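(* Let $X$ be an infinite dimensional complex Banach space, let $T\in L(X)$ and let $1\le i\le 6$. The following conditions are equivalent: (i) there exists $(M,N)\in Red(T)$ such that $T_M\in \mathbf{R}_i$ and $T_N$ is quasinilpotent, that is, $T\in \mathbf{gDR}_i$; (ii) $T$ admits a generalized Kato decomposition and $0$ is not an accumulation point of $\sigma_{\mathbf{R}_i}(T)$; (iii) $T$ admits a generalized Kato decomposition and $0$ is not an interior point of $\sigma_{\mathbf{R}_i}(T)$; (iv) there exists a projection $P\in L(X)$ that commutes with $T$ such that $T+P\in\mathbf{R}_i$ and $TP$ is quasinilpotent.
   Context: $L(Y)$ is the algebra of bounded linear operators on a Banach space $Y$; $T-\lambda$ means $T-\lambda I$. For a Banach space $Y$ (finite dimensional or zero spaces allowed) and $S\in L(Y)$, $N(S)$ and $R(S)$ are the kernel and range, $\alpha(S)=\dim N(S)$, $\beta(S)=\operatorname{codim}R(S)$. $S$ is upper semi-Fredholm ($S\in\Phi_+(Y)$) if $R(S)$ is closed and $\alpha(S)<\infty$; lower semi-Fredholm ($S\in\Phi_-(Y)$) if $\beta(S)<\infty$; Fredholm ($S\in\Phi(Y)$) if both $\alpha(S),\beta(S)<\infty$; for a semi-Fredholm $S$, $\operatorname{ind}(S)=\alpha(S)-\beta(S)$. $\mathcal{W}_+(Y)=\{S\in\Phi_+(Y):\operatorname{ind}(S)\le 0\}$, $\mathcal{W}_-(Y)=\{S\in\Phi_-(Y):\operatorname{ind}(S)\ge 0\}$, $\mathcal{W}(Y)=\{S\in\Phi(Y):\operatorname{ind}(S)=0\}$.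 $\mathbf{R}_1=\Phi_+$, $\mathbf{R}_2=\Phi_-$, $\mathbf{R}_3=\Phi$, $\mathbf{R}_4=\mathcal{W}_+$, $\mathbf{R}_5=\mathcal{W}_-$, $\mathbf{R}_6=\mathcal{W}$, where membership of an operator in $\mathbf{R}_i$ refers to the class on the space on which the operator acts. $\sigma_{\mathbf{R}_i}(T)=\{\lambda\in\mathbb{C}:T-\lambda\notin\mathbf{R}_i\}$. $(M,N)\in Red(T)$ means that $M,N$ are closed $T$-invariant subspaces of $X$ with $X=M\oplus N$; $T_M\in L(M)$, $T_N\in L(N)$ are the restrictions of $T$. $\mathbf{gDR}_i$ is the class of $T\in L(X)$ for which there is $(M,N)\in Red(T)$ with $T_M\in\mathbf{R}_i$ and $T_N$ quasinilpotent ($S$ is quasinilpotent if $\|S^n\|^{1/n}\to0$). $S\in L(Y)$ is Kato if $R(S)$ is closed and $N(S)\subset R(S^n)$ for all $n\ge 0$. $T$ admits a generalized Kato decomposition if there is $(M,N)\in Red(T)$ such that $T_M$ is Kato and $T_N$ is quasinilpotent. *)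

theory Defs
  imports "HOL-Analysis.Analysis"
begin

section \<open>Complex Banach spaces\<close>

class complex_normed_vector = real_normed_vector +
  fixes scaleC :: "complex \<Rightarrow> 'a \<Rightarrow> 'a" (infixr \<open>*\<^sub>C\<close> 75)
  assumes scaleC_add_right: "c *\<^sub>C (x + y) = c *\<^sub>C x + c *\<^sub>C y"
    and scaleC_add_left: "(c + d) *\<^sub>C x = c *\<^sub>C x + d *\<^sub>C x"
    and scaleC_scaleC: "c *\<^sub>C (d *\<^sub>C x) = (c * d) *\<^sub>C x"
    and scaleC_one: "1 *\<^sub>C x = x"
    and scaleR_scaleC: "r *\<^sub>R x = complex_of_real r *\<^sub>C x"
    and norm_scaleC: "norm (c *\<^sub>C x) = cmod c * norm x"

class complex_banach = complex_normed_vector + banach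

global_interpretation complex_vector: vector_space "scaleC :: complex \<Rightarrow> 'a \<Rightarrow> 'a::complex_normed_vector"
  by unfold_locales
    (simp_all add: scaleC_add_right scaleC_add_left scaleC_scaleC scaleC_one)

instantiation complex :: complex_banach
begin

definition scaleC_complex :: "complex \<Rightarrow> complex \<Rightarrow> complex" where
  "scaleC_complex c x = c * x"

instance
  by standard (auto simp: scaleC_complex_def algebra_simps norm_mult scaleR_conv_of_real)

end


section \<open>Dimension and codimension\<close>

text \<open>The library dimension is \<open>0\<close> on infinite dimensional spaces, hence the case distinction.\<close>

definition edim :: "'a::complex_normed_vector set \<Rightarrow> enat" where
  "edim V = (if \<exists>B. finite B \<and> V \<subseteq> complex_vector.span B
             then enat (complex_vector.dim V) else \<infinity>)"

definition direct_sum :: "'a::complex_normed_vector set \<Rightarrow> 'a set \<Rightarrow> 'a set \<Rightarrow> bool" where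
  "direct_sum Y M N \<longleftrightarrow> complex_vector.subspace M \<and> complex_vector.subspace N \<and>
     M \<inter> N = {0} \<and> Y = {m + n | m n. m \<in> M \<and> n \<in> N}"

text \<open>The codimension of \<open>R\<close> in \<open>Y\<close>, i.e. the dimension of \<open>Y / R\<close>, is the dimension of an
  algebraic complement of \<open>R\<close> in \<open>Y\<close>. Complements exist, and by \<open>ecodim_eq\<close> below they all
  have the same dimension, so the infimum is that common value.\<close>

definition ecodim :: "'a::complex_normed_vector set \<Rightarrow> 'a set \<Rightarrow> enat" where
  "ecodim Y R = (INF W \<in> {W. direct_sum Y R W}. edim W)"

lemma edim_complement_le:
  assumes V: "direct_sum Y R V" and W: "direct_sum Y R W"
  shows "edim W \<le> edim V"
proof (cases "\<exists>B. finite B \<and> V \<subseteq> complex_vector.span B")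
  case False
  then have "edim V = \<infinity>" unfolding edim_def by (rule if_not_P)
  then show ?thesis by simp
next
  case True
  have subV: "complex_vector.subspace V" and subW: "complex_vector.subspace W"
    and subR: "complex_vector.subspace R" and RW: "R \<inter> W = {0}"
    and YV: "Y = {r + v | r v. r \<in> R \<and> v \<in> V}" and YW: "Y = {r + w | r w. r \<in> R \<and> w \<in> W}"
    using V W by (auto simp: direct_sum_def)
  obtain B where B: "B \<subseteq> V" "complex_vector.independent B" "V \<subseteq> complex_vector.span B"
    "card B = complex_vector.dim V"
    using complex_vector.basis_exists by blast
  obtain C where C: "finite C" "V \<subseteq> complex_vector.span C" using True by blast
  have finB: "finite B"
    using complex_vector.independent_span_bound[OF C(1) B(2)] B(1) C(2) by blast
  have "\<exists>w\<in>W. b - w \<in> R" if b: "b \<in> V" for b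
  proof -
    have "b \<in> Y"
      unfolding YV using b complex_vector.subspace_0[OF subR] by force
    then obtain r w where "b = r + w" "r \<in> R" "w \<in> W" unfolding YW by blast
    then show ?thesis by force
  qed
  then obtain g where g: "\<And>b. b \<in> V \<Longrightarrow> g b \<in> W \<and> b - g b \<in> R" by metis
  have gW: "complex_vector.span (g ` B) \<subseteq> W"
    using g B(1) by (intro complex_vector.span_minimal subW) auto
  have lift: "\<exists>u \<in> complex_vector.span (g ` B). v - u \<in> R" if "v \<in> complex_vector.span B" for v
    using that
  proof (induction rule: complex_vector.span_induct_alt)
    case base
    show ?case using complex_vector.span_zero complex_vector.subspace_0[OF subR] by force
  next
    case (step c x y)
    then obtain u where u: "u \<in> complex_vector.span (g ` B)" "y - u \<in> R" by blast
    have "c *\<^sub>C (x - g x) + (y - u) \<in> R"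
      using step.hyps g B(1) u(2)
      by (intro complex_vector.subspace_add[OF subR] complex_vector.subspace_scale[OF subR]) auto
    moreover have "c *\<^sub>C (x - g x) + (y - u) = (c *\<^sub>C x + y) - (c *\<^sub>C g x + u)"
      by (simp add: complex_vector.scale_right_diff_distrib)
    moreover have "c *\<^sub>C g x + u \<in> complex_vector.span (g ` B)"
      using step.hyps u(1)
      by (intro complex_vector.span_add complex_vector.span_scale)
        (auto intro: complex_vector.span_base)
    ultimately show ?case by metis
  qed
  have WB: "W \<subseteq> complex_vector.span (g ` B)"
  proof
    fix w assume w: "w \<in> W"
    then have "w \<in> Y"
      unfolding YW using complex_vector.subspace_0[OF subR] by force
    then obtain r v where rv: "w = r + v" "r \<in> R" "v \<in> V" unfolding YV by blast
    then obtain u where u: "u \<in> complex_vector.span (g ` B)" "v - u \<in> R" using lift B(3) by blast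
    have "w - u = r + (v - u)" using rv by simp
    then have "w - u \<in> R" using complex_vector.subspace_add[OF subR rv(2) u(2)] by (simp only:)
    moreover have "w - u \<in> W" using complex_vector.subspace_diff[OF subW w] u(1) gW by blast
    ultimately have "w - u = 0" using RW by blast
    then show "w \<in> complex_vector.span (g ` B)" using u(1) by simp
  qed
  have "complex_vector.dim W \<le> card (g ` B)"
    by (rule complex_vector.dim_le_card[OF WB]) (simp add: finB)
  also have "\<dots> \<le> complex_vector.dim V" using B(4) card_image_le[OF finB] by simp
  finally have "complex_vector.dim W \<le> complex_vector.dim V" .
  moreover have "\<exists>B. finite B \<and> W \<subseteq> complex_vector.span B" using WB finB by blast
  ultimately show ?thesis using True unfolding edim_def by simp
qed

lemma ecodim_eq:
  assumes "direct_sum Y R W"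
  shows "ecodim Y R = edim W"
  unfolding ecodim_def
  by (rule antisym) (auto intro: INF_lower INF_greatest edim_complement_le assms)


section \<open>Operators on closed subspaces\<close>

text \<open>An operator on a closed subspace \<open>Y\<close> is represented by a function on the whole type, of
  which only the values on \<open>Y\<close> matter. In particular, the restriction \<open>T\<^sub>M\<close> of \<open>T\<close> to an
  invariant subspace \<open>M\<close> is \<open>T\<close> itself, regarded as an operator on \<open>M\<close>.\<close>

definition bounded_ops :: "'a::complex_normed_vector set \<Rightarrow> ('a \<Rightarrow> 'a) set" where
  "bounded_ops Y = {S. S ` Y \<subseteq> Y \<and>
     (\<forall>x\<in>Y. \<forall>y\<in>Y. S (x + y) = S x + S y) \<and>
     (\<forall>c. \<forall>x\<in>Y. S (c *\<^sub>C x) = c *\<^sub>C S x) \<and>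
     (\<exists>K. \<forall>x\<in>Y. norm (S x) \<le> K * norm x)}"

lemma bounded_ops_UNIV:
  "S \<in> bounded_ops UNIV \<longleftrightarrow> bounded_linear S \<and> (\<forall>c x. S (c *\<^sub>C x) = c *\<^sub>C S x)"
proof
  assume S: "S \<in> bounded_ops UNIV"
  then obtain K where "\<And>x. norm (S x) \<le> norm x * K"
    by (auto simp: bounded_ops_def mult.commute)
  with S have "bounded_linear S"
    by (intro bounded_linear_intro) (auto simp: bounded_ops_def scaleR_scaleC)
  with S show "bounded_linear S \<and> (\<forall>c x. S (c *\<^sub>C x) = c *\<^sub>C S x)"
    by (simp add: bounded_ops_def)
next
  assume "bounded_linear S \<and> (\<forall>c x. S (c *\<^sub>C x) = c *\<^sub>C S x)"
  then show "S \<in> bounded_ops UNIV"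
    using bounded_linear.bounded[of S]
    by (auto simp: bounded_ops_def mult.commute linear_add bounded_linear.linear)
qed

definition kernel_on :: "'a::complex_normed_vector set \<Rightarrow> ('a \<Rightarrow> 'a) \<Rightarrow> 'a set" where
  "kernel_on Y S = {x \<in> Y. S x = 0}"

definition nullity :: "'a::complex_normed_vector set \<Rightarrow> ('a \<Rightarrow> 'a) \<Rightarrow> enat" where
  "nullity Y S = edim (kernel_on Y S)"

definition defect :: "'a::complex_normed_vector set \<Rightarrow> ('a \<Rightarrow> 'a) \<Rightarrow> enat" where
  "defect Y S = ecodim Y (S ` Y)"

definition fredholm_index :: "'a::complex_normed_vector set \<Rightarrow> ('a \<Rightarrow> 'a) \<Rightarrow> ereal" where
  "fredholm_index Y S = ereal_of_enat (nullity Y S) - ereal_of_enat (defect Y S)"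

definition upper_semi_fredholm :: "'a::complex_normed_vector set \<Rightarrow> ('a \<Rightarrow> 'a) set" where
  "upper_semi_fredholm Y =
     {S \<in> bounded_ops Y. closedin (top_of_set Y) (S ` Y) \<and> nullity Y S < \<infinity>}"

definition lower_semi_fredholm :: "'a::complex_normed_vector set \<Rightarrow> ('a \<Rightarrow> 'a) set" where
  "lower_semi_fredholm Y = {S \<in> bounded_ops Y. defect Y S < \<infinity>}"

definition fredholm :: "'a::complex_normed_vector set \<Rightarrow> ('a \<Rightarrow> 'a) set" where
  "fredholm Y = {S \<in> bounded_ops Y. nullity Y S < \<infinity> \<and> defect Y S < \<infinity>}"

definition upper_semi_weyl :: "'a::complex_normed_vector set \<Rightarrow> ('a \<Rightarrow> 'a) set" where
  "upper_semi_weyl Y = {S \<in> upper_semi_fredholm Y. fredholm_index Y S \<le> 0}"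

definition lower_semi_weyl :: "'a::complex_normed_vector set \<Rightarrow> ('a \<Rightarrow> 'a) set" where
  "lower_semi_weyl Y = {S \<in> lower_semi_fredholm Y. fredholm_index Y S \<ge> 0}"

definition weyl :: "'a::complex_normed_vector set \<Rightarrow> ('a \<Rightarrow> 'a) set" where
  "weyl Y = {S \<in> fredholm Y. fredholm_index Y S = 0}"

definition regularity :: "nat \<Rightarrow> 'a::complex_normed_vector set \<Rightarrow> ('a \<Rightarrow> 'a) set" where
  "regularity i Y =
    (if i = 1 then upper_semi_fredholm Y
     else if i = 2 then lower_semi_fredholm Y
     else if i = 3 then fredholm Y
     else if i = 4 then upper_semi_weyl Y
     else if i = 5 then lower_semi_weyl Y
     else if i = 6 then weyl Y
     else {})"

definition regularity_spectrum :: "nat \<Rightarrow> ('a::complex_normed_vector \<Rightarrow> 'a) \<Rightarrow> complex set" where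
  "regularity_spectrum i T = {l. (\<lambda>x. T x - l *\<^sub>C x) \<notin> regularity i UNIV}"

text \<open>For \<open>Y = UNIV\<close> this is the library's \<open>onorm\<close>.\<close>

definition onorm_on :: "'a::complex_normed_vector set \<Rightarrow> ('a \<Rightarrow> 'a) \<Rightarrow> real" where
  "onorm_on Y S = (SUP x\<in>Y. norm (S x) / norm x)"

definition quasinilpotent :: "'a::complex_normed_vector set \<Rightarrow> ('a \<Rightarrow> 'a) \<Rightarrow> bool" where
  "quasinilpotent Y S \<longleftrightarrow> S \<in> bounded_ops Y \<and>
     (\<lambda>n. root n (onorm_on Y (S ^^ n))) \<longlonglongrightarrow> 0"

definition kato :: "'a::complex_normed_vector set \<Rightarrow> ('a \<Rightarrow> 'a) \<Rightarrow> bool" where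
  "kato Y S \<longleftrightarrow> S \<in> bounded_ops Y \<and> closedin (top_of_set Y) (S ` Y) \<and>
     (\<forall>n. kernel_on Y S \<subseteq> (S ^^ n) ` Y)"

definition Red :: "('a::complex_normed_vector \<Rightarrow> 'a) \<Rightarrow> ('a set \<times> 'a set) set" where
  "Red T = {(M, N). closed M \<and> closed N \<and> T ` M \<subseteq> M \<and> T ` N \<subseteq> N \<and> direct_sum UNIV M N}"

definition gDR :: "nat \<Rightarrow> ('a::complex_normed_vector \<Rightarrow> 'a) set" where
  "gDR i = {T \<in> bounded_ops UNIV.
     \<exists>(M, N) \<in> Red T. T \<in> regularity i M \<and> quasinilpotent N T}"

definition generalized_kato_decomposition :: "('a::complex_normed_vector \<Rightarrow> 'a) \<Rightarrow> bool" where
  "generalized_kato_decomposition T \<longleftrightarrow> (\<exists>(M, N) \<in> Red T. kato M T \<and> quasinilpotent N T)"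

end

theory Submission
  imports Defs
begin

text \<open>A Kato operator \<open>S\<close> has shifts \<open>S - \<lambda>\<close> for which \<open>(S - \<lambda>) x = y\<close> is solvable on
  the range with a bound uniform in small \<open>\<lambda>\<close>. This makes nullity and defect locally constant,
  hence, by connectedness, constant on a disc around \<open>0\<close>; in particular \<open>S\<close> and \<open>S - \<lambda>\<close>
  belong to the same classes. On the quasinilpotent summand all shifts by \<open>\<lambda> \<noteq> 0\<close> are bijective,
  so for a generalized Kato decomposition \<open>(M, N)\<close> the class of \<open>T - \<lambda>\<close> near \<open>0\<close> is that of the
  restriction to \<open>M\<close>. An operator in one of the six classes is brought into Kato form by splitting
  off finitely many finite dimensional nilpotent Jordan blocks, each of which lowers both nullity
  and defect by one.\<close>

text \<open>The nullity of \<open>T - \<lambda>\<close> can in general be smaller for every small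
  nonzero \<lambda> than at 0, so stability cannot be read off a semi-Fredholm operator directly.
  The kernel condition of a Kato operator excludes this jump: it places the kernel in the
  generalized range, on which the operator is onto. Closed range is carried in quantitative form, as
  the constant of \<open>bounded_solvable\<close>; one constant valid at all points of a disc gives
  both semicontinuities of nullity and of defect at every centre. Defects are estimated in the space
  itself, with complements and finite rank projections built from Hahn--Banach functionals. The six
  classes see only closedness of the range, finiteness of nullity and defect, and their difference,
  all of which survive the removal of a Jordan block; each class forces one of the two numbers to be
  finite, so the removal stops. In (iv) the shift by -1 plays the part of the small shift: on the
  quasinilpotent summand any nonzero \<lambda> will do.\<close>

abbreviation csubspace :: "'a::complex_normed_vector set \<Rightarrow> bool" where
  "csubspace \<equiv> complex_vector.subspace"

abbreviation cspan :: "'a::complex_normed_vector set \<Rightarrow> 'a set" where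
  "cspan \<equiv> complex_vector.span"

lemma csubspace_imp_subspace: "csubspace V \<Longrightarrow> subspace V"
  by (simp add: complex_vector.subspace_def subspace_def scaleR_scaleC)

section \<open>Solvability with bounds and the open mapping theorem\<close>

text \<open>Successive approximation: the residual \<open>y - F x\<close> lies in \<open>G\<close>
  again and is corrected in turn. Residuals and corrections shrink by half each time, and the
  corrections sum in the complete domain to an exact solution; the geometric series gives the factor
  2.\<close>

lemma approx_solvable_imp_solvable:
  fixes F :: "'b::banach \<Rightarrow> 'a::real_normed_vector"
  assumes F: "bounded_linear F" and E: "closed E" "subspace E" and G: "subspace G" "F ` E \<subseteq> G"
    and ap: "\<And>y. y \<in> G \<Longrightarrow> \<exists>x\<in>E. norm x \<le> C * norm y \<and> norm (y - F x) \<le> norm y / 2"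
    and y: "y \<in> G"
  shows "\<exists>x\<in>E. F x = y \<and> norm x \<le> 2 * C * norm y"
proof -
  interpret F: bounded_linear F by fact
  obtain h where h: "\<And>y. y \<in> G \<Longrightarrow> h y \<in> E \<and> norm (h y) \<le> C * norm y \<and> norm (y - F (h y)) \<le> norm y / 2"
    using ap by metis
  define r where "r = (\<lambda>n. ((\<lambda>y. y - F (h y)) ^^ n) y)"
  have r0: "r 0 = y" and rS: "r (Suc n) = r n - F (h (r n))" for n by (simp_all add: r_def)
  have r: "r n \<in> G \<and> norm (r n) \<le> norm y * (1/2) ^ n" for n
  proof (induction n)
    case 0 then show ?case using y by (simp add: r0)
  next
    case (Suc n)
    then show ?case using h[of "r n"] G by (auto simp: rS intro!: subspace_diff[OF G(1)])
  qed
  define x where "x = (\<lambda>n. h (r n))"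
  \<comment> \<open>If \<open>C\<close> is negative this forces \<open>y = 0\<close>, and then all
    residuals vanish; hence the case distinction in \<open>xb\<close>.\<close>
  have Cy: "0 \<le> C * norm y" using h[OF y] by (meson norm_ge_zero order_trans)
  have xb: "norm (x n) \<le> C * norm y * (1/2) ^ n" for n
  proof (cases "y = 0")
    case True
    then show ?thesis using h[of "r n"] r[of n] by (auto simp: x_def)
  next
    case False
    then have "0 \<le> C" using Cy by (simp add: zero_le_mult_iff)
    have "norm (x n) \<le> C * norm (r n)" using h[of "r n"] r[of n] by (simp add: x_def)
    also have "\<dots> \<le> C * (norm y * (1/2) ^ n)" using r[of n] \<open>0 \<le> C\<close> by (intro mult_left_mono) auto
    finally show ?thesis by (simp add: mult.assoc)
  qed
  have xE: "x n \<in> E" for n using h r by (auto simp: x_def)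
  have geo: "(\<lambda>n. C * norm y * (1/2) ^ n) sums (C * norm y * 2)"
    using sums_mult[OF geometric_sums[of "1/2::real"], of "C * norm y"] by simp
  have nsum: "summable (\<lambda>n. norm (x n))"
    by (rule summable_comparison_test'[OF sums_summable[OF geo], of 0]) (simp add: xb)
  have sx: "x sums suminf x" using nsum by (simp add: summable_norm_cancel summable_sums)
  have "suminf x \<in> E"
    by (rule closed_sequentially[OF E(1) _ sx[unfolded sums_def]]) (auto intro: subspace_sum[OF E(2)] xE)
  moreover have "norm (suminf x) \<le> 2 * C * norm y"
  proof -
    have "norm (suminf x) \<le> (\<Sum>n. norm (x n))" by (rule summable_norm[OF nsum])
    also have "\<dots> \<le> C * norm y * 2"
      using suminf_le[OF xb nsum sums_summable[OF geo]] sums_unique[OF geo] by simp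
    finally show ?thesis by simp
  qed
  moreover have "F (suminf x) = y"
  proof -
    have part: "F (\<Sum>k<n. x k) = y - r n" for n
      by (induction n) (simp_all add: r0 rS F.add x_def F.zero)
    have "r \<longlonglongrightarrow> 0"
    proof (rule Lim_null_comparison)
      show "\<forall>\<^sub>F n in sequentially. norm (r n) \<le> norm y * (1/2) ^ n" using r by simp
      show "(\<lambda>n. norm y * (1/2) ^ n) \<longlonglongrightarrow> 0"
        by (intro tendsto_mult_right_zero LIMSEQ_power_zero) simp
    qed
    then have "(\<lambda>n. y - r n) \<longlonglongrightarrow> y" using tendsto_diff[OF tendsto_const, of r 0 _ y] by simp
    moreover have "(\<lambda>n. F (\<Sum>k<n. x k)) \<longlonglongrightarrow> F (suminf x)"
      using F.tendsto[OF sx[unfolded sums_def]] .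
    ultimately show ?thesis unfolding part using LIMSEQ_unique by blast
  qed
  ultimately show ?thesis by blast
qed

text \<open>The range is closed, hence of second category in itself, so some closure
  \<open>D n\<close> of the image of a ball has an interior point \<open>y0\<close>. Subtracting
  approximate preimages of \<open>y0\<close> and of \<open>y0 + t *\<^sub>R y\<close> gives an
  approximate preimage of \<open>t *\<^sub>R y\<close>, which successive approximation makes
  exact.\<close>

lemma open_mapping_bound:
  fixes F :: "'b::banach \<Rightarrow> 'a::banach"
  assumes F: "bounded_linear F" and E: "closed E" "subspace E" and G: "closed (F ` E)"
  shows "\<exists>C>0. \<forall>y\<in>F ` E. \<exists>x\<in>E. F x = y \<and> norm x \<le> C * norm y"
proof -
  interpret F: bounded_linear F by fact
  let ?G = "F ` E"
  have subG: "subspace ?G" by (intro linear_subspace_image F.linear E)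
  define D where "D n = ?G \<inter> closure (F ` (E \<inter> cball 0 (real n)))" for n
  have cov: "\<Union>(range D) = ?G"
  proof -
    have "F x \<in> D (nat \<lceil>norm x\<rceil>)" if "x \<in> E" for x
      using that unfolding D_def by (auto intro!: subsetD[OF closure_subset])
    then show ?thesis unfolding D_def by fast
  qed
  have "\<exists>n. (top_of_set ?G) interior_of (D n) \<noteq> {}"
  proof (rule ccontr)
    assume "\<not> ?thesis"
    moreover have "closedin (top_of_set ?G) (D n)" for n
      unfolding D_def by (simp add: closedin_closed_Int)
    moreover have "completely_metrizable_space (top_of_set ?G)"
      using G by (simp add: completely_metrizable_space_closedin completely_metrizable_space_euclidean)
    ultimately have "(top_of_set ?G) interior_of (\<Union>(range D)) = {}"
      by (intro Baire_category_alt) auto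
    then show False
      using E(2) subspace_0 by (auto simp: cov interior_of_topspace[of "top_of_set ?G", simplified])
  qed
  then obtain n y0 where "y0 \<in> (top_of_set ?G) interior_of (D n)" by blast
  then obtain U where U: "openin (top_of_set ?G) U" "y0 \<in> U" "U \<subseteq> D n"
    unfolding interior_of_def by blast
  then obtain e where e: "e > 0" "ball y0 e \<inter> ?G \<subseteq> U" and y0: "y0 \<in> ?G"
    unfolding openin_contains_ball by blast
  have near: "\<exists>a\<in>E. norm a \<le> real n \<and> norm (z - F a) < d" if "z \<in> ?G" "norm (z - y0) < e" "d > 0" for z d
  proof -
    have "z \<in> D n" using that e U(3) by (auto simp: dist_norm norm_minus_commute)
    then have "z \<in> closure (F ` (E \<inter> cball 0 (real n)))" by (simp add: D_def)
    then show ?thesis using \<open>d > 0\<close>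
      by (fastforce simp: closure_approachable dist_norm norm_minus_commute)
  qed
  \<comment> \<open>The difference \<open>a - b\<close> has norm at most \<open>2 * real n\<close>
    and is rescaled by \<open>1 / t = 2 * norm y / e\<close>, which gives
    \<open>4 * real n / e\<close>; the added 1 keeps \<open>C\<close> positive for
    \<open>n = 0\<close>. The two errors \<open>e / 8\<close> rescale to
    \<open>norm y / 2\<close>.\<close>
  define C where "C = 4 * (real n + 1) / e"
  have Cpos: "C > 0" using e by (simp add: C_def)
  have ap: "\<exists>x\<in>E. norm x \<le> C * norm y \<and> norm (y - F x) \<le> norm y / 2" if y: "y \<in> ?G" for y
  proof (cases "y = 0")
    case True
    then show ?thesis using E(2) subspace_0 by (intro bexI[of _ 0]) (auto simp: F.zero)
  next
    case False
    define t where "t = e / (2 * norm y)"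
    have t: "t > 0" using e False by (simp add: t_def)
    have ty: "norm (t *\<^sub>R y) = e / 2" using False e by (simp add: t_def)
    have "y0 + t *\<^sub>R y \<in> ?G" using y y0 subG by (intro subspace_add subspace_scale)
    then obtain a where a: "a \<in> E" "norm a \<le> real n" "norm (y0 + t *\<^sub>R y - F a) < e / 8"
      using near[of "y0 + t *\<^sub>R y" "e / 8"] ty e by auto
    obtain b where b: "b \<in> E" "norm b \<le> real n" "norm (y0 - F b) < e / 8"
      using near[of y0 "e / 8"] y0 e by auto
    define x where "x = (1 / t) *\<^sub>R (a - b)"
    have "x \<in> E" using a b E unfolding x_def by (intro subspace_scale subspace_diff)
    moreover have "norm x \<le> C * norm y"
    proof -
      have "norm (a - b) \<le> 2 * real n" using norm_triangle_ineq4[of a b] a b by simp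
      then have "norm x \<le> (1 / t) * (2 * real n)" unfolding x_def using t
        by (simp add: divide_right_mono)
      also have "\<dots> \<le> C * norm y" using e False by (simp add: C_def t_def field_simps)
      finally show ?thesis .
    qed
    moreover have "norm (y - F x) \<le> norm y / 2"
    proof -
      have "y - F x = (1 / t) *\<^sub>R ((y0 + t *\<^sub>R y - F a) - (y0 - F b))"
        using t by (simp add: x_def F.diff F.scaleR algebra_simps)
      then have "norm (y - F x) = (1 / t) * norm ((y0 + t *\<^sub>R y - F a) - (y0 - F b))" using t by simp
      also have "\<dots> \<le> (1 / t) * (e / 4)"
        using norm_triangle_ineq4[of "y0 + t *\<^sub>R y - F a" "y0 - F b"] a b t
        by (intro mult_left_mono) auto
      also have "\<dots> = norm y / 2" using e False by (simp add: t_def)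
      finally show ?thesis .
    qed
    ultimately show ?thesis by blast
  qed
  show ?thesis
    by (intro exI[of _ "2 * C"] conjI ballI approx_solvable_imp_solvable[OF F E subG order_refl ap])
      (use Cpos in auto)
qed

lemma subspace_closure:
  fixes V :: "'a::real_normed_vector set"
  assumes V: "subspace V" shows "subspace (closure V)"
proof (rule subspaceI)
  show "0 \<in> closure V" using subspace_0[OF V] closure_subset by blast
  fix x y assume "x \<in> closure V" "y \<in> closure V"
  then obtain a b where "\<And>n. a n \<in> V" "a \<longlonglongrightarrow> x" "\<And>n. b n \<in> V" "b \<longlonglongrightarrow> y"
    unfolding closure_sequential by blast
  then show "x + y \<in> closure V"
    unfolding closure_sequential
    by (intro exI[of _ "\<lambda>n. a n + b n"]) (simp add: subspace_add[OF V] tendsto_add)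
next
  fix c x assume "x \<in> closure V"
  then obtain a where "\<And>n. a n \<in> V" "a \<longlonglongrightarrow> x"
    unfolding closure_sequential by blast
  then show "c *\<^sub>R x \<in> closure V"
    unfolding closure_sequential
    by (intro exI[of _ "\<lambda>n. c *\<^sub>R a n"]) (simp add: subspace_scale[OF V] tendsto_scaleR)
qed

text \<open>A point of the closure is close to an image point of comparable norm, whose controlled
  preimage solves the equation up to half the norm. Successive approximation with the closure as
  \<open>G\<close> then puts the point itself into the image.\<close>

lemma closed_image_of_bounded_solvable:
  fixes F :: "'b::banach \<Rightarrow> 'a::real_normed_vector"
  assumes F: "bounded_linear F" and E: "closed E" "subspace E"
    and sol: "\<And>y. y \<in> F ` E \<Longrightarrow> \<exists>x\<in>E. F x = y \<and> norm x \<le> C * norm y"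
  shows "closed (F ` E)"
proof -
  interpret F: bounded_linear F by fact
  have subG: "subspace (F ` E)" by (intro linear_subspace_image F.linear E)
  have subC: "subspace (closure (F ` E))" by (rule subspace_closure[OF subG])
  have "\<exists>x\<in>E. F x = y \<and> norm x \<le> 2 * (2 * \<bar>C\<bar>) * norm y" if y: "y \<in> closure (F ` E)" for y
  proof (rule approx_solvable_imp_solvable[OF F E subC closure_subset _ y])
    fix y assume y: "y \<in> closure (F ` E)"
    show "\<exists>x\<in>E. norm x \<le> (2 * \<bar>C\<bar>) * norm y \<and> norm (y - F x) \<le> norm y / 2"
    proof (cases "y = 0")
      case True
      then show ?thesis using E(2) subspace_0 by (intro bexI[of _ 0]) (auto simp: F.zero)
    next
      case False
      then obtain y' where y': "y' \<in> F ` E" "dist y' y < norm y / 2"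
        using y unfolding closure_approachable by (metis half_gt_zero zero_less_norm_iff)
      then obtain x where x: "x \<in> E" "F x = y'" "norm x \<le> C * norm y'" using sol by blast
      have "norm y' \<le> 2 * norm y"
        using y'(2) norm_triangle_ineq[of "y' - y" y] norm_ge_zero[of y] unfolding dist_norm diff_add_cancel by linarith
      then have "C * norm y' \<le> \<bar>C\<bar> * (2 * norm y)"
        by (intro mult_mono) auto
      then show ?thesis using x y'(2)
        by (intro bexI[of _ x]) (auto simp: dist_norm norm_minus_commute)
    qed
  qed
  then have "closure (F ` E) \<subseteq> F ` E" by blast
  then show ?thesis using closure_subset_eq by blast
qed

text \<open>Applied to \<open>y - v\<close>, the hypothesis bounds the distance from
  \<open>y\<close> to \<open>V\<close> by half of \<open>dist y v\<close>. The infimum over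
  \<open>v\<close> makes that distance at most half of itself, hence 0.\<close>

lemma closed_subspace_eq_of_half_approx:
  fixes V :: "'a::real_normed_vector set"
  assumes V: "closed V" "subspace V" "V \<subseteq> Y" and Y: "subspace Y"
    and ap: "\<And>y. y \<in> Y \<Longrightarrow> \<exists>v\<in>V. norm (y - v) \<le> norm y / 2"
  shows "V = Y"
proof
  show "Y \<subseteq> V"
  proof
    fix y assume y: "y \<in> Y"
    have "infdist y V / (1/2) \<le> dist y v" if v: "v \<in> V" for v
    proof -
      obtain w where w: "w \<in> V" "norm (y - v - w) \<le> norm (y - v) / 2"
        using ap[of "y - v"] y v V Y by (meson subsetD subspace_diff)
      have "infdist y V \<le> dist y (v + w)" using v w(1) V by (intro infdist_le subspace_add)
      then show ?thesis using w(2) by (simp add: dist_norm algebra_simps)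
    qed
    then have "infdist y V / (1/2) \<le> infdist y V"
      using subspace_0[OF V(2)] by (subst (2) infdist_notempty) (auto intro!: cINF_greatest)
    then have "infdist y V = 0" using infdist_nonneg[of y V] by simp
    then show "y \<in> V" using in_closed_iff_infdist_zero[OF V(1)] subspace_0[OF V(2)] by blast
  qed
qed (rule V)

section \<open>The Hahn--Banach theorem\<close>

definition sublinear :: "('a::real_vector \<Rightarrow> real) \<Rightarrow> bool" where
  "sublinear q \<longleftrightarrow> (\<forall>x y. q (x + y) \<le> q x + q y) \<and> (\<forall>t x. 0 \<le> t \<longrightarrow> q (t *\<^sub>R x) \<le> t * q x)"

lemma sublinear_lower:
  assumes "sublinear q" shows "- q (- x) \<le> q x"
proof -
  have "0 \<le> q 0" using assms[unfolded sublinear_def, THEN conjunct1, rule_format, of 0 0] by simp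
  also have "\<dots> \<le> q x + q (- x)" using assms[unfolded sublinear_def, THEN conjunct1, rule_format, of x "- x"] by simp
  finally show ?thesis by simp
qed

text \<open>\<open>q'\<close> lowers \<open>q\<close> along the ray through \<open>y\<close> as far
  as sublinearity allows; \<open>t = 1\<close> at the point \<open>- y\<close> gives the last
  inequality. A minimal functional must agree with all its tilts, which is how linearity is
  obtained.\<close>

lemma sublinear_tilt:
  fixes q :: "'a::real_vector \<Rightarrow> real"
  assumes q: "sublinear q"
  obtains q' where "sublinear q'" "q' \<le> q" "q' (- y) \<le> - q y"
proof
  define q' where "q' x = (INF t\<in>{0..}. q (x + t *\<^sub>R y) - t * q y)" for x
  have add: "q (a + b) \<le> q a + q b" and scale: "0 \<le> t \<Longrightarrow> q (t *\<^sub>R a) \<le> t * q a" for a b t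
    using q by (auto simp: sublinear_def)
  have bdd: "bdd_below ((\<lambda>t. q (x + t *\<^sub>R y) - t * q y) ` {0..})" for x
  proof (rule bdd_belowI2)
    fix t :: real assume "t \<in> {0..}"
    then have t: "0 \<le> t" by simp
    have "t * q y \<le> q (t *\<^sub>R y)"
    proof (cases "t = 0")
      case True then show ?thesis using sublinear_lower[OF q, of 0] by simp
    next
      case False
      then show ?thesis using scale[of "1 / t" "t *\<^sub>R y"] t by (simp add: field_simps)
    qed
    also have "\<dots> \<le> q (x + t *\<^sub>R y) + q (- x)" using add[of "x + t *\<^sub>R y" "- x"] by simp
    finally show "- q (- x) \<le> q (x + t *\<^sub>R y) - t * q y" by simp
  qed
  have lower: "q' x \<le> q (x + t *\<^sub>R y) - t * q y" if "0 \<le> t" for x t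
    unfolding q'_def by (rule cINF_lower[OF bdd]) (simp add: that)
  have greatest: "c \<le> q' x" if "\<And>t. 0 \<le> t \<Longrightarrow> c \<le> q (x + t *\<^sub>R y) - t * q y" for c x
    unfolding q'_def by (rule cINF_greatest) (auto simp: that)
  show "q' \<le> q" using lower[of 0] by (auto simp: le_fun_def)
  show "q' (- y) \<le> - q y"
    using lower[of 1 "- y"] scale[of 0 0] by simp
  show "sublinear q'" unfolding sublinear_def
  proof (intro conjI allI impI)
    fix a b
    have "q' (a + b) - q' b \<le> q' a"
    proof (rule greatest)
      fix t :: real assume t: "0 \<le> t"
      have "q' (a + b) - (q (a + t *\<^sub>R y) - t * q y) \<le> q' b"
      proof (rule greatest)
        fix s :: real assume s: "0 \<le> s"
        have "q' (a + b) \<le> q ((a + t *\<^sub>R y) + (b + s *\<^sub>R y)) - (t + s) * q y"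
          using lower[of "t + s" "a + b"] t s by (simp add: algebra_simps)
        also have "\<dots> \<le> q (a + t *\<^sub>R y) + q (b + s *\<^sub>R y) - (t + s) * q y" using add by simp
        finally show "q' (a + b) - (q (a + t *\<^sub>R y) - t * q y) \<le> q (b + s *\<^sub>R y) - s * q y"
          by (simp add: algebra_simps)
      qed
      then show "q' (a + b) - q' b \<le> q (a + t *\<^sub>R y) - t * q y" by simp
    qed
    then show "q' (a + b) \<le> q' a + q' b" by simp
  next
    fix s :: real and a assume s: "0 \<le> s"
    show "q' (s *\<^sub>R a) \<le> s * q' a"
    proof (cases "s = 0")
      case True then show ?thesis using lower[of 0 0] scale[of 0 0] by simp
    next
      case False
      have "q' (s *\<^sub>R a) / s \<le> q' a"
      proof (rule greatest)
        fix t :: real assume t: "0 \<le> t"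
        have "q' (s *\<^sub>R a) \<le> q (s *\<^sub>R (a + t *\<^sub>R y)) - (s * t) * q y"
          using lower[of "s * t" "s *\<^sub>R a"] s t by (simp add: scaleR_add_right)
        also have "\<dots> \<le> s * (q (a + t *\<^sub>R y) - t * q y)"
          using scale[OF s, of "a + t *\<^sub>R y"] by (simp add: algebra_simps)
        finally show "q' (s *\<^sub>R a) / s \<le> q (a + t *\<^sub>R y) - t * q y" using s False by (simp add: field_simps)
      qed
      then show ?thesis using s False by (simp add: field_simps)
    qed
  qed
qed

text \<open>A minimal sublinear functional below \<open>p\<close> is linear.\<close>

lemma hahn_banach_sublinear:
  fixes p :: "'a::real_vector \<Rightarrow> real"
  assumes p: "sublinear p"
  obtains g where "linear g" "g \<le> p" "g u = p u"
proof -
  \<comment> \<open>Searching below the tilt of \<open>p\<close> along \<open>u\<close> forces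
    \<open>g (- u) \<le> - p u\<close>, and with \<open>g \<le> p\<close> this becomes
    \<open>g u = p u\<close> once \<open>g\<close> is linear.\<close>
  obtain p' where p': "sublinear p'" "p' \<le> p" "p' (- u) \<le> - p u" using sublinear_tilt[OF p] .
  define A where "A = {q. sublinear q \<and> q \<le> p'}"
  \<comment> \<open>Zorn for the reversed order: maximal elements are minimal functionals, and the
    pointwise infimum bounds a chain from below.\<close>
  have "\<exists>m\<in>A. \<forall>a\<in>A. m \<ge> a \<longrightarrow> a = m"
  proof (rule predicate_Zorn)
    show "partial_order_on A (relation_of (\<ge>) A)"
      by (rule partial_order_on_relation_ofI) auto
    fix C assume C: "C \<in> Chains (relation_of (\<ge>) A)"
    have CA: "C \<subseteq> A" using C unfolding Chains_def relation_of_def by auto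
    have ch: "a \<le> b \<or> b \<le> a" if "a \<in> C" "b \<in> C" for a b
      using C that unfolding Chains_def relation_of_def by auto
    show "\<exists>v\<in>A. \<forall>a\<in>C. a \<ge> v"
    proof (cases "C = {}")
      case True then show ?thesis using p' by (auto simp: A_def)
    next
      case False
      define v where "v x = (INF q\<in>C. q x)" for x
      have bdd: "bdd_below ((\<lambda>q. q x) ` C)" for x
      proof (rule bdd_belowI2)
        fix q assume "q \<in> C"
        then have "sublinear q" "q (- x) \<le> p' (- x)" using CA by (auto simp: A_def le_fun_def)
        then show "- p' (- x) \<le> q x" using sublinear_lower[of q x] by simp
      qed
      have lower: "q \<in> C \<Longrightarrow> v x \<le> q x" for q x
        unfolding v_def by (rule cINF_lower[OF bdd])
      have greatest: "(\<And>q. q \<in> C \<Longrightarrow> c \<le> q x) \<Longrightarrow> c \<le> v x" for c x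
        unfolding v_def by (rule cINF_greatest[OF False])
      have sub: "q (a + b) \<le> q a + q b" and scale: "0 \<le> t \<Longrightarrow> q (t *\<^sub>R a) \<le> t * q a" if "q \<in> C" for q a b t
        using that CA by (auto simp: A_def sublinear_def)
      have "sublinear v" unfolding sublinear_def
      proof (intro conjI allI impI)
        fix a b
        have "v (a + b) - v b \<le> v a"
        proof (rule greatest)
          fix q assume q: "q \<in> C"
          have "v (a + b) - q a \<le> v b"
          proof (rule greatest)
            fix r assume r: "r \<in> C"
            \<comment> \<open>The infima at \<open>a\<close> and \<open>b\<close> may be approached
              by different members of the chain; the smaller of the two serves for both.\<close>
            from ch[OF q r] show "v (a + b) - q a \<le> r b"
            proof
              assume "q \<le> r"
              then show ?thesis using lower[OF q, of "a + b"] sub[OF q, of a b] by (fastforce simp: le_fun_def dest: spec[of _ b])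
            next
              assume "r \<le> q"
              then show ?thesis using lower[OF r, of "a + b"] sub[OF r, of a b] by (fastforce simp: le_fun_def dest: spec[of _ a])
            qed
          qed
          then show "v (a + b) - v b \<le> q a" by simp
        qed
        then show "v (a + b) \<le> v a + v b" by simp
      next
        fix t :: real and a assume t: "0 \<le> t"
        show "v (t *\<^sub>R a) \<le> t * v a"
        proof (cases "t = 0")
          case True
          obtain q where "q \<in> C" using False by blast
          then show ?thesis using True lower[of q 0] scale[of q 0 0] by simp
        next
          case False
          have "v (t *\<^sub>R a) / t \<le> v a"
            by (rule greatest) (use lower[of _ "t *\<^sub>R a"] scale[OF _ t, of _ a] t False in \<open>force simp: field_simps intro: order_trans\<close>)
          then show ?thesis using t False by (simp add: field_simps)
        qed
      qed
      moreover have "v \<le> p'"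
      proof -
        obtain q where "q \<in> C" using False by blast
        then show ?thesis using CA lower[of q] by (auto simp: A_def le_fun_def intro: order_trans)
      qed
      ultimately show ?thesis using lower by (intro bexI[of _ v]) (auto simp: A_def le_fun_def)
    qed
  qed
  then obtain g where g: "sublinear g" "g \<le> p'" and min: "\<And>q. sublinear q \<Longrightarrow> q \<le> g \<Longrightarrow> q = g"
    unfolding A_def by (blast intro: order_trans)
  \<comment> \<open>By minimality \<open>g\<close> equals its tilt along \<open>y\<close>, so it is
    odd; an odd subadditive functional is additive.\<close>
  have neg: "g (- y) = - g y" for y
  proof -
    obtain q where "sublinear q" "q \<le> g" "q (- y) \<le> - g y" using sublinear_tilt[OF g(1)] .
    then have "g (- y) \<le> - g y" using min by blast
    then show ?thesis using sublinear_lower[OF g(1), of y] by simp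
  qed
  have add: "g (x + y) = g x + g y" for x y
  proof -
    have le: "g (a + b) \<le> g a + g b" for a b using g(1) by (simp add: sublinear_def)
    have "- g (x + y) \<le> - g x + - g y" using le[of "- x" "- y"] neg[of "x + y"] neg by simp
    then show ?thesis using le[of x y] by simp
  qed
  have pos: "g (t *\<^sub>R x) = t * g x" if "0 \<le> t" for t x
  proof -
    have le: "g (t *\<^sub>R a) \<le> t * g a" for a using g(1) that by (simp add: sublinear_def)
    show ?thesis using le[of x] le[of "- x"] neg[of x] neg[of "t *\<^sub>R x"] by simp
  qed
  have "linear g"
  proof (rule linearI)
    fix t x
    show "g (t *\<^sub>R x) = t *\<^sub>R g x"
      using pos[of t x] pos[of "- t" x] neg[of "t *\<^sub>R x"] by (cases "0 \<le> t") auto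
  qed (rule add)
  moreover have "g \<le> p" using g p' by (meson order_trans)
  moreover have "g u = p u"
  proof -
    have "g (- u) \<le> - p u" using g(2) p'(3) by (meson le_funD order_trans)
    then show ?thesis using neg[of u] \<open>g \<le> p\<close>[THEN le_funD, of u] by simp
  qed
  ultimately show thesis using that by blast
qed

lemma infdist_subspace_sublinear:
  fixes R :: "'a::real_normed_vector set"
  assumes R: "subspace R"
  shows "sublinear (\<lambda>x. infdist x R)"
  unfolding sublinear_def
proof (intro conjI allI impI)
  have ne: "R \<noteq> {}" using subspace_0[OF R] by blast
  have greatest: "c \<le> infdist x R" if "\<And>z. z \<in> R \<Longrightarrow> c \<le> dist x z" for c x
    using ne that by (auto simp: infdist_notempty intro: cINF_greatest)
  fix a b
  have "infdist (a + b) R - infdist b R \<le> infdist a R"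
  proof (rule greatest)
    fix z assume z: "z \<in> R"
    have "infdist (a + b) R - dist a z \<le> infdist b R"
    proof (rule greatest)
      fix w assume w: "w \<in> R"
      have "infdist (a + b) R \<le> dist (a + b) (z + w)" using z w R by (intro infdist_le subspace_add)
      also have "\<dots> \<le> dist a z + dist b w" by (rule dist_triangle_add)
      finally show "infdist (a + b) R - dist a z \<le> dist b w" by simp
    qed
    then show "infdist (a + b) R - infdist b R \<le> dist a z" by simp
  qed
  then show "infdist (a + b) R \<le> infdist a R + infdist b R" by simp
next
  have ne: "R \<noteq> {}" using subspace_0[OF R] by blast
  have greatest: "c \<le> infdist x R" if "\<And>z. z \<in> R \<Longrightarrow> c \<le> dist x z" for c x
    using ne that by (auto simp: infdist_notempty intro: cINF_greatest)
  fix t :: real and a assume t: "0 \<le> t"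
  show "infdist (t *\<^sub>R a) R \<le> t * infdist a R"
  proof (cases "t = 0")
    case True then show ?thesis using subspace_0[OF R] by simp
  next
    case False
    have "infdist (t *\<^sub>R a) R / t \<le> infdist a R"
    proof (rule greatest)
      fix z assume z: "z \<in> R"
      have "infdist (t *\<^sub>R a) R \<le> dist (t *\<^sub>R a) (t *\<^sub>R z)" using z R by (intro infdist_le subspace_scale)
      also have "\<dots> = t * dist a z" using t by (simp add: dist_norm flip: scaleR_diff_right)
      finally show "infdist (t *\<^sub>R a) R / t \<le> dist a z" using t False by (simp add: field_simps)
    qed
    then show ?thesis using t False by (simp add: field_simps)
  qed
qed

text \<open>Domination by the distance to \<open>R\<close> yields both vanishing on \<open>R\<close>
  and boundedness, and \<open>g u = infdist u R\<close> is nonzero because \<open>R\<close> is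
  closed.\<close>

lemma hahn_banach_functional:
  fixes R :: "'a::complex_normed_vector set"
  assumes R: "closed R" "csubspace R" and u: "u \<notin> R"
  obtains f :: "'a \<Rightarrow> complex" where "bounded_linear f" "\<And>c x. f (c *\<^sub>C x) = c * f x"
    "\<And>x. x \<in> R \<Longrightarrow> f x = 0" "f u = 1"
proof -
  have sR: "subspace R" using R(2) by (rule csubspace_imp_subspace)
  obtain g where g: "linear g" "g \<le> (\<lambda>x. infdist x R)" "g u = infdist u R"
    using hahn_banach_sublinear[OF infdist_subspace_sublinear[OF sR]] .
  interpret g: linear g by fact
  have le: "\<bar>g x\<bar> \<le> norm x" for x
  proof -
    have "g y \<le> norm y" for y
      using le_funD[OF g(2), of y] infdist_le[OF subspace_0[OF sR], of y] by simp
    from this[of x] this[of "- x"] show ?thesis by (simp add: g.neg)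
  qed
  have zero: "g x = 0" if "x \<in> R" for x
    using le_funD[OF g(2), of x] le_funD[OF g(2), of "- x"] that subspace_neg[OF sR that] by (simp add: g.neg)
  \<comment> \<open>The usual passage from a real functional \<open>g\<close> to the complex linear
    one with real part \<open>g\<close>.\<close>
  define f where "f x = Complex (g x) (- g (\<i> *\<^sub>C x))" for x
  have add: "f (x + y) = f x + f y" for x y
    by (simp add: f_def scaleC_add_right g.add complex_eq_iff)
  have scale: "f (c *\<^sub>C x) = c * f x" for c x
  proof -
    have "c *\<^sub>C x = Re c *\<^sub>R x + Im c *\<^sub>R (\<i> *\<^sub>C x)"
      by (simp add: scaleR_scaleC scaleC_scaleC flip: scaleC_add_left)
        (metis complex_eq mult.commute)
    moreover have "\<i> *\<^sub>C c *\<^sub>C x = Re c *\<^sub>R (\<i> *\<^sub>C x) - Im c *\<^sub>R x"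
      by (simp add: scaleR_scaleC scaleC_scaleC flip: complex_vector.scale_left_diff_distrib)
        (simp add: complex_eq_iff)
    ultimately show ?thesis
      by (simp add: f_def g.add g.diff g.scale complex_eq_iff)
  qed
  have "bounded_linear f"
  proof (rule bounded_linear_intro)
    fix x
    have "norm (f x) \<le> \<bar>g x\<bar> + \<bar>g (\<i> *\<^sub>C x)\<bar>" using cmod_le[of "f x"] by (simp add: f_def)
    also have "\<dots> \<le> norm x * 2" using le[of x] le[of "\<i> *\<^sub>C x"] by (simp add: norm_scaleC)
    finally show "norm (f x) \<le> norm x * 2" .
  qed (simp_all add: add scale scaleR_scaleC scaleC_complex_def)
  moreover have fu: "f u \<noteq> 0"
  proof -
    have "infdist u R \<noteq> 0" using in_closed_iff_infdist_zero[OF R(1)] subspace_0[OF sR] u by blast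
    then show ?thesis by (simp add: f_def g(3) complex_eq_iff)
  qed
  moreover have "f x = 0" if "x \<in> R" for x
    using that zero complex_vector.subspace_scale[OF R(2) that] by (simp add: f_def complex_eq_iff)
  ultimately show thesis
    by (intro that[of "\<lambda>x. f x / f u"]) (auto simp: scale intro!: bounded_linear_divide[THEN bounded_linear_compose])
qed

section \<open>Dimension\<close>

abbreviation sumset :: "'a::complex_normed_vector set \<Rightarrow> 'a set \<Rightarrow> 'a set" where
  "sumset V W \<equiv> {v + w | v w. v \<in> V \<and> w \<in> W}"

lemma subset_sumset1: "csubspace W \<Longrightarrow> V \<subseteq> sumset V W"
  using complex_vector.subspace_0 by force

lemma subset_sumset2: "csubspace V \<Longrightarrow> W \<subseteq> sumset V W"
  using complex_vector.subspace_0 by force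

lemma csubspace_basis:
  assumes "csubspace V"
  obtains B where "complex_vector.independent B" "V = cspan B"
  using complex_vector.maximal_independent_subset[of V] complex_vector.span_minimal[OF _ assms]
  by (metis antisym_conv)

lemma edim_finite_iff: "edim V < \<infinity> \<longleftrightarrow> (\<exists>B. finite B \<and> V \<subseteq> cspan B)"
  by (simp add: edim_def)

lemma edim_cspan:
  assumes "complex_vector.independent B"
  shows "edim (cspan B) = (if finite B then enat (card B) else \<infinity>)"
proof (cases "finite B")
  case True
  then show ?thesis
    using complex_vector.dim_span_eq_card_independent[OF assms] by (auto simp: edim_def)
next
  case False
  have "\<not> (\<exists>C. finite C \<and> cspan B \<subseteq> cspan C)"
    using complex_vector.independent_span_bound[OF _ assms] complex_vector.span_superset False by blast
  then show ?thesis using False by (simp add: edim_def)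
qed

lemma finite_dim_basis:
  assumes "csubspace V" "edim V < \<infinity>"
  obtains B where "finite B" "complex_vector.independent B" "V = cspan B" "edim V = enat (card B)"
proof -
  obtain B where B: "complex_vector.independent B" "V = cspan B" using csubspace_basis[OF assms(1)] .
  then have "finite B" using assms(2) by (auto simp: edim_cspan split: if_splits)
  then show ?thesis using B that by (simp add: edim_cspan)
qed

lemma edim_zero [simp]: "edim {0} = 0"
  using edim_cspan[of "{}"] by (simp add: complex_vector.independent_empty zero_enat_def)

lemma edim_cspan_singleton: "u \<noteq> 0 \<Longrightarrow> edim (cspan {u}) = 1"
  by (simp add: edim_cspan one_enat_def)

lemma edim_mono:
  assumes "V \<subseteq> W" shows "edim V \<le> edim W"
proof (cases "\<exists>B. finite B \<and> W \<subseteq> cspan B")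
  case True
  then obtain B where B: "B \<subseteq> W" "complex_vector.independent B" "W \<subseteq> cspan B"
    "card B = complex_vector.dim W"
    using complex_vector.basis_exists by blast
  have "finite B"
    using True complex_vector.independent_span_bound[OF _ B(2)] B(1) by blast
  then have "complex_vector.dim V \<le> complex_vector.dim W"
    using complex_vector.dim_le_card[of V B] B assms by auto
  moreover have "\<exists>B. finite B \<and> V \<subseteq> cspan B" using True assms by blast
  ultimately show ?thesis using True by (simp add: edim_def)
next
  case False
  then have "edim W = \<infinity>" unfolding edim_def by (rule if_not_P)
  then show ?thesis by simp
qed

lemma edim_ge_subspace:
  assumes "csubspace V" "enat m \<le> edim V"
  obtains W where "csubspace W" "W \<subseteq> V" "edim W = enat m"
proof -
  obtain B where B: "complex_vector.independent B" "V = cspan B" using csubspace_basis[OF assms(1)] .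
  have "\<exists>C\<subseteq>B. finite C \<and> card C = m"
  proof (cases "finite B")
    case True
    then have "m \<le> card B" using assms(2) B by (simp add: edim_cspan)
    then show ?thesis using True by (meson obtain_subset_with_card_n)
  next
    case False
    then show ?thesis using infinite_arbitrarily_large by blast
  qed
  then obtain C where C: "C \<subseteq> B" "finite C" "card C = m" by blast
  then have "complex_vector.independent C" using B complex_vector.independent_mono by blast
  then show ?thesis
    using C B by (intro that[of "cspan C"]) (auto simp: edim_cspan intro: complex_vector.span_mono[THEN subsetD])
qed

text \<open>Phrased through \<open>Vector_Spaces.linear\<close> so that the generic facts on pairs
  of vector spaces apply to complex scalars.\<close>

definition clinear :: "('a::complex_normed_vector \<Rightarrow> 'a) \<Rightarrow> bool" where
  "clinear = Vector_Spaces.linear scaleC scaleC"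

lemma vector_space_scaleC: "vector_space (scaleC :: complex \<Rightarrow> 'a \<Rightarrow> 'a::complex_normed_vector)"
  by (rule complex_vector.vector_space_axioms)

lemma vector_space_pair_scaleC:
  "vector_space_pair (scaleC :: complex \<Rightarrow> 'a \<Rightarrow> 'a::complex_normed_vector)
     (scaleC :: complex \<Rightarrow> 'b \<Rightarrow> 'b::complex_normed_vector)"
  by (intro vector_space_pair.intro vector_space_scaleC)

lemma clinear_iff: "clinear f \<longleftrightarrow> (\<forall>x y. f (x + y) = f x + f y) \<and> (\<forall>c x. f (c *\<^sub>C x) = c *\<^sub>C f x)"
  unfolding clinear_def Vector_Spaces.linear_iff by (simp add: vector_space_scaleC)

lemma csubspace_image: "clinear f \<Longrightarrow> csubspace U \<Longrightarrow> csubspace (f ` U)"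
  unfolding clinear_def
  using vector_space_pair_scaleC[THEN vector_space_pair.linear_subspace_image] by blast

lemma edim_image_le:
  assumes f: "clinear f" and U: "csubspace U"
  shows "edim (f ` U) \<le> edim U"
proof (cases "edim U")
  case (enat n)
  then have "edim U < \<infinity>" by simp
  then obtain B where B: "finite B" "U = cspan B" "edim U = enat (card B)"
    using finite_dim_basis[OF U] by metis
  have fU: "f ` U = cspan (f ` B)"
    unfolding B(2) using f[unfolded clinear_def]
      vector_space_pair_scaleC[THEN vector_space_pair.linear_span_image] by metis
  obtain C where C: "C \<subseteq> f ` B" "complex_vector.independent C" "f ` B \<subseteq> cspan C"
    using complex_vector.maximal_independent_subset by blast
  have fin: "finite C" using C B finite_subset by blast
  have "f ` U = cspan C" unfolding fU
    using C by (intro antisym complex_vector.span_minimal complex_vector.span_mono) auto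
  then have "edim (f ` U) = enat (card C)" using C(2) fin by (simp add: edim_cspan)
  also have "card C \<le> card B" using C B by (meson card_image_le card_mono finite_imageI order_trans)
  finally show ?thesis using B by simp
qed simp

lemma edim_le_of_inj:
  assumes f: "clinear f" and U: "csubspace U" and inj: "inj_on f U" and V: "f ` U \<subseteq> V"
  shows "edim U \<le> edim V"
proof -
  obtain g where g: "clinear g" "\<And>u. u \<in> U \<Longrightarrow> g (f u) = u"
    using vector_space_pair_scaleC[THEN vector_space_pair.linear_exists_left_inverse_on,
      OF f[unfolded clinear_def] U inj] unfolding clinear_def by blast
  have "U = g ` f ` U" using g(2) by force
  then have "edim U \<le> edim (f ` U)" using edim_image_le[OF g(1) csubspace_image[OF f U]] by simp
  also have "\<dots> \<le> edim V" using V by (rule edim_mono)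
  finally show ?thesis .
qed

lemma independent_Un:
  assumes B: "complex_vector.independent B" and C: "complex_vector.independent C"
    and BC: "cspan B \<inter> cspan C = {0}"
  shows "complex_vector.independent (B \<union> C)"
  unfolding complex_vector.independent_explicit_finite_subsets
proof (intro allI impI ballI)
  fix S u v
  assume S: "S \<subseteq> B \<union> C" "finite S" "(\<Sum>v\<in>S. u v *\<^sub>C v) = 0" and v: "v \<in> S"
  let ?s = "\<lambda>A. \<Sum>v\<in>A. u v *\<^sub>C v"
  have eq: "?s (S \<inter> B) + ?s (S - B) = 0"
    using sum.Int_Diff[OF S(2), of "\<lambda>v. u v *\<^sub>C v" B] S(3) by simp
  have 1: "?s (S \<inter> B) \<in> cspan B"
    by (intro complex_vector.span_sum complex_vector.span_scale complex_vector.span_base) auto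
  have 2: "?s (S - B) \<in> cspan C"
    using S(1) by (intro complex_vector.span_sum complex_vector.span_scale complex_vector.span_base) auto
  have "?s (S \<inter> B) = - ?s (S - B)" using eq by (simp add: eq_neg_iff_add_eq_0)
  then have "?s (S \<inter> B) \<in> cspan B \<inter> cspan C" using 1 2 complex_vector.span_neg by auto
  then have z: "?s (S \<inter> B) = 0" "?s (S - B) = 0" using BC eq by auto
  show "u v = 0"
  proof (cases "v \<in> B")
    case True
    then show ?thesis
      using B[unfolded complex_vector.independent_explicit_finite_subsets, rule_format, of "S \<inter> B" u v]
        z S(2) v by auto
  next
    case False
    then show ?thesis
      using C[unfolded complex_vector.independent_explicit_finite_subsets, rule_format, of "S - B" u v]
        z S v by auto
  qed
qed

lemma edim_sumset:
  assumes V: "csubspace V" and W: "csubspace W" and VW: "V \<inter> W = {0}"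
  shows "edim (sumset V W) = edim V + edim W"
proof -
  obtain B where B: "complex_vector.independent B" "V = cspan B" using csubspace_basis[OF V] .
  obtain C where C: "complex_vector.independent C" "W = cspan C" using csubspace_basis[OF W] .
  have ind: "complex_vector.independent (B \<union> C)"
    using independent_Un[OF B(1) C(1)] VW B C by simp
  have disj: "B \<inter> C = {}"
  proof -
    have "B \<inter> C \<subseteq> {0}" using VW unfolding B(2) C(2) using complex_vector.span_superset by blast
    then show ?thesis using complex_vector.dependent_zero B(1) by blast
  qed
  have "sumset V W = cspan (B \<union> C)" unfolding B(2) C(2) complex_vector.span_Un by simp
  then have "edim (sumset V W) = (if finite (B \<union> C) then enat (card (B \<union> C)) else \<infinity>)"
    using edim_cspan[OF ind] by simp
  then show ?thesis
    using disj by (auto simp: B(2) C(2) edim_cspan[OF B(1)] edim_cspan[OF C(1)] card_Un_disjoint)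
qed

section \<open>Algebraic complements and bounds for the codimension\<close>

lemma complement_exists:
  assumes R: "csubspace R" and Y: "csubspace Y" and RY: "R \<subseteq> Y"
  obtains W where "direct_sum Y R W"
proof -
  obtain B where B: "complex_vector.independent B" "R = cspan B" using csubspace_basis[OF R] .
  have "B \<subseteq> Y" using RY B complex_vector.span_superset by blast
  then obtain C where C: "B \<subseteq> C" "C \<subseteq> Y" "complex_vector.independent C" "Y \<subseteq> cspan C"
    using complex_vector.maximal_independent_subset_extend B(1) by metis
  have YC: "Y = cspan C" using C complex_vector.span_minimal[OF C(2) Y] by blast
  \<comment> \<open>\<open>g\<close> acts as the coordinate projection: identity on the span of
    \<open>B\<close>, zero on the span of \<open>C - B\<close>. A vector in both spans is therefore
    0.\<close>
  obtain g where g: "Vector_Spaces.linear scaleC scaleC g" "\<And>x. x \<in> C \<Longrightarrow> g x = (if x \<in> B then x else 0)"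
    using vector_space_pair_scaleC[THEN vector_space_pair.linear_independent_extend, OF C(3),
      of "\<lambda>x. if x \<in> B then x else 0"] by blast
  have "x = 0" if x: "x \<in> cspan B" "x \<in> cspan (C - B)" for x
  proof -
    have "\<And>b. b \<in> B \<Longrightarrow> g b = id b" using g(2) C(1) by auto
    then have "g x = id x"
      by (rule vector_space_pair_scaleC[THEN vector_space_pair.linear_eq_on, OF g(1)
            vector_space_scaleC[THEN vector_space.linear_id] x(1)])
    moreover have "g x = 0"
      using vector_space_pair_scaleC[THEN vector_space_pair.linear_eq_0_on_span, OF g(1) _ x(2)]
        g(2) by auto
    ultimately show ?thesis by simp
  qed
  then have "cspan B \<inter> cspan (C - B) = {0}" using complex_vector.span_zero by auto
  moreover have "Y = sumset (cspan B) (cspan (C - B))"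
    using C(1) unfolding YC complex_vector.span_Un[symmetric] by (simp add: Un_absorb1)
  ultimately show ?thesis using that B(2) by (auto simp: direct_sum_def)
qed

text \<open>A complement \<open>U\<close> of \<open>R + W\<close> enlarges \<open>W\<close> to the
  complement \<open>W + U\<close> of \<open>R\<close>.\<close>

lemma ecodim_ge:
  assumes R: "csubspace R" and Y: "csubspace Y" and W: "csubspace W"
    and sub: "R \<subseteq> Y" "W \<subseteq> Y" and RW: "R \<inter> W = {0}"
  shows "edim W \<le> ecodim Y R"
proof -
  have S: "csubspace (sumset R W)" using complex_vector.subspace_sums[OF R W] .
  have "sumset R W \<subseteq> Y" using sub complex_vector.subspace_add[OF Y] by blast
  then obtain U where "direct_sum Y (sumset R W) U" using complement_exists[OF S Y] by blast
  then have U: "csubspace U" "sumset R W \<inter> U = {0}" "Y = sumset (sumset R W) U"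
    by (auto simp: direct_sum_def)
  have "direct_sum Y R (sumset W U)" unfolding direct_sum_def
  proof (intro conjI)
    show "csubspace (sumset W U)" by (rule complex_vector.subspace_sums[OF W U(1)])
    show "R \<inter> sumset W U = {0}"
    proof safe
      fix w u assume x: "w + u \<in> R" "w \<in> W" "u \<in> U"
      have "u = (w + u) + (- w)" by simp
      then have "u \<in> sumset R W" using x complex_vector.subspace_neg[OF W] by blast
      then have "u = 0" using x(3) U(2) by blast
      then show "w + u = 0" using x RW by auto
    next
      show "0 \<in> R" by (rule complex_vector.subspace_0[OF R])
      show "\<exists>v w. 0 = v + w \<and> v \<in> W \<and> w \<in> U"
        using complex_vector.subspace_0[OF W] complex_vector.subspace_0[OF U(1)] by force
    qed
    show "Y = sumset R (sumset W U)" unfolding U(3) by (auto; metis add.assoc)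
  qed (rule R)
  then have "ecodim Y R = edim (sumset W U)" by (rule ecodim_eq)
  also have "edim W \<le> \<dots>" by (rule edim_mono[OF subset_sumset1[OF U(1)]])
  finally show ?thesis .
qed

text \<open>\<open>W\<close> may overlap \<open>R\<close>; a complement of the overlap inside
  \<open>W\<close> is a complement of \<open>R\<close> in \<open>Y\<close>.\<close>

lemma ecodim_le:
  assumes R: "csubspace R" and W: "csubspace W" and Y: "Y = sumset R W"
  shows "ecodim Y R \<le> edim W"
proof -
  obtain V where "direct_sum W (R \<inter> W) V"
    using complement_exists[OF complex_vector.subspace_inter[OF R W] W] by blast
  then have V: "csubspace V" "(R \<inter> W) \<inter> V = {0}" "W = sumset (R \<inter> W) V"
    by (auto simp: direct_sum_def)
  have VW: "V \<subseteq> W" using V(3) subset_sumset2[OF complex_vector.subspace_inter[OF R W]] by blast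
  have "direct_sum Y R V" unfolding direct_sum_def
  proof (intro conjI R V(1))
    show "R \<inter> V = {0}" using V(2) VW by blast
    show "Y = sumset R V"
    proof
      show "sumset R V \<subseteq> Y" using VW unfolding Y by blast
      show "Y \<subseteq> sumset R V"
      proof
        fix y assume "y \<in> Y"
        then obtain r w where rw: "y = r + w" "r \<in> R" "w \<in> W" unfolding Y by blast
        then obtain s v where sv: "w = s + v" "s \<in> R" "v \<in> V" using V(3) by blast
        have "y = (r + s) + v" "r + s \<in> R"
          using rw sv complex_vector.subspace_add[OF R] by (auto simp: add.assoc)
        then show "y \<in> sumset R V" using sv(3) by blast
      qed
    qed
  qed
  then have "ecodim Y R = edim V" by (rule ecodim_eq)
  then show ?thesis using edim_mono[OF VW] by simp
qed

section \<open>Bounded operators\<close>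

lemma bounded_ops_UNIV_D:
  assumes "S \<in> bounded_ops UNIV"
  shows "bounded_linear S" "S (c *\<^sub>C x) = c *\<^sub>C S x" "S (x + y) = S x + S y" "S (x - y) = S x - S y"
    "S 0 = 0" "S (- x) = - S x" "clinear S"
proof -
  show 1: "bounded_linear S" and 2: "\<And>c x. S (c *\<^sub>C x) = c *\<^sub>C S x"
    using assms bounded_ops_UNIV by blast+
  then interpret bounded_linear S by blast
  show 3: "S (x + y) = S x + S y" "S (x - y) = S x - S y" "S 0 = 0" "S (- x) = - S x"
    by (simp_all add: add diff zero neg)
  show "clinear S" by (simp add: clinear_iff 2 add)
qed

lemma bounded_linear_scaleC_left: "bounded_linear (\<lambda>c. c *\<^sub>C u)"
  by (rule bounded_linear_intro[of _ "norm u"])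
    (simp_all add: scaleC_add_left norm_scaleC scaleR_scaleC scaleC_scaleC scaleC_complex_def)

lemma bounded_linear_scaleC_right: "bounded_linear (\<lambda>x. c *\<^sub>C x)"
  by (rule bounded_linear_intro[of _ "cmod c"])
    (simp_all add: scaleC_add_right norm_scaleC scaleR_scaleC scaleC_scaleC mult.commute)

lemma bounded_ops_add:
  "S \<in> bounded_ops UNIV \<Longrightarrow> T \<in> bounded_ops UNIV \<Longrightarrow> (\<lambda>x. S x + T x) \<in> bounded_ops UNIV"
  unfolding bounded_ops_UNIV by (auto simp: scaleC_add_right intro: bounded_linear_add)

lemma bounded_ops_diff:
  "S \<in> bounded_ops UNIV \<Longrightarrow> T \<in> bounded_ops UNIV \<Longrightarrow> (\<lambda>x. S x - T x) \<in> bounded_ops UNIV"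
  unfolding bounded_ops_UNIV
  by (auto simp: complex_vector.scale_right_diff_distrib intro: bounded_linear_sub)

lemma bounded_ops_id: "(\<lambda>x. x) \<in> bounded_ops UNIV"
  unfolding bounded_ops_UNIV by (auto intro: bounded_linear_ident)

lemma bounded_ops_zero: "(\<lambda>x. 0) \<in> bounded_ops UNIV"
  unfolding bounded_ops_UNIV by (auto intro: bounded_linear_zero)

lemma bounded_ops_scaleC: "S \<in> bounded_ops UNIV \<Longrightarrow> (\<lambda>x. c *\<^sub>C S x) \<in> bounded_ops UNIV"
  unfolding bounded_ops_UNIV
  by (auto simp: scaleC_scaleC mult.commute
      intro: bounded_linear_compose[OF bounded_linear_scaleC_right])

lemma bounded_ops_rank_one:
  assumes "bounded_linear f" "\<And>c x. f (c *\<^sub>C x) = c * f x"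
  shows "(\<lambda>x. f x *\<^sub>C u) \<in> bounded_ops UNIV"
  unfolding bounded_ops_UNIV
  using assms bounded_linear_compose[OF bounded_linear_scaleC_left assms(1)]
  by (auto simp: scaleC_scaleC)

lemma bounded_ops_compose:
  "S \<in> bounded_ops UNIV \<Longrightarrow> T \<in> bounded_ops UNIV \<Longrightarrow> S \<circ> T \<in> bounded_ops UNIV"
  unfolding bounded_ops_UNIV by (auto simp: o_def intro: bounded_linear_compose)

lemma bounded_ops_funpow: "T \<in> bounded_ops UNIV \<Longrightarrow> T ^^ n \<in> bounded_ops UNIV"
  by (induction n) (auto simp: bounded_ops_compose bounded_ops_id[folded id_def])

lemma bounded_ops_diff_scaleC: "T \<in> bounded_ops UNIV \<Longrightarrow> (\<lambda>x. T x - c *\<^sub>C x) \<in> bounded_ops UNIV"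
  by (intro bounded_ops_diff bounded_ops_scaleC bounded_ops_id)

lemma bounded_ops_subspace:
  assumes "T \<in> bounded_ops UNIV" "T ` Y \<subseteq> Y" shows "T \<in> bounded_ops Y"
  using assms by (auto simp: bounded_ops_def)

lemma csubspace_vimage:
  "clinear T \<Longrightarrow> csubspace V \<Longrightarrow> csubspace {x. T x \<in> V}"
  by (auto simp: clinear_iff complex_vector.subspace_def) (metis complex_vector.scale_zero_left)

section \<open>Finite dimensional subspaces\<close>

text \<open>A functional with \<open>f u = 1\<close> that vanishes on \<open>R\<close> reads off the
  coefficient of \<open>u\<close> continuously, so the span is the preimage of \<open>R\<close>
  under the continuous map sending \<open>x\<close> to \<open>x - f x *\<^sub>C u\<close>.\<close>

lemma closed_cspan_insert:
  fixes R :: "'a::complex_normed_vector set"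
  assumes R: "closed R" "csubspace R"
  shows "closed (cspan (insert u R))"
proof (cases "u \<in> R")
  case True
  then show ?thesis using R by (simp add: insert_absorb complex_vector.span_eq_iff[THEN iffD2])
next
  case False
  obtain f :: "'a \<Rightarrow> complex" where f: "bounded_linear f" "\<And>c x. f (c *\<^sub>C x) = c * f x"
    "\<And>x. x \<in> R \<Longrightarrow> f x = 0" "f u = 1"
    using hahn_banach_functional[OF R False] by blast
  interpret f: bounded_linear f by fact
  have "k = f x" if "x - k *\<^sub>C u \<in> R" for x k
    using f(3)[OF that] f(2,4) by (simp add: f.diff)
  then have "cspan (insert u R) = {x. x - f x *\<^sub>C u \<in> R}"
    using R(2) unfolding complex_vector.span_insert
    by (auto simp: complex_vector.span_eq_iff[THEN iffD2])
  moreover have "closed ((\<lambda>x. x - f x *\<^sub>C u) -` R)"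
  proof (rule continuous_closed_vimage[OF R(1)])
    fix x
    have "bounded_linear (\<lambda>x. x - f x *\<^sub>C u)"
      by (intro bounded_linear_sub bounded_linear_ident
          bounded_linear_compose[OF bounded_linear_scaleC_left f(1)])
    then show "isCont (\<lambda>x. x - f x *\<^sub>C u) x"
      by (rule linear_continuous_at)
  qed
  ultimately show ?thesis by (simp add: vimage_def)
qed

lemma closed_cspan_Un_finite:
  assumes R: "closed R" "csubspace R" and B: "finite B"
  shows "closed (cspan (R \<union> B))"
  using B
proof (induction B rule: finite_induct)
  case empty
  then show ?case using R by (simp add: complex_vector.span_eq_iff[THEN iffD2])
next
  case (insert u B)
  have "cspan (R \<union> insert u B) = cspan (insert u (cspan (R \<union> B)))"
    by (simp add: complex_vector.span_insert complex_vector.span_span)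
  then show ?case
    using closed_cspan_insert[OF insert.IH complex_vector.subspace_span] by simp
qed

lemma closed_sumset_finite_dim:
  assumes R: "closed R" "csubspace R" and V: "csubspace V" "edim V < \<infinity>"
  shows "closed (sumset R V)"
proof -
  obtain B where B: "finite B" "V = cspan B" using finite_dim_basis[OF V] by metis
  have "sumset R V = cspan (R \<union> B)"
    unfolding complex_vector.span_Un B(2) using R(2)
    by (simp add: complex_vector.span_eq_iff[THEN iffD2])
  then show ?thesis using closed_cspan_Un_finite[OF R B(1)] by simp
qed

lemma closed_finite_dim:
  assumes V: "csubspace V" "edim V < \<infinity>" shows "closed V"
proof -
  have "sumset {0} V = V" by auto
  then show ?thesis
    using closed_sumset_finite_dim[of "{0}" V] V by (simp add: complex_vector.subspace_single_0)
qed

text \<open>Used with \<open>R = {0}\<close> and \<open>V\<close> inside a kernel for the nullity,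
  and with \<open>R\<close> a closed range and \<open>V\<close> transversal to it for the defect.
  The projection is built one basis vector at a time.\<close>

lemma finite_dim_projection:
  fixes R :: "'a::complex_normed_vector set"
  assumes R: "closed R" "csubspace R" and V: "csubspace V" "edim V < \<infinity>" and VR: "V \<inter> R = {0}"
  obtains Q where "Q \<in> bounded_ops UNIV" "\<And>x. x \<in> R \<Longrightarrow> Q x = 0" "\<And>v. v \<in> V \<Longrightarrow> Q v = v"
    "range Q \<subseteq> V"
proof -
  obtain B where B: "finite B" "complex_vector.independent B" "V = cspan B"
    using finite_dim_basis[OF V] by metis
  have "\<exists>Q\<in>bounded_ops UNIV. (\<forall>x\<in>R. Q x = 0) \<and> (\<forall>v\<in>cspan B. Q v = v) \<and> range Q \<subseteq> cspan B"
    if "finite B" "complex_vector.independent B" "cspan B \<inter> R = {0}" for B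
    using that
  proof (induction B rule: finite_induct)
    case empty
    then show ?case by (intro bexI[of _ "\<lambda>x. 0"]) (auto simp: bounded_ops_zero)
  next
    case (insert u B)
    have ind: "complex_vector.independent B" and uB: "u \<notin> cspan B"
      using insert.prems(1) insert.hyps complex_vector.independent_insert[of u B] by auto
    have sub: "cspan B \<subseteq> cspan (insert u B)" by (rule complex_vector.span_mono) auto
    have BR: "cspan B \<inter> R = {0}"
      using insert.prems(2) sub complex_vector.span_zero complex_vector.subspace_0[OF R(2)] by blast
    from insert.IH[OF ind BR] obtain Q where Q0: "Q \<in> bounded_ops UNIV" "\<forall>x\<in>R. Q x = 0"
      "\<forall>v\<in>cspan B. Q v = v" "range Q \<subseteq> cspan B"
      by (elim bexE conjE) (rule that)
    note Q = Q0(1) Q0(2)[rule_format] Q0(3)[rule_format] Q0(4)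
    have uI: "u \<in> cspan (insert u B)" by (simp add: complex_vector.span_base)
    have "u \<notin> cspan (R \<union> B)"
    proof
      assume "u \<in> cspan (R \<union> B)"
      then obtain r b where rb: "u = r + b" "r \<in> R" "b \<in> cspan B"
        using R(2) unfolding complex_vector.span_Un by (auto simp: complex_vector.span_eq_iff[THEN iffD2])
      have "r = u - b" using rb by simp
      then have "r \<in> cspan (insert u B)" using uI sub rb(3) complex_vector.span_diff by blast
      then have "r = 0" using insert.prems(2) rb(2) by blast
      then show False using rb uB by simp
    qed
    then obtain f :: "'a \<Rightarrow> complex" where f: "bounded_linear f" "\<And>c x. f (c *\<^sub>C x) = c * f x"
      "\<And>x. x \<in> cspan (R \<union> B) \<Longrightarrow> f x = 0" "f u = 1"
      using hahn_banach_functional[OF closed_cspan_Un_finite[OF R insert.hyps(1)] complex_vector.subspace_span]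
      by blast
    interpret f: bounded_linear f by fact
    \<comment> \<open>The added term repairs the value at \<open>u\<close> only: \<open>f\<close>
      vanishes on \<open>R\<close> and on the vectors already treated.\<close>
    define P where "P = (\<lambda>x. Q x + f x *\<^sub>C (u - Q u))"
    have Pb: "P \<in> bounded_ops UNIV"
      unfolding P_def by (intro bounded_ops_add Q(1) bounded_ops_rank_one f)
    have "P x = 0" if "x \<in> R" for x
      using that Q(2) f(3)[of x] by (simp add: P_def complex_vector.span_base)
    moreover have "P v = v" if v: "v \<in> cspan (insert u B)" for v
    proof -
      obtain k where k: "v - k *\<^sub>C u \<in> cspan B" using v unfolding complex_vector.span_breakdown_eq by blast
      have "v - k *\<^sub>C u \<in> cspan (R \<union> B)"
        using k complex_vector.span_mono[of B "R \<union> B"] by blast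
      then have "P (v - k *\<^sub>C u) = v - k *\<^sub>C u" using Q(3)[OF k] f(3) by (simp add: P_def)
      moreover have "P u = u" using f(4) by (simp add: P_def scaleC_one)
      ultimately show ?thesis by (simp add: bounded_ops_UNIV_D[OF Pb])
    qed
    moreover have "P x \<in> cspan (insert u B)" for x
      unfolding P_def using Q(4) sub uI
      by (intro complex_vector.span_add complex_vector.span_scale complex_vector.span_diff) auto
    ultimately show ?case using Pb by blast
  qed
  from this[OF B(1,2)] VR show thesis using that by (auto simp: B(3))
qed

section \<open>Invariant direct sums\<close>

lemma kernel_on_csubspace:
  assumes "clinear T" "csubspace Y" shows "csubspace (kernel_on Y T)"
proof -
  have "kernel_on Y T = Y \<inter> {x. T x \<in> {0}}" by (auto simp: kernel_on_def)
  then show ?thesis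
    using complex_vector.subspace_inter[OF assms(2) csubspace_vimage[OF assms(1) complex_vector.subspace_single_0]]
    by simp
qed

lemma direct_sumD:
  assumes "direct_sum Y M N"
  shows "csubspace M" "csubspace N" "M \<inter> N = {0}" "Y = sumset M N" "csubspace Y" "M \<subseteq> Y" "N \<subseteq> Y"
proof -
  show 1: "csubspace M" "csubspace N" "M \<inter> N = {0}" "Y = sumset M N"
    using assms by (auto simp: direct_sum_def)
  then show "csubspace Y" "M \<subseteq> Y" "N \<subseteq> Y"
    using complex_vector.subspace_sums[OF 1(1,2)] subset_sumset1[OF 1(2)] subset_sumset2[OF 1(1)] by auto
qed

lemma direct_sum_commute: "direct_sum Y M N \<Longrightarrow> direct_sum Y N M"
  unfolding direct_sum_def by (auto; metis add.commute)

lemma nullity_direct_sum: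
  assumes Y: "direct_sum Y M N" and T: "clinear T" "T ` M \<subseteq> M" "T ` N \<subseteq> N"
  shows "nullity Y T = nullity M T + nullity N T"
proof -
  note D = direct_sumD[OF Y]
  have add: "T (x + y) = T x + T y" for x y using T(1) by (simp add: clinear_iff)
  have "kernel_on Y T = sumset (kernel_on M T) (kernel_on N T)"
  proof
    show "kernel_on Y T \<subseteq> sumset (kernel_on M T) (kernel_on N T)"
    proof
      fix x assume "x \<in> kernel_on Y T"
      then obtain m n where mn: "x = m + n" "m \<in> M" "n \<in> N" "T m + T n = 0"
        unfolding kernel_on_def D(4) by (auto simp: add)
      have "T m = - T n" using mn(4) by (simp add: eq_neg_iff_add_eq_0)
      then have "T m \<in> M \<inter> N" using mn T complex_vector.subspace_neg[OF D(2), of "T n"] by auto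
      then have "T m = 0" "T n = 0" using D(3) mn(4) by auto
      then show "x \<in> sumset (kernel_on M T) (kernel_on N T)" using mn by (auto simp: kernel_on_def)
    qed
    show "sumset (kernel_on M T) (kernel_on N T) \<subseteq> kernel_on Y T"
      unfolding D(4) by (auto simp: kernel_on_def add)
  qed
  moreover have "kernel_on M T \<inter> kernel_on N T = {0}"
  proof -
    have "0 \<in> kernel_on M T \<inter> kernel_on N T"
      using complex_vector.subspace_0[OF kernel_on_csubspace[OF T(1) D(1)]]
        complex_vector.subspace_0[OF kernel_on_csubspace[OF T(1) D(2)]] by (rule IntI)
    then show ?thesis using D(3) by (auto simp: kernel_on_def)
  qed
  ultimately show ?thesis
    unfolding nullity_def using edim_sumset[OF kernel_on_csubspace[OF T(1) D(1)] kernel_on_csubspace[OF T(1) D(2)]]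
    by simp
qed

lemma image_direct_sum:
  assumes "clinear T" shows "T ` sumset M N = sumset (T ` M) (T ` N)"
proof -
  have add: "T (x + y) = T x + T y" for x y using assms by (simp add: clinear_iff)
  show ?thesis
  proof
    show "T ` sumset M N \<subseteq> sumset (T ` M) (T ` N)"
    proof
      fix y assume "y \<in> T ` sumset M N"
      then obtain m n where "m \<in> M" "n \<in> N" "y = T m + T n" by (auto simp: add)
      then show "y \<in> sumset (T ` M) (T ` N)" by blast
    qed
    show "sumset (T ` M) (T ` N) \<subseteq> T ` sumset M N"
    proof
      fix y assume "y \<in> sumset (T ` M) (T ` N)"
      then obtain m n where "m \<in> M" "n \<in> N" "y = T m + T n" by blast
      then show "y \<in> T ` sumset M N" by (intro image_eqI[of _ _ "m + n"]) (auto simp: add)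
    qed
  qed
qed

text \<open>Complements of the images in \<open>M\<close> and in \<open>N\<close> add up to a
  complement of the image of \<open>Y\<close>: by invariance every relation splits into its
  components in \<open>M\<close> and \<open>N\<close>.\<close>

lemma defect_direct_sum:
  assumes Y: "direct_sum Y M N" and T: "clinear T" "T ` M \<subseteq> M" "T ` N \<subseteq> N"
  shows "defect Y T = defect M T + defect N T"
proof -
  note D = direct_sumD[OF Y]
  obtain V where V: "direct_sum M (T ` M) V"
    using complement_exists[OF csubspace_image[OF T(1) D(1)] D(1) T(2)] .
  obtain W where W: "direct_sum N (T ` N) W"
    using complement_exists[OF csubspace_image[OF T(1) D(2)] D(2) T(3)] .
  note V' = direct_sumD[OF V] and W' = direct_sumD[OF W]
  have TY: "T ` Y = sumset (T ` M) (T ` N)" unfolding D(4) by (rule image_direct_sum[OF T(1)])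
  have VW: "V \<inter> W = {0}"
    using V'(7) W'(7) D(3) complex_vector.subspace_0[OF V'(2)] complex_vector.subspace_0[OF W'(2)] by blast
  have "direct_sum Y (T ` Y) (sumset V W)" unfolding direct_sum_def
  proof (intro conjI)
    show "csubspace (T ` Y)" by (rule csubspace_image[OF T(1) D(5)])
    show "csubspace (sumset V W)" by (rule complex_vector.subspace_sums[OF V'(2) W'(2)])
    have "x = 0" if x0: "x \<in> T ` Y \<inter> sumset V W" for x
    proof -
      obtain m n v w where x: "x = m + n" "m \<in> T ` M" "n \<in> T ` N" "x = v + w" "v \<in> V" "w \<in> W"
        using x0 unfolding TY by blast
      have "m - v \<in> M" using x V' complex_vector.subspace_diff[OF D(1)] by blast
      moreover have "m - v = w - n"
      proof -
        have "m + n = v + w" using x(1,4) by (rule subst)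
        then show ?thesis by (simp add: algebra_simps)
      qed
      moreover have "w - n \<in> N" using x W' complex_vector.subspace_diff[OF D(2)] by blast
      ultimately have "m - v = 0" "w - n = 0"
        using IntI[of "m - v" M N] D(3) by simp_all
      then have "m = v" "n = w" by auto
      then have "m = 0" "n = 0" using x V'(3) W'(3) by blast+
      then show ?thesis using x by simp
    qed
    moreover have "0 \<in> T ` Y \<inter> sumset V W"
      using complex_vector.subspace_0[OF csubspace_image[OF T(1) D(5)]]
        complex_vector.subspace_0[OF complex_vector.subspace_sums[OF V'(2) W'(2)]] by blast
    ultimately show "T ` Y \<inter> sumset V W = {0}" by blast
    show "Y = sumset (T ` Y) (sumset V W)"
    proof
      show "Y \<subseteq> sumset (T ` Y) (sumset V W)"
      proof
        fix y assume "y \<in> Y"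
        then obtain m n where y: "y = m + n" "m \<in> M" "n \<in> N" unfolding D(4) by blast
        obtain a v where a: "m = a + v" "a \<in> T ` M" "v \<in> V" using y(2) V'(4) by blast
        obtain b w where b: "n = b + w" "b \<in> T ` N" "w \<in> W" using y(3) W'(4) by blast
        have "y = (a + b) + (v + w)" using y a b by (simp add: algebra_simps)
        then show "y \<in> sumset (T ` Y) (sumset V W)" unfolding TY using a b by blast
      qed
      have "T ` Y \<subseteq> Y" unfolding TY using T D(1,2) unfolding D(4) by blast
      moreover have "sumset V W \<subseteq> Y" unfolding D(4) using V'(7) W'(7) by blast
      ultimately show "sumset (T ` Y) (sumset V W) \<subseteq> Y"
        using complex_vector.subspace_add[OF D(5)] by blast
    qed
  qed
  then have "defect Y T = edim (sumset V W)" unfolding defect_def by (rule ecodim_eq)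
  also have "\<dots> = edim V + edim W" by (rule edim_sumset[OF V'(2) W'(2) VW])
  also have "\<dots> = defect M T + defect N T"
    unfolding defect_def ecodim_eq[OF V] ecodim_eq[OF W] ..
  finally show ?thesis .
qed

text \<open>Addition maps the Banach space \<open>M \<times> N\<close> onto the whole space. The
  open mapping bound controls the unique pair above \<open>x\<close>, whose first component is
  \<open>P x\<close>.\<close>

lemma closed_direct_sum_projection:
  fixes M N :: "'a::complex_banach set"
  assumes MN: "direct_sum UNIV M N" and cl: "closed M" "closed N"
  obtains P where "P \<in> bounded_ops UNIV" "\<And>x. P x \<in> M" "\<And>x. x - P x \<in> N"
    "\<And>x. x \<in> M \<Longrightarrow> P x = x" "\<And>x. x \<in> N \<Longrightarrow> P x = 0"
proof -
  note D = direct_sumD[OF MN]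
  have "\<exists>m. m \<in> M \<and> x - m \<in> N" for x
  proof -
    have "x \<in> sumset M N" using D(4) by blast
    then obtain m n where "x = m + n" "m \<in> M" "n \<in> N" by blast
    then show ?thesis by (intro exI[of _ m]) simp
  qed
  then obtain P where P: "\<And>x. P x \<in> M" "\<And>x. x - P x \<in> N" by metis
  have uniq: "P x = m" if "m \<in> M" "x - m \<in> N" for x m
  proof -
    have "P x - m \<in> M" using P that complex_vector.subspace_diff[OF D(1)] by blast
    moreover have "P x - m \<in> N"
      using complex_vector.subspace_diff[OF D(2) that(2) P(2)[of x]] by simp
    ultimately have "P x - m \<in> M \<inter> N" by (rule IntI)
    then show ?thesis unfolding D(3) by simp
  qed
  have add: "P (x + y) = P x + P y" for x y
  proof (rule uniq)
    show "P x + P y \<in> M" using P complex_vector.subspace_add[OF D(1)] by blast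
    show "x + y - (P x + P y) \<in> N"
      using complex_vector.subspace_add[OF D(2) P(2)[of x] P(2)[of y]] by (simp add: algebra_simps)
  qed
  have scale: "P (c *\<^sub>C x) = c *\<^sub>C P x" for c x
  proof (rule uniq)
    show "c *\<^sub>C P x \<in> M" using P complex_vector.subspace_scale[OF D(1)] by blast
    show "c *\<^sub>C x - c *\<^sub>C P x \<in> N"
      using complex_vector.subspace_scale[OF D(2) P(2)[of x], of c]
      by (simp add: complex_vector.scale_right_diff_distrib)
  qed
  define F :: "'a \<times> 'a \<Rightarrow> 'a" where "F = (\<lambda>p. fst p + snd p)"
  have F: "bounded_linear F" unfolding F_def
    by (intro bounded_linear_add bounded_linear_fst bounded_linear_snd)
  have E: "closed (M \<times> N)" "subspace (M \<times> N)"
    using cl D by (auto intro: closed_Times subspace_Times csubspace_imp_subspace)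
  have FE: "F ` (M \<times> N) = UNIV"
  proof -
    have "x = F (P x, x - P x)" "(P x, x - P x) \<in> M \<times> N" for x using P by (auto simp: F_def)
    then show ?thesis by blast
  qed
  obtain C where C: "\<And>y. \<exists>x\<in>M \<times> N. F x = y \<and> norm x \<le> C * norm y"
    using open_mapping_bound[OF F E] unfolding FE by auto
  have "norm (P x) \<le> norm x * C" for x
  proof -
    obtain p where p: "p \<in> M \<times> N" "F p = x" "norm p \<le> C * norm x" using C by blast
    have "x - fst p = snd p" using p(2) by (auto simp: F_def)
    then have "P x = fst p" using p(1) by (intro uniq) auto
    then show ?thesis using p(3) norm_fst_le[of "fst p" "snd p"] by (simp add: mult.commute)
  qed
  then have "bounded_linear P"
    by (intro bounded_linear_intro) (auto simp: add scale scaleR_scaleC)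
  then have "P \<in> bounded_ops UNIV" by (simp add: bounded_ops_UNIV scale)
  moreover have "x \<in> M \<Longrightarrow> P x = x" "x \<in> N \<Longrightarrow> P x = 0" for x
    using complex_vector.subspace_0 D by (auto intro!: uniq)
  ultimately show thesis using that P by blast
qed

section \<open>The six classes in terms of closed range, nullity and defect\<close>

lemma regularity_cong:
  assumes "csubspace Y" "\<And>x. x \<in> Y \<Longrightarrow> S x = T x"
  shows "S \<in> regularity i Y \<longleftrightarrow> T \<in> regularity i Y"
proof -
  have im: "S ` Y = T ` Y" using assms(2) by (auto intro: image_cong)
  have k: "kernel_on Y S = kernel_on Y T" using assms(2) by (auto simp: kernel_on_def)
  have "S \<in> bounded_ops Y \<longleftrightarrow> T \<in> bounded_ops Y"
    unfolding bounded_ops_def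
    using im assms(2) complex_vector.subspace_add[OF assms(1)] complex_vector.subspace_scale[OF assms(1)]
    by auto
  then show ?thesis
    unfolding regularity_def upper_semi_fredholm_def lower_semi_fredholm_def fredholm_def
      upper_semi_weyl_def lower_semi_weyl_def weyl_def fredholm_index_def nullity_def defect_def
    by (simp add: im k)
qed

text \<open>The arguments stand for closedness of the range, nullity and defect. In cases 4 to 6 at
  least one of \<open>a\<close> and \<open>b\<close> is finite, so the value given to a difference
  of two infinities never decides.\<close>

definition regular_data :: "nat \<Rightarrow> bool \<Rightarrow> enat \<Rightarrow> enat \<Rightarrow> bool" where
  "regular_data i c a b \<longleftrightarrow>
    (i = 1 \<and> c \<and> a < \<infinity>) \<or> (i = 2 \<and> b < \<infinity>) \<or> (i = 3 \<and> a < \<infinity> \<and> b < \<infinity>) \<or>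
    (i = 4 \<and> c \<and> a < \<infinity> \<and> ereal_of_enat a - ereal_of_enat b \<le> 0) \<or>
    (i = 5 \<and> b < \<infinity> \<and> ereal_of_enat a - ereal_of_enat b \<ge> 0) \<or>
    (i = 6 \<and> a < \<infinity> \<and> b < \<infinity> \<and> ereal_of_enat a - ereal_of_enat b = 0)"

lemma regularity_iff:
  assumes "closed Y" "T \<in> bounded_ops UNIV" "T ` Y \<subseteq> Y"
  shows "T \<in> regularity i Y \<longleftrightarrow> regular_data i (closed (T ` Y)) (nullity Y T) (defect Y T)"
proof -
  have "T \<in> bounded_ops Y" using assms(2,3) by (rule bounded_ops_subspace)
  moreover have "closedin (top_of_set Y) (T ` Y) \<longleftrightarrow> closed (T ` Y)"
    using assms closedin_closed_eq by blast
  ultimately show ?thesis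
    unfolding regularity_def upper_semi_fredholm_def lower_semi_fredholm_def fredholm_def
      upper_semi_weyl_def lower_semi_weyl_def weyl_def fredholm_index_def regular_data_def
    by auto
qed

text \<open>This is the effect of splitting off one Jordan block: finiteness and the difference are
  unchanged.\<close>

lemma regular_data_Suc:
  "regular_data i c (a + 1) (b + 1) \<longleftrightarrow> regular_data i c a b"
  unfolding regular_data_def
  by (cases a; cases b) (simp_all add: one_enat_def)

lemma nullity_zero_iff:
  assumes "clinear T" "csubspace Y"
  shows "nullity Y T = 0 \<longleftrightarrow> kernel_on Y T = {0}"
proof
  assume "nullity Y T = 0"
  then have "edim (kernel_on Y T) = 0" by (simp add: nullity_def)
  moreover from this have "edim (kernel_on Y T) < \<infinity>" by simp
  ultimately obtain B where "finite B" "kernel_on Y T = cspan B" "card B = 0"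
    using finite_dim_basis[OF kernel_on_csubspace[OF assms]] by (metis enat_0_iff(1))
  then show "kernel_on Y T = {0}" by simp
qed (simp add: nullity_def)

lemma defect_zero:
  assumes "clinear T" "csubspace Y" "T ` Y = Y"
  shows "defect Y T = 0"
proof -
  have "sumset Y {0} = Y" by simp
  then have "ecodim Y Y \<le> edim ({0} :: 'a set)"
    by (intro ecodim_le[OF assms(2) complex_vector.subspace_single_0]) simp
  then show ?thesis using assms(3) by (simp add: defect_def)
qed

text \<open>A bijective summand adds nothing to nullity or defect. Closedness passes both ways,
  because the full range is the preimage under \<open>P\<close> of the image of \<open>M\<close>,
  and that image is the intersection of the full range with \<open>M\<close>.\<close>

lemma regularity_direct_sum_bijective:
  fixes M N :: "'a::complex_banach set"
  assumes MN: "direct_sum UNIV M N" and cl: "closed M" "closed N"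
    and T: "T \<in> bounded_ops UNIV" "T ` M \<subseteq> M" "T ` N = N" "kernel_on N T = {0}"
  shows "T \<in> regularity i UNIV \<longleftrightarrow> T \<in> regularity i M"
proof -
  note D = direct_sumD[OF MN] and TD = bounded_ops_UNIV_D[OF T(1)]
  obtain P where P: "P \<in> bounded_ops UNIV" "\<And>x. P x \<in> M" "\<And>x. x - P x \<in> N"
    "\<And>x. x \<in> M \<Longrightarrow> P x = x" "\<And>x. x \<in> N \<Longrightarrow> P x = 0"
    using closed_direct_sum_projection[OF MN cl] by blast
  have rT: "range T = P -` (T ` M)"
  proof
    show "P -` (T ` M) \<subseteq> range T"
    proof
      fix x assume "x \<in> P -` (T ` M)"
      then obtain m where m: "m \<in> M" "P x = T m" by auto
      obtain n where "n \<in> N" "x - P x = T n" using P(3)[of x] T(3) by blast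
      then have "x = T (m + n)" using m by (simp add: TD(3) algebra_simps)
      then show "x \<in> range T" by blast
    qed
    show "range T \<subseteq> P -` (T ` M)"
    proof safe
      fix x
      obtain m n where mn: "x = m + n" "m \<in> M" "n \<in> N" using D(4) by blast
      have "T m \<in> M" "T n \<in> N" using mn T by auto
      then have "P (T x) = T m"
        using mn P(4)[of "T m"] P(5)[of "T n"] by (auto simp: TD(3) bounded_ops_UNIV_D[OF P(1)])
      then show "T x \<in> P -` (T ` M)" using mn by simp
    qed
  qed
  have "closed (range T) \<longleftrightarrow> closed (T ` M)"
  proof
    assume "closed (T ` M)"
    then show "closed (range T)" unfolding rT
      using linear_continuous_at[OF bounded_ops_UNIV_D(1)[OF P(1)]] by (rule continuous_closed_vimage)
  next
    assume "closed (range T)"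
    moreover have "T ` M = range T \<inter> M" unfolding rT using T(2) P(4) by auto
    ultimately show "closed (T ` M)" using cl(1) by (auto intro: closed_Int)
  qed
  moreover have "nullity UNIV T = nullity M T" "defect UNIV T = defect M T"
    using nullity_direct_sum[OF MN TD(7) T(2)] defect_direct_sum[OF MN TD(7) T(2)] T(3)
      nullity_zero_iff[OF TD(7) D(2)] T(4) defect_zero[OF TD(7) D(2) T(3)] by simp_all
  ultimately show ?thesis
    using regularity_iff[OF cl(1) T(1,2)] regularity_iff[OF closed_UNIV T(1)] by simp
qed

section \<open>Quasinilpotent operators\<close>

lemma onorm_on_bound:
  assumes "S \<in> bounded_ops UNIV" "0 \<in> Y"
  shows "x \<in> Y \<Longrightarrow> norm (S x) \<le> onorm_on Y S * norm x" and "0 \<le> onorm_on Y S"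
proof -
  obtain K where K: "\<And>x. norm (S x) \<le> norm x * K"
    using bounded_linear.bounded[OF bounded_ops_UNIV_D(1)[OF assms(1)]] by blast
  have "norm (S x) / norm x \<le> \<bar>K\<bar>" for x
  proof (cases "x = 0")
    case False
    then show ?thesis using order_trans[OF K[of x] mult_left_mono[of K "\<bar>K\<bar>" "norm x"]]
      by (simp add: divide_le_eq mult.commute)
  qed simp
  then have bdd: "bdd_above ((\<lambda>x. norm (S x) / norm x) ` Y)" by (intro bdd_aboveI2)
  have up: "norm (S x) / norm x \<le> onorm_on Y S" if "x \<in> Y" for x
    unfolding onorm_on_def using that bdd by (rule cSUP_upper)
  show "0 \<le> onorm_on Y S" using up[OF assms(2)] by simp
  show "norm (S x) \<le> onorm_on Y S * norm x" if "x \<in> Y"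
    using up[OF that] bounded_ops_UNIV_D(5)[OF assms(1)] by (cases "x = 0") (simp_all add: divide_le_eq)
qed

lemma onorm_on_le:
  assumes "Y \<noteq> {}" "0 \<le> C" "\<And>x. x \<in> Y \<Longrightarrow> norm (S x) \<le> C * norm x"
  shows "onorm_on Y S \<le> C"
  unfolding onorm_on_def
proof (rule cSUP_least[OF assms(1)])
  fix x assume "x \<in> Y"
  then show "norm (S x) / norm x \<le> C"
    using assms(2,3) by (cases "x = 0") (simp_all add: divide_le_eq)
qed

text \<open>Geometric bounds for every ratio \<open>e\<close> replace the root limit; unlike roots
  of operator norms they combine directly over sums and compositions.\<close>

lemma quasinilpotent_iff:
  assumes T: "T \<in> bounded_ops UNIV" "T ` Y \<subseteq> Y" and Y: "0 \<in> Y"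
  shows "quasinilpotent Y T \<longleftrightarrow>
    (\<forall>e>0. \<exists>C. \<forall>n. \<forall>x\<in>Y. norm ((T ^^ n) x) \<le> C * e ^ n * norm x)"
proof
  note on = onorm_on_bound[OF bounded_ops_funpow[OF T(1)] Y]
  let ?o = "\<lambda>n. onorm_on Y (T ^^ n)"
  show "\<forall>e>0. \<exists>C. \<forall>n. \<forall>x\<in>Y. norm ((T ^^ n) x) \<le> C * e ^ n * norm x" if "quasinilpotent Y T"
  proof (intro allI impI)
    fix e :: real assume e: "e > 0"
    have "(\<lambda>n. root n (?o n)) \<longlonglongrightarrow> 0" using that by (simp add: quasinilpotent_def)
    then have "\<forall>\<^sub>F n in sequentially. root n (?o n) < e" using e by (rule order_tendstoD)
    then obtain N where N: "\<And>n. n \<ge> N \<Longrightarrow> root n (?o n) < e" by (auto simp: eventually_sequentially)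
    \<comment> \<open>The sum absorbs the finitely many \<open>n \<le> N\<close> where the root
      estimate is not yet in force; the summand 1 serves the larger \<open>n\<close>.\<close>
    define C where "C = 1 + (\<Sum>k\<le>N. ?o k / e ^ k)"
    have C1: "1 \<le> C" unfolding C_def using e on(2) by (simp add: sum_nonneg)
    have "?o n \<le> C * e ^ n" for n
    proof (cases "n \<le> N")
      case True
      then have "?o n / e ^ n \<le> (\<Sum>k\<le>N. ?o k / e ^ k)"
        using e on(2) by (intro member_le_sum) auto
      then have "?o n / e ^ n \<le> C" by (simp add: C_def)
      then show ?thesis using e by (simp add: divide_le_eq)
    next
      case False
      then have "?o n = root n (?o n) ^ n" using on(2) by simp
      also have "\<dots> \<le> e ^ n"
        using N[of n] False on(2) by (intro power_mono real_root_ge_zero) auto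
      also have "\<dots> \<le> C * e ^ n" using C1 e by simp
      finally show ?thesis .
    qed
    then have "norm ((T ^^ n) x) \<le> C * e ^ n * norm x" if "x \<in> Y" for n x
      using on(1)[OF that, of n] by (meson mult_right_mono norm_ge_zero order_trans)
    then show "\<exists>C. \<forall>n. \<forall>x\<in>Y. norm ((T ^^ n) x) \<le> C * e ^ n * norm x" by blast
  qed
  show "quasinilpotent Y T"
    if bd: "\<forall>e>0. \<exists>C. \<forall>n. \<forall>x\<in>Y. norm ((T ^^ n) x) \<le> C * e ^ n * norm x"
    unfolding quasinilpotent_def
  proof (rule conjI[OF bounded_ops_subspace[OF T]])
    show "(\<lambda>n. root n (?o n)) \<longlonglongrightarrow> 0"
    proof (rule order_tendstoI)
      fix a :: real assume "a < 0"
      then show "\<forall>\<^sub>F n in sequentially. a < root n (?o n)"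
        using on(2) by (intro always_eventually allI) (meson less_le_trans real_root_ge_zero)
    next
      fix r :: real assume r: "0 < r"
      \<comment> \<open>The ratio \<open>r / 2\<close> leaves a factor 2 to spare, which absorbs
        \<open>root n D\<close> eventually; \<open>D \<ge> 1\<close> ensures that these roots tend
        to 1.\<close>
      obtain C where C: "\<And>n x. x \<in> Y \<Longrightarrow> norm ((T ^^ n) x) \<le> C * (r / 2) ^ n * norm x"
        using bd r by (metis half_gt_zero)
      define D where "D = max C 1"
      have D: "?o n \<le> D * (r / 2) ^ n" for n
      proof (rule onorm_on_le)
        fix x assume "x \<in> Y"
        then have "norm ((T ^^ n) x) \<le> C * (r / 2) ^ n * norm x" by (rule C)
        also have "\<dots> \<le> D * (r / 2) ^ n * norm x"
          using r by (intro mult_right_mono) (auto simp: D_def)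
        finally show "norm ((T ^^ n) x) \<le> D * (r / 2) ^ n * norm x" .
      qed (use Y r in \<open>auto simp: D_def\<close>)
      have "(\<lambda>n. root n D) \<longlonglongrightarrow> 1" by (rule LIMSEQ_root_const) (simp add: D_def)
      then have "\<forall>\<^sub>F n in sequentially. root n D < 2" by (rule order_tendstoD) simp
      then show "\<forall>\<^sub>F n in sequentially. root n (?o n) < r"
        using eventually_gt_at_top[of 0]
      proof eventually_elim
        case (elim n)
        have "root n (?o n) \<le> root n (D * (r / 2) ^ n)"
          using D[of n] elim by simp
        also have "\<dots> = root n D * (r / 2)"
          using r elim by (simp add: real_root_mult real_root_power_cancel)
        also have "\<dots> < 2 * (r / 2)" using elim r by (intro mult_strict_right_mono) auto
        finally show ?case by simp
      qed
    qed
  qed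
qed

lemma quasinilpotent_of_nilpotent:
  assumes T: "T \<in> bounded_ops UNIV" "T ` Y \<subseteq> Y" and Y: "0 \<in> Y"
    and nil: "\<And>x. x \<in> Y \<Longrightarrow> (T ^^ k) x = 0"
  shows "quasinilpotent Y T"
  unfolding quasinilpotent_def
proof (rule conjI[OF bounded_ops_subspace[OF T]])
  have "onorm_on Y (T ^^ n) = 0" if "n \<ge> k" for n
  proof -
    have "(T ^^ n) x = 0" if x: "x \<in> Y" for x
    proof -
      have "(T ^^ n) x = (T ^^ (n - k)) ((T ^^ k) x)"
        using \<open>n \<ge> k\<close> by (metis comp_apply funpow_add le_add_diff_inverse2)
      then show ?thesis using nil[OF x] bounded_ops_UNIV_D(5)[OF bounded_ops_funpow[OF T(1)]] by simp
    qed
    then show ?thesis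
      using onorm_on_le[of Y 0 "T ^^ n"] onorm_on_bound(2)[OF bounded_ops_funpow[OF T(1)] Y, of n] Y by fastforce
  qed
  then have "\<forall>\<^sub>F n in sequentially. root n (onorm_on Y (T ^^ n)) = 0"
    unfolding eventually_sequentially by (intro exI[of _ k]) simp
  then show "(\<lambda>n. root n (onorm_on Y (T ^^ n))) \<longlonglongrightarrow> 0" by (rule tendsto_eventually)
qed

text \<open>The bounded \<open>Q\<close> controls both components of a vector by its norm, so the
  geometric bounds on \<open>N\<close> and \<open>L\<close> add up.\<close>

lemma quasinilpotent_sumset:
  assumes T: "T \<in> bounded_ops UNIV" "T ` N \<subseteq> N" "T ` L \<subseteq> L" and sub: "csubspace N" "csubspace L"
    and Q: "Q \<in> bounded_ops UNIV" "\<And>x. x \<in> N \<Longrightarrow> Q x = x" "\<And>x. x \<in> L \<Longrightarrow> Q x = 0"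
    and qn: "quasinilpotent N T" "quasinilpotent L T"
  shows "quasinilpotent (sumset N L) T"
proof -
  note TD = bounded_ops_UNIV_D[OF T(1)]
  have zN: "0 \<in> N" and zL: "0 \<in> L" using sub complex_vector.subspace_0 by auto
  have z: "0 \<in> sumset N L" using zN zL by force
  have inv: "T ` sumset N L \<subseteq> sumset N L"
    using image_direct_sum[OF TD(7), of N L] T(2,3) by blast
  obtain K where K: "\<And>x. norm (Q x) \<le> norm x * K"
    using bounded_linear.bounded[OF bounded_ops_UNIV_D(1)[OF Q(1)]] by blast
  show ?thesis unfolding quasinilpotent_iff[OF T(1) inv z]
  proof (intro allI impI)
    fix e :: real assume e: "e > 0"
    obtain C where C: "\<And>n x. x \<in> N \<Longrightarrow> norm ((T ^^ n) x) \<le> C * e ^ n * norm x"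
      using qn(1) e unfolding quasinilpotent_iff[OF T(1,2) zN] by blast
    obtain D where D: "\<And>n x. x \<in> L \<Longrightarrow> norm ((T ^^ n) x) \<le> D * e ^ n * norm x"
      using qn(2) e unfolding quasinilpotent_iff[OF T(1,3) zL] by blast
    have "norm ((T ^^ n) x) \<le> (\<bar>C\<bar> * \<bar>K\<bar> + \<bar>D\<bar> * (1 + \<bar>K\<bar>)) * e ^ n * norm x"
      if x0: "x \<in> sumset N L" for n x
    proof -
      obtain a b where x: "x = a + b" "a \<in> N" "b \<in> L" using x0 by blast
      have a: "Q x = a" using x Q by (simp add: bounded_ops_UNIV_D[OF Q(1)])
      have na: "norm a \<le> \<bar>K\<bar> * norm x"
        using order_trans[OF K[of x] mult_left_mono[OF abs_ge_self norm_ge_zero]] by (simp add: a mult.commute)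
      have nb: "norm b \<le> (1 + \<bar>K\<bar>) * norm x"
        using na norm_triangle_ineq4[of x a] x(1) by (simp add: algebra_simps)
      have "norm ((T ^^ n) x) \<le> norm ((T ^^ n) a) + norm ((T ^^ n) b)"
        unfolding x(1) bounded_ops_UNIV_D(3)[OF bounded_ops_funpow[OF T(1)]] by (rule norm_triangle_ineq)
      also have "\<dots> \<le> C * e ^ n * norm a + D * e ^ n * norm b" using C D x by (intro add_mono) auto
      also have "\<dots> \<le> \<bar>C\<bar> * e ^ n * (\<bar>K\<bar> * norm x) + \<bar>D\<bar> * e ^ n * ((1 + \<bar>K\<bar>) * norm x)"
        using e na nb by (intro add_mono mult_mono) auto
      finally show ?thesis by (simp add: algebra_simps)
    qed
    then show "\<exists>C. \<forall>n. \<forall>x\<in>sumset N L. norm ((T ^^ n) x) \<le> C * e ^ n * norm x" by blast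
  qed
qed

text \<open>For one fixed \<open>k\<close> the power \<open>T ^^ k\<close> has at most half the size
  of \<open>l ^ k\<close> on \<open>N\<close>. This excludes eigenvectors for \<open>l\<close>, and
  it makes a truncated Neumann series an approximate inverse that successive approximation turns
  into surjectivity.\<close>

lemma quasinilpotent_diff_scaleC_bijective:
  fixes T :: "'a::complex_banach \<Rightarrow> 'a"
  assumes T: "T \<in> bounded_ops UNIV" "T ` N \<subseteq> N" and N: "csubspace N" "closed N"
    and qn: "quasinilpotent N T" and l: "l \<noteq> 0"
  shows "(\<lambda>x. T x - l *\<^sub>C x) ` N = N" "kernel_on N (\<lambda>x. T x - l *\<^sub>C x) = {0}"
proof -
  let ?A = "\<lambda>x. T x - l *\<^sub>C x"
  note TD = bounded_ops_UNIV_D[OF T(1)]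
  have zN: "0 \<in> N" using N complex_vector.subspace_0 by auto
  have A: "?A \<in> bounded_ops UNIV" by (rule bounded_ops_diff_scaleC[OF T(1)])
  \<comment> \<open>Half of \<open>cmod l\<close>, so that \<open>C * e ^ k\<close> is
    \<open>cmod l ^ k\<close> times \<open>C * (1/2) ^ k\<close>, and the last factor can be made
    smaller than one half.\<close>
  define e where "e = cmod l / 2"
  have e: "e > 0" using l by (simp add: e_def)
  obtain C where C: "\<And>n x. x \<in> N \<Longrightarrow> norm ((T ^^ n) x) \<le> C * e ^ n * norm x"
    using qn e unfolding quasinilpotent_iff[OF T zN] by blast
  have "(\<lambda>n. C * (1/2) ^ n) \<longlonglongrightarrow> 0" by (intro tendsto_mult_right_zero LIMSEQ_power_zero) simp
  then have "\<forall>\<^sub>F n in sequentially. C * (1/2) ^ n < 1/2" by (rule order_tendstoD) simp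
  then obtain k where k: "C * (1/2) ^ k < 1/2" by (auto simp: eventually_sequentially)
  have Tk: "norm ((T ^^ k) x) \<le> cmod l ^ k * (norm x / 2)" if "x \<in> N" for x
  proof -
    have "norm ((T ^^ k) x) \<le> C * e ^ k * norm x" using C that by blast
    also have "\<dots> = cmod l ^ k * ((C * (1/2) ^ k) * norm x)" by (simp add: e_def power_divide)
    also have "\<dots> \<le> cmod l ^ k * ((1/2) * norm x)" using k by (intro mult_left_mono mult_right_mono) auto
    finally show ?thesis by simp
  qed
  have "x = 0" if "x \<in> kernel_on N ?A" for x
  proof -
    have x: "x \<in> N" "T x = l *\<^sub>C x" using that by (auto simp: kernel_on_def)
    have "(T ^^ n) x = l ^ n *\<^sub>C x" for n
      by (induction n) (simp_all add: scaleC_one TD x scaleC_scaleC mult.commute)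
    then have "cmod l ^ k * norm x \<le> cmod l ^ k * (norm x / 2)"
      using Tk[OF x(1)] by (simp add: norm_scaleC norm_power)
    then have "norm x \<le> norm x / 2" using l by simp
    then show ?thesis by simp
  qed
  moreover have "0 \<in> kernel_on N ?A" using zN by (simp add: kernel_on_def TD)
  ultimately show "kernel_on N ?A = {0}" by blast
  have AN: "?A ` N \<subseteq> N"
    using T(2) complex_vector.subspace_diff[OF N(1)] complex_vector.subspace_scale[OF N(1)] by blast
  have TnN: "(T ^^ n) y \<in> N" if "y \<in> N" for n y
    using that T(2) by (induction n) auto
  \<comment> \<open>The first \<open>k\<close> terms of the Neumann series of the inverse of
    \<open>T - l\<close>; the sum telescopes to the single error term in \<open>Ah\<close>.\<close>
  define h where "h = (\<lambda>y. - (\<Sum>j<k. (1 / l) ^ Suc j *\<^sub>C (T ^^ j) y))"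
  have hb: "h \<in> bounded_ops UNIV"
  proof -
    have "(\<lambda>y. \<Sum>j<n. (1 / l) ^ Suc j *\<^sub>C (T ^^ j) y) \<in> bounded_ops UNIV" for n
    proof (induction n)
      case (Suc n)
      show ?case
        using bounded_ops_add[OF Suc bounded_ops_scaleC[OF bounded_ops_funpow[OF T(1)]]]
        by (simp del: power_Suc)
    qed (simp add: bounded_ops_zero)
    then show ?thesis using bounded_ops_diff[OF bounded_ops_zero] unfolding h_def by fastforce
  qed
  obtain K where K: "\<And>y. norm (h y) \<le> norm y * K"
    using bounded_linear.bounded[OF bounded_ops_UNIV_D(1)[OF hb]] by blast
  have Ah: "?A (h y) = y - (1 / l) ^ k *\<^sub>C (T ^^ k) y" for y
  proof -
    have "?A (- (\<Sum>j<n. (1 / l) ^ Suc j *\<^sub>C (T ^^ j) y)) = y - (1 / l) ^ n *\<^sub>C (T ^^ n) y" for n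
    proof (induction n)
      case 0 then show ?case by (simp add: TD scaleC_one)
    next
      case (Suc n)
      let ?s = "\<Sum>j<n. (1 / l) ^ Suc j *\<^sub>C (T ^^ j) y"
      have "?A (- (\<Sum>j<Suc n. (1 / l) ^ Suc j *\<^sub>C (T ^^ j) y))
        = ?A (- ?s) - ?A ((1 / l) ^ Suc n *\<^sub>C (T ^^ n) y)"
        using bounded_ops_UNIV_D(4)[OF A, of "- ?s" "(1 / l) ^ Suc n *\<^sub>C (T ^^ n) y"] by simp
      also have "?A ((1 / l) ^ Suc n *\<^sub>C (T ^^ n) y)
        = (1 / l) ^ Suc n *\<^sub>C (T ^^ Suc n) y - (1 / l) ^ n *\<^sub>C (T ^^ n) y"
        using l by (simp add: TD scaleC_scaleC)
      finally show ?case unfolding Suc.IH by simp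
    qed
    then show ?thesis by (simp add: h_def)
  qed
  have "\<exists>x\<in>N. ?A x = y \<and> norm x \<le> 2 * K * norm y" if "y \<in> N" for y
  proof (rule approx_solvable_imp_solvable[OF bounded_ops_UNIV_D(1)[OF A] N(2)
        csubspace_imp_subspace[OF N(1)] csubspace_imp_subspace[OF N(1)] AN _ that])
    fix y assume y: "y \<in> N"
    have "h y \<in> N" unfolding h_def
      using y TnN by (intro complex_vector.subspace_neg[OF N(1)] complex_vector.subspace_sum[OF N(1)]
          complex_vector.subspace_scale[OF N(1)]) auto
    moreover have "norm (y - ?A (h y)) \<le> norm y / 2"
    proof -
      have "norm (y - ?A (h y)) = (1 / cmod l) ^ k * norm ((T ^^ k) y)"
        unfolding Ah by (simp add: norm_scaleC norm_power norm_divide)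
      also have "\<dots> \<le> (1 / cmod l) ^ k * (cmod l ^ k * (norm y / 2))"
        using Tk[OF y] by (intro mult_left_mono) auto
      also have "\<dots> = norm y / 2" using l by (simp add: power_divide)
      finally show ?thesis .
    qed
    ultimately show "\<exists>x\<in>N. norm x \<le> K * norm y \<and> norm (y - ?A x) \<le> norm y / 2"
      using K[of y] by (auto simp: mult.commute)
  qed
  then have "N \<subseteq> ?A ` N" by (intro subsetI) (blast intro: image_eqI[OF sym])
  then show "?A ` N = N" using AN by blast
qed

section \<open>Stability of Kato operators\<close>

text \<open>A quantitative closed range condition: for positive \<open>K\<close> and linear
  \<open>A\<close>, \<open>1 / K\<close> is a lower bound for the reduced minimum modulus. The
  explicit constant makes it possible to speak of uniformity over a family of shifts.\<close>

definition bounded_solvable :: "real \<Rightarrow> 'a::real_normed_vector set \<Rightarrow> ('a \<Rightarrow> 'a) \<Rightarrow> bool" where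
  "bounded_solvable K Y A \<longleftrightarrow> (\<forall>y\<in>A ` Y. \<exists>x\<in>Y. A x = y \<and> norm x \<le> K * norm y)"

abbreviation shift :: "('a::complex_normed_vector \<Rightarrow> 'a) \<Rightarrow> complex \<Rightarrow> 'a \<Rightarrow> 'a" where
  "shift T l \<equiv> \<lambda>x. T x - l *\<^sub>C x"

lemma shift_shift: "shift (shift T m) l = shift T (m + l)"
  by (simp add: scaleC_add_left fun_eq_iff)

lemma shift_zero: "shift T 0 = T"
  by (simp add: fun_eq_iff)

lemma shift_image_subset:
  assumes "csubspace Y" "T ` Y \<subseteq> Y" shows "shift T l ` Y \<subseteq> Y"
  using assms(2) complex_vector.subspace_diff[OF assms(1)] complex_vector.subspace_scale[OF assms(1)]
  by blast

lemma bounded_ops_norm_bound: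
  assumes "S \<in> bounded_ops UNIV"
  obtains B where "0 < B" "\<And>x. norm (S x) \<le> B * norm x"
  using bounded_linear.pos_bounded[OF bounded_ops_UNIV_D(1)[OF assms]] by (metis mult.commute)

lemma closed_imp_bounded_solvable:
  fixes T :: "'a::complex_banach \<Rightarrow> 'a"
  assumes "T \<in> bounded_ops UNIV" "closed Y" "csubspace Y" "closed (T ` Y)"
  obtains K where "0 < K" "bounded_solvable K Y T"
  using open_mapping_bound[OF bounded_ops_UNIV_D(1)[OF assms(1)] assms(2)
      csubspace_imp_subspace[OF assms(3)] assms(4)]
  unfolding bounded_solvable_def by blast

lemma bounded_solvable_imp_closed:
  fixes T :: "'a::complex_banach \<Rightarrow> 'a"
  assumes "T \<in> bounded_ops UNIV" "closed Y" "csubspace Y" "bounded_solvable K Y T"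
  shows "closed (T ` Y)"
  using closed_image_of_bounded_solvable[OF bounded_ops_UNIV_D(1)[OF assms(1)] assms(2)
      csubspace_imp_subspace[OF assms(3)]] assms(4)
  unfolding bounded_solvable_def by blast

lemma mult_le_half: "0 < c \<Longrightarrow> x < 1 / (2 * c) \<Longrightarrow> x * c \<le> 1 / 2" for x c :: real
  by (simp add: field_simps)

lemma funpow_image_subset: "T ` Y \<subseteq> Y \<Longrightarrow> (T ^^ n) ` Y \<subseteq> Y"
  by (induction n) auto

text \<open>Without the kernel condition the powers of an operator with closed range need not have
  closed range.\<close>

lemma bounded_solvable_funpow:
  assumes T: "T \<in> bounded_ops UNIV" "T ` Y \<subseteq> Y" and Y: "csubspace Y"
    and sol: "bounded_solvable K Y T" "0 < K"
    and ker: "\<And>j. j < n \<Longrightarrow> kernel_on Y T \<subseteq> (T ^^ j) ` Y"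
  shows "bounded_solvable (K ^ n) Y (T ^^ n)"
  using ker
proof (induction n)
  case 0
  then show ?case by (auto simp: bounded_solvable_def)
next
  case (Suc n)
  have IH: "bounded_solvable (K ^ n) Y (T ^^ n)" using Suc by simp
  show ?case unfolding bounded_solvable_def
  proof
    fix y assume "y \<in> (T ^^ Suc n) ` Y"
    then obtain w where w: "w \<in> Y" "y = T ((T ^^ n) w)" by auto
    have Tw: "(T ^^ n) w \<in> Y" using w(1) funpow_image_subset[OF T(2)] by blast
    then obtain x1 where x1: "x1 \<in> Y" "T x1 = y" "norm x1 \<le> K * norm y"
      using sol(1) w(2) unfolding bounded_solvable_def by blast
    \<comment> \<open>The controlled solution \<open>x1\<close> differs from
      \<open>(T ^^ n) w\<close> by a kernel vector, which lies in the range of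
      \<open>T ^^ n\<close>; so \<open>x1\<close> lies there too and can be lifted further.\<close>
    have "x1 - (T ^^ n) w \<in> kernel_on Y T"
      using x1 w Tw complex_vector.subspace_diff[OF Y] by (simp add: kernel_on_def bounded_ops_UNIV_D[OF T(1)])
    then obtain v where v: "v \<in> Y" "x1 - (T ^^ n) w = (T ^^ n) v" using Suc.prems[of n] by blast
    have "x1 = (T ^^ n) (v + w)"
      using v(2) by (simp add: bounded_ops_UNIV_D(3)[OF bounded_ops_funpow[OF T(1)]] algebra_simps)
    then have "x1 \<in> (T ^^ n) ` Y" using v w complex_vector.subspace_add[OF Y] by blast
    then obtain x where x: "x \<in> Y" "(T ^^ n) x = x1" "norm x \<le> K ^ n * norm x1"
      using IH unfolding bounded_solvable_def by blast
    have "norm x \<le> K ^ n * (K * norm y)"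
      using x(3) x1(3) sol(2) by (meson mult_left_mono order_trans zero_le_power less_imp_le)
    then show "\<exists>x\<in>Y. (T ^^ Suc n) x = y \<and> norm x \<le> K ^ Suc n * norm y"
      using x x1 by (intro bexI[of _ x]) (auto simp: algebra_simps)
  qed
qed

text \<open>The operator is onto on the generalized range \<open>Z = \<Inter>n. (T ^^ n) ` Y\<close> and bounded below
  modulo \<open>Z\<close>; both properties survive small shifts with uniform constants.\<close>

lemma kato_uniformly_solvable:
  fixes T :: "'a::complex_banach \<Rightarrow> 'a"
  assumes T: "T \<in> bounded_ops UNIV" "T ` Y \<subseteq> Y" and Y: "closed Y" "csubspace Y"
    and kato: "closed (T ` Y)" "\<And>n. kernel_on Y T \<subseteq> (T ^^ n) ` Y"
  obtains e K where "0 < e" "0 < K" "\<And>l. cmod l < e \<Longrightarrow> bounded_solvable K Y (shift T l)"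
proof -
  note TD = bounded_ops_UNIV_D[OF T(1)]
  obtain K where K: "0 < K" "bounded_solvable K Y T"
    using closed_imp_bounded_solvable[OF T(1) Y kato(1)] .
  obtain B where B: "0 < B" "\<And>x. norm (T x) \<le> B * norm x" using bounded_ops_norm_bound[OF T(1)] by blast
  define Z where "Z = (\<Inter>n. (T ^^ n) ` Y)"
  have clZ: "closed Z" unfolding Z_def
    using bounded_solvable_imp_closed[OF bounded_ops_funpow[OF T(1)] Y
        bounded_solvable_funpow[OF T Y(2) K(2,1) kato(2)]] by (intro closed_INT) auto
  have subZ: "csubspace Z" unfolding Z_def
    by (intro complex_vector.subspace_Inter)
      (auto intro: csubspace_image[OF bounded_ops_UNIV_D(7)[OF bounded_ops_funpow[OF T(1)]] Y(2)])
  have ZY: "Z \<subseteq> Y" using INT_lower[of 0 UNIV "\<lambda>n. (T ^^ n) ` Y"] by (simp add: Z_def)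
  have ZT: "Z \<subseteq> T ` Y" using INT_lower[of 1 UNIV "\<lambda>n. (T ^^ n) ` Y"] by (simp add: Z_def)
  have TZ: "T z \<in> Z" if "z \<in> Z" for z
    unfolding Z_def
  proof
    fix n
    obtain w where w: "w \<in> Y" "z = (T ^^ n) w" using \<open>z \<in> Z\<close> unfolding Z_def by blast
    have "T z = (T ^^ n) (T w)" unfolding w(2) by (simp add: funpow_swap1)
    then show "T z \<in> (T ^^ n) ` Y" using w(1) T(2) by blast
  qed
  \<comment> \<open>Here the kernel condition enters: every preimage of a vector of \<open>Z\<close>
    lies in \<open>Z\<close>. With \<open>ZT\<close>, \<open>T\<close> maps \<open>Z\<close> onto
    itself and induces an injective map modulo \<open>Z\<close>.\<close>
  have preZ: "x \<in> Z" if x: "x \<in> Y" "T x \<in> Z" for x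
    unfolding Z_def
  proof
    fix n
    obtain w where w: "w \<in> Y" "T x = (T ^^ Suc n) w" using x(2) unfolding Z_def by blast
    have Tw: "(T ^^ n) w \<in> Y" using w(1) funpow_image_subset[OF T(2)] by blast
    have "x - (T ^^ n) w \<in> kernel_on Y T"
      using x w Tw complex_vector.subspace_diff[OF Y(2)] by (simp add: kernel_on_def TD)
    then obtain v where v: "v \<in> Y" "x - (T ^^ n) w = (T ^^ n) v" using kato(2)[of n] by blast
    have "x = (T ^^ n) (v + w)"
      using v(2) by (simp add: bounded_ops_UNIV_D(3)[OF bounded_ops_funpow[OF T(1)]] algebra_simps)
    then show "x \<in> (T ^^ n) ` Y" using v w complex_vector.subspace_add[OF Y(2)] by blast
  qed
  have zne: "Z \<noteq> {}" using complex_vector.subspace_0[OF subZ] by blast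
  define e where "e = min 1 (1 / (2 * K))"
  \<comment> \<open>\<open>3 * K\<close> comes from the distance of \<open>x\<close> to a chosen
    \<open>z\<close> in \<open>Z\<close>, the factor \<open>1 + (B + 1) * (3 * K)\<close> from the
    shifted image of \<open>z\<close>, and \<open>2 * K\<close> from solving on \<open>Z\<close> for
    a better \<open>z'\<close>; the final solution is \<open>x - z + z'\<close>.\<close>
  define C where "C = 2 * K * (1 + (B + 1) * (3 * K)) + 3 * K"
  have C: "0 < C" unfolding C_def using K B by (intro add_nonneg_pos mult_nonneg_nonneg) auto
  have "bounded_solvable C Y (shift T l)" if l: "cmod l < e" for l
  proof -
    let ?A = "shift T l"
    have A: "?A \<in> bounded_ops UNIV" by (rule bounded_ops_diff_scaleC[OF T(1)])
    note AD = bounded_ops_UNIV_D[OF A]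
    have l1: "cmod l \<le> 1" and lK: "cmod l * K \<le> 1 / 2"
      using l K(1) by (auto simp: e_def field_simps)
    have AB: "norm (?A x) \<le> (B + 1) * norm x" for x
      using norm_triangle_ineq4[of "T x" "l *\<^sub>C x"] B(2)[of x] mult_right_mono[OF l1 norm_ge_zero[of x]]
      by (simp add: norm_scaleC algebra_simps)
    have AZ: "?A ` Z \<subseteq> Z"
      using shift_image_subset[OF subZ] TZ by blast
    \<comment> \<open>A preimage under \<open>T\<close> solves the shifted equation up to
      \<open>cmod l * K \<le> 1 / 2\<close>, so surjectivity on \<open>Z\<close> persists with the
      constant doubled.\<close>
    have solZ: "\<exists>x\<in>Z. ?A x = z \<and> norm x \<le> 2 * K * norm z" if "z \<in> Z" for z
    proof (rule approx_solvable_imp_solvable[OF AD(1) clZ csubspace_imp_subspace[OF subZ]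
          csubspace_imp_subspace[OF subZ] AZ _ that])
      fix z assume z: "z \<in> Z"
      then obtain x where x: "x \<in> Y" "T x = z" "norm x \<le> K * norm z"
        using K(2) ZT unfolding bounded_solvable_def by blast
      have "x \<in> Z" using preZ x z by blast
      moreover have "norm (z - ?A x) \<le> norm z / 2"
      proof -
        have "norm (z - ?A x) = cmod l * norm x" by (simp add: x(2) norm_scaleC)
        also have "\<dots> \<le> cmod l * (K * norm z)" using x(3) by (intro mult_left_mono) auto
        also have "\<dots> \<le> (1 / 2) * norm z"
          using mult_right_mono[OF lK norm_ge_zero[of z]] by (simp add: mult.assoc)
        finally show ?thesis by simp
      qed
      ultimately show "\<exists>x\<in>Z. norm x \<le> K * norm z \<and> norm (z - ?A x) \<le> norm z / 2"
        using x(3) by blast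
    qed
    \<comment> \<open>For \<open>w\<close> in \<open>Z\<close> write
      \<open>l *\<^sub>C w = T z\<close> with \<open>z\<close> in \<open>Z\<close>. Then
      \<open>T (x - z) = ?A x + l *\<^sub>C (x - w)\<close>, so the distance to \<open>Z\<close> is
      at most \<open>K * norm (?A x)\<close> plus half of \<open>dist x w\<close>; the infimum over
      \<open>w\<close> absorbs the half.\<close>
    have mod: "infdist x Z \<le> 2 * K * norm (?A x)" if x: "x \<in> Y" for x
    proof -
      have "2 * (infdist x Z - K * norm (?A x)) \<le> dist x w" if w: "w \<in> Z" for w
      proof -
        have lw: "l *\<^sub>C w \<in> Z" using w complex_vector.subspace_scale[OF subZ] by blast
        obtain z where "l *\<^sub>C w = T z" "z \<in> Y" using subsetD[OF ZT lw] by (rule imageE)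
        then have z: "z \<in> Y" "T z = l *\<^sub>C w" by simp_all
        then have zZ: "z \<in> Z" using preZ lw by simp
        have xz: "x - z \<in> Y" using x z complex_vector.subspace_diff[OF Y(2)] by blast
        then obtain v where v: "v \<in> Y" "T v = T (x - z)" "norm v \<le> K * norm (T (x - z))"
          using K(2) unfolding bounded_solvable_def by blast
        have "x - z - v \<in> Z"
          using preZ[of "x - z - v"] complex_vector.subspace_diff[OF Y(2) xz v(1)] v(2)
            complex_vector.subspace_0[OF subZ] by (simp add: TD)
        then have "x - v \<in> Z" using complex_vector.subspace_add[OF subZ _ zZ] by fastforce
        then have "infdist x Z \<le> norm v" using infdist_le[of "x - v" Z x] by (simp add: dist_norm)
        also have "\<dots> \<le> K * norm (?A x + l *\<^sub>C (x - w))"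
          using v(3) z(2) by (simp add: TD complex_vector.scale_right_diff_distrib)
        also have "\<dots> \<le> K * (norm (?A x) + cmod l * dist x w)"
          using K(1) norm_triangle_ineq[of "?A x" "l *\<^sub>C (x - w)"]
          by (intro mult_left_mono) (auto simp: dist_norm norm_scaleC)
        also have "\<dots> \<le> K * norm (?A x) + (1 / 2) * dist x w"
          using mult_right_mono[OF lK zero_le_dist[of x w]] by (simp add: algebra_simps)
        finally show ?thesis by simp
      qed
      then have "2 * (infdist x Z - K * norm (?A x)) \<le> infdist x Z"
        using zne by (subst (2) infdist_notempty) (auto intro!: cINF_greatest)
      then show ?thesis by simp
    qed
    show ?thesis unfolding bounded_solvable_def
    proof
      fix y assume "y \<in> ?A ` Y"
      then obtain x where x: "x \<in> Y" "y = ?A x" by blast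
      show "\<exists>x\<in>Y. ?A x = y \<and> norm x \<le> C * norm y"
      proof (cases "y = 0")
        case True
        then show ?thesis using complex_vector.subspace_0[OF Y(2)] by (intro bexI[of _ 0]) (auto simp: TD)
      next
        case False
        \<comment> \<open>The infimum need not be attained; raising 2 to 3 makes the inequality
          strict, so that some \<open>z\<close> realizes it.\<close>
        have "infdist x Z < 3 * K * norm y"
        proof -
          have "0 < K * norm y" using K(1) False by simp
          then show ?thesis using mod[OF x(1), folded x(2)] unfolding mult.assoc by linarith
        qed
        then obtain z where z: "z \<in> Z" "dist x z < 3 * K * norm y"
          using zne by (auto simp: infdist_notempty cINF_less_iff)
        have nAz: "norm (?A z) \<le> (1 + (B + 1) * (3 * K)) * norm y"
        proof -
          have "?A z = y - ?A (x - z)" using x(2) AD(4)[of x z] by simp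
          then have "norm (?A z) \<le> norm y + norm (?A (x - z))" by (metis norm_triangle_ineq4)
          also have "\<dots> \<le> norm y + (B + 1) * (3 * K * norm y)"
          proof (intro add_left_mono order_trans[OF AB] mult_left_mono)
            show "norm (x - z) \<le> 3 * K * norm y" using z(2) by (simp add: dist_norm)
          qed (use B(1) in simp)
          finally show ?thesis by (simp add: algebra_simps)
        qed
        obtain z' where z': "z' \<in> Z" "?A z' = ?A z" "norm z' \<le> 2 * K * norm (?A z)"
          using solZ[of "?A z"] AZ z(1) by blast
        have "norm z' \<le> 2 * K * ((1 + (B + 1) * (3 * K)) * norm y)"
          by (rule order_trans[OF z'(3) mult_left_mono[OF nAz]]) (use K(1) in simp)
        moreover have "norm (x - z + z') \<le> dist x z + norm z'"
          using norm_triangle_ineq[of "x - z" z'] by (simp add: dist_norm)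
        ultimately have "norm (x - z + z') \<le> C * norm y" using z(2) by (simp add: C_def algebra_simps)
        moreover have "x - z + z' \<in> Y"
          using x(1) z(1) z'(1) ZY complex_vector.subspace_diff[OF Y(2)] complex_vector.subspace_add[OF Y(2)]
          by blast
        moreover have "?A (x - z + z') = y"
          using AD(3)[of "x - z" z'] AD(4)[of x z] z'(2) x(2) by simp
        ultimately show ?thesis by blast
      qed
    qed
  qed
  moreover have "0 < e" using K(1) by (simp add: e_def)
  ultimately show thesis using that C by blast
qed

section \<open>Semicontinuity of nullity and defect under small shifts\<close>

lemma nullity_lower_semicontinuous:
  fixes A :: "'a::complex_banach \<Rightarrow> 'a"
  assumes A: "A \<in> bounded_ops UNIV" and Y: "csubspace Y"
    and e: "0 < e" and sol: "\<And>l. cmod l < e \<Longrightarrow> bounded_solvable K Y (shift A l)" and K: "0 < K"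
    and m: "enat m \<le> nullity Y A"
  obtains d where "0 < d" "\<And>l. cmod l < d \<Longrightarrow> enat m \<le> nullity Y (shift A l)"
proof -
  note AD = bounded_ops_UNIV_D[OF A]
  obtain V where V: "csubspace V" "V \<subseteq> kernel_on Y A" "edim V = enat m"
    using edim_ge_subspace[OF kernel_on_csubspace[OF AD(7) Y] m[unfolded nullity_def]] .
  have V0: "V \<inter> {0} = {0}" using complex_vector.subspace_0[OF V(1)] by blast
  have Vf: "edim V < \<infinity>" using V(3) by simp
  obtain Q where Q: "Q \<in> bounded_ops UNIV" "\<And>v. v \<in> V \<Longrightarrow> Q v = v" "range Q \<subseteq> V"
    using finite_dim_projection[OF closed_singleton complex_vector.subspace_single_0 V(1) Vf V0] by metis
  note QD = bounded_ops_UNIV_D[OF Q(1)]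
  obtain B where B: "0 < B" "\<And>x. norm (Q x) \<le> B * norm x" using bounded_ops_norm_bound[OF Q(1)] by blast
  define d where "d = min e (1 / (2 * B * K))"
  have "enat m \<le> nullity Y (shift A l)" if l: "cmod l < d" for l
  proof -
    let ?U = "kernel_on Y (shift A l)"
    have le: "cmod l < e" and lBK: "B * (K * cmod l) \<le> 1 / 2"
      using l B K by (auto simp: d_def field_simps)
    have lA: "shift A l \<in> bounded_ops UNIV" by (rule bounded_ops_diff_scaleC[OF A])
    have U: "csubspace ?U" by (rule kernel_on_csubspace[OF bounded_ops_UNIV_D(7)[OF lA] Y])
    have QU: "csubspace (Q ` ?U)" by (rule csubspace_image[OF QD(7) U])
    have QUV: "Q ` ?U \<subseteq> V" using Q(3) by blast
    have "edim (Q ` ?U) < \<infinity>" using edim_mono[OF QUV] Vf by (rule le_less_trans)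
    then have clQU: "closed (Q ` ?U)" by (rule closed_finite_dim[OF QU])
    \<comment> \<open>A kernel vector \<open>b\<close> of \<open>A\<close> has the small image
      \<open>- (l *\<^sub>C b)\<close> under the shift. The uniform constant gives a small
      \<open>c\<close> with the same image, so \<open>b - c\<close> lies in the new kernel and
      \<open>Q\<close> sends it close to \<open>b\<close>.\<close>
    have "Q ` ?U = V"
    proof (rule closed_subspace_eq_of_half_approx[OF clQU csubspace_imp_subspace[OF QU] QUV
          csubspace_imp_subspace[OF V(1)]])
      fix b assume b: "b \<in> V"
      then have bk: "b \<in> Y" "A b = 0" using V(2) by (auto simp: kernel_on_def)
      then have "shift A l b \<in> shift A l ` Y" by blast
      then obtain c where c: "c \<in> Y" "shift A l c = shift A l b" "norm c \<le> K * norm (shift A l b)"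
        using sol[OF le] unfolding bounded_solvable_def by blast
      have "b - c \<in> ?U"
        using bk c complex_vector.subspace_diff[OF Y]
          bounded_ops_UNIV_D(4)[OF lA, of b c] by (simp add: kernel_on_def)
      moreover have "norm (b - Q (b - c)) \<le> norm b / 2"
      proof -
        have "norm (b - Q (b - c)) = norm (Q c)" by (simp add: QD Q(2)[OF b])
        also have "\<dots> \<le> B * norm c" by (rule B(2))
        also have "\<dots> \<le> B * (K * (cmod l * norm b))"
          using c(3) bk B(1) by (intro mult_left_mono) (auto simp: norm_scaleC)
        also have "\<dots> \<le> (1 / 2) * norm b"
          using mult_right_mono[OF lBK norm_ge_zero[of b]] by (simp add: mult.assoc)
        finally show ?thesis by simp
      qed
      ultimately show "\<exists>v\<in>Q ` ?U. norm (b - v) \<le> norm b / 2" by blast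
    qed
    then have "edim V \<le> edim ?U" using edim_image_le[OF QD(7) U] by simp
    then show ?thesis using V(3) by (simp add: nullity_def)
  qed
  moreover have "0 < d" using e B K by (simp add: d_def)
  ultimately show thesis using that by blast
qed

text \<open>A projection \<open>Q\<close> onto the kernel of \<open>A\<close> stays injective on the
  kernels of nearby shifts: if \<open>Q u = 0\<close> there, then \<open>u = x - Q x\<close> for a
  solution \<open>x\<close> of \<open>A x = l *\<^sub>C u\<close>, whence the norm of
  \<open>u\<close> is at most half of itself.\<close>

lemma nullity_upper_semicontinuous:
  fixes A :: "'a::complex_banach \<Rightarrow> 'a"
  assumes A: "A \<in> bounded_ops UNIV" "A ` Y \<subseteq> Y" and Y: "csubspace Y"
    and sol: "bounded_solvable K Y A" and K: "0 < K" and fin: "nullity Y A < \<infinity>"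
  obtains d where "0 < d" "\<And>l. cmod l < d \<Longrightarrow> nullity Y (shift A l) \<le> nullity Y A"
proof -
  note AD = bounded_ops_UNIV_D[OF A(1)]
  let ?V = "kernel_on Y A"
  have V: "csubspace ?V" by (rule kernel_on_csubspace[OF AD(7) Y])
  have Vf: "edim ?V < \<infinity>" using fin by (simp add: nullity_def)
  have V0: "?V \<inter> {0} = {0}" using complex_vector.subspace_0[OF V] by blast
  obtain Q where Q: "Q \<in> bounded_ops UNIV" "\<And>v. v \<in> ?V \<Longrightarrow> Q v = v" "range Q \<subseteq> ?V"
    using finite_dim_projection[OF closed_singleton complex_vector.subspace_single_0 V Vf V0] by metis
  note QD = bounded_ops_UNIV_D[OF Q(1)]
  obtain B where B: "0 < B" "\<And>x. norm (Q x) \<le> B * norm x" using bounded_ops_norm_bound[OF Q(1)] by blast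
  define d where "d = 1 / (2 * ((1 + B) * K))"
  have "nullity Y (shift A l) \<le> nullity Y A" if l: "cmod l < d" for l
  proof -
    let ?U = "kernel_on Y (shift A l)"
    have lBK: "(1 + B) * (K * cmod l) \<le> 1 / 2"
    proof -
      have "0 < (1 + B) * K" using B(1) K by simp
      then have "cmod l * ((1 + B) * K) \<le> 1 / 2"
        by (rule mult_le_half) (use l in \<open>simp add: d_def\<close>)
      then show ?thesis by (simp add: mult_ac)
    qed
    have U: "csubspace ?U"
      using kernel_on_csubspace[OF bounded_ops_UNIV_D(7)[OF bounded_ops_diff_scaleC[OF A(1)]] Y] .
    have Q0: "u = 0" if u: "u \<in> ?U" "Q u = 0" for u
    proof -
      have uY: "u \<in> Y" "A u = l *\<^sub>C u" using u by (auto simp: kernel_on_def)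
      then obtain x where x: "x \<in> Y" "A x = A u" "norm x \<le> K * norm (A u)"
        using sol unfolding bounded_solvable_def by blast
      have "u - x \<in> ?V" using uY x complex_vector.subspace_diff[OF Y] by (simp add: kernel_on_def AD)
      then have "u - x = - Q x" using Q(2)[of "u - x"] u(2) by (simp add: QD)
      then have "u = x - Q x" by (simp add: algebra_simps)
      then have "norm u \<le> norm x + norm (Q x)" by (metis norm_triangle_ineq4)
      also have "\<dots> \<le> (1 + B) * norm x" using B(2)[of x] by (simp add: algebra_simps)
      also have "\<dots> \<le> (1 + B) * (K * (cmod l * norm u))"
        using x(3) B(1) uY by (intro mult_left_mono) (auto simp: norm_scaleC)
      also have "\<dots> \<le> (1 / 2) * norm u"
        using mult_right_mono[OF lBK norm_ge_zero[of u]] by (simp add: mult.assoc)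
      finally show ?thesis by simp
    qed
    have "inj_on Q ?U"
    proof (rule inj_onI)
      fix u v assume "u \<in> ?U" "v \<in> ?U" "Q u = Q v"
      then show "u = v"
        using Q0[of "u - v"] complex_vector.subspace_diff[OF U] by (simp add: QD)
    qed
    then show ?thesis unfolding nullity_def
      using edim_le_of_inj[OF QD(7) U _ subset_trans[OF image_mono[OF subset_UNIV] Q(3)]] by blast
  qed
  moreover have "0 < d" using B K by (simp add: d_def)
  ultimately show thesis using that by blast
qed

text \<open>A finite dimensional \<open>V\<close> transversal to the range stays transversal. With
  \<open>Q\<close> fixing \<open>V\<close> and killing the range of \<open>A\<close>, a common
  vector \<open>w\<close> satisfies \<open>w = Q w = - (l *\<^sub>C Q x)\<close> with
  \<open>x\<close> controlled by \<open>w\<close>, so \<open>w = 0\<close>.\<close>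

lemma defect_lower_semicontinuous:
  fixes A :: "'a::complex_banach \<Rightarrow> 'a"
  assumes A: "A \<in> bounded_ops UNIV" "A ` Y \<subseteq> Y" and Y: "closed Y" "csubspace Y"
    and e: "0 < e" and sol: "\<And>l. cmod l < e \<Longrightarrow> bounded_solvable K Y (shift A l)" and K: "0 < K"
    and m: "enat m \<le> defect Y A"
  obtains d where "0 < d" "\<And>l. cmod l < d \<Longrightarrow> enat m \<le> defect Y (shift A l)"
proof -
  note AD = bounded_ops_UNIV_D[OF A(1)]
  have sol0: "bounded_solvable K Y A" using sol[of 0] e by (simp add: shift_zero)
  have cl: "closed (A ` Y)" by (rule bounded_solvable_imp_closed[OF A(1) Y sol0])
  have AY: "csubspace (A ` Y)" by (rule csubspace_image[OF AD(7) Y(2)])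
  obtain W where W: "direct_sum Y (A ` Y) W" using complement_exists[OF AY Y(2) A(2)] .
  note WD = direct_sumD[OF W]
  have "enat m \<le> edim W" using m by (simp add: defect_def ecodim_eq[OF W])
  then obtain V where V: "csubspace V" "V \<subseteq> W" "edim V = enat m"
    using edim_ge_subspace[OF WD(2)] by blast
  have Vf: "edim V < \<infinity>" using V(3) by simp
  have V0: "V \<inter> A ` Y = {0}"
    using WD(3) V(2) complex_vector.subspace_0[OF V(1)] complex_vector.subspace_0[OF AY] by blast
  obtain Q where Q: "Q \<in> bounded_ops UNIV" "\<And>x. x \<in> A ` Y \<Longrightarrow> Q x = 0" "\<And>v. v \<in> V \<Longrightarrow> Q v = v"
    using finite_dim_projection[OF cl AY V(1) Vf V0] by metis
  note QD = bounded_ops_UNIV_D[OF Q(1)]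
  obtain B where B: "0 < B" "\<And>x. norm (Q x) \<le> B * norm x" using bounded_ops_norm_bound[OF Q(1)] by blast
  define d where "d = min e (1 / (2 * B * K))"
  have "enat m \<le> defect Y (shift A l)" if l: "cmod l < d" for l
  proof -
    have le: "cmod l < e" and lBK: "cmod l * (B * K) \<le> 1 / 2"
      using l B K by (auto simp: d_def field_simps)
    have lA: "shift A l \<in> bounded_ops UNIV" by (rule bounded_ops_diff_scaleC[OF A(1)])
    have R: "csubspace (shift A l ` Y)" by (rule csubspace_image[OF bounded_ops_UNIV_D(7)[OF lA] Y(2)])
    have "w = 0" if w: "w \<in> shift A l ` Y" "w \<in> V" for w
    proof -
      obtain x where x: "x \<in> Y" "shift A l x = w" "norm x \<le> K * norm w"
        using sol[OF le] w(1) unfolding bounded_solvable_def by blast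
      have "w = Q (A x) - l *\<^sub>C Q x" using Q(3)[OF w(2)] x(2) by (metis QD(2) QD(4))
      then have "norm w = cmod l * norm (Q x)" using Q(2)[of "A x"] x(1) by (simp add: norm_scaleC)
      also have "\<dots> \<le> cmod l * (B * (K * norm w))"
        using order_trans[OF B(2)[of x] mult_left_mono[OF x(3) less_imp_le[OF B(1)]]]
        by (intro mult_left_mono) auto
      also have "\<dots> \<le> (1 / 2) * norm w"
        using mult_right_mono[OF lBK norm_ge_zero[of w]] by (simp add: mult.assoc)
      finally show ?thesis by simp
    qed
    then have "shift A l ` Y \<inter> V = {0}"
      using complex_vector.subspace_0[OF V(1)] complex_vector.subspace_0[OF R] by blast
    then have "edim V \<le> ecodim Y (shift A l ` Y)"
      using V(2) WD(7) by (intro ecodim_ge[OF R Y(2) V(1) shift_image_subset[OF Y(2) A(2)]]) auto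
    then show ?thesis using V(3) by (simp add: defect_def)
  qed
  moreover have "0 < d" using e B K by (simp add: d_def)
  ultimately show thesis using that by blast
qed

text \<open>A complement \<open>W\<close> of the range still spans \<open>Y\<close> together with
  the shifted range: \<open>y - Q y = A x\<close> is met by the shift up to
  \<open>l *\<^sub>C x\<close>. The sum is closed, since the shifted range is closed and
  \<open>W\<close> is finite dimensional, so half approximation suffices.\<close>

lemma defect_upper_semicontinuous:
  fixes A :: "'a::complex_banach \<Rightarrow> 'a"
  assumes A: "A \<in> bounded_ops UNIV" "A ` Y \<subseteq> Y" and Y: "closed Y" "csubspace Y"
    and e: "0 < e" and sol: "\<And>l. cmod l < e \<Longrightarrow> bounded_solvable K Y (shift A l)" and K: "0 < K"
    and fin: "defect Y A < \<infinity>"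
  obtains d where "0 < d" "\<And>l. cmod l < d \<Longrightarrow> defect Y (shift A l) \<le> defect Y A"
proof -
  note AD = bounded_ops_UNIV_D[OF A(1)]
  have sol0: "bounded_solvable K Y A" using sol[of 0] e by (simp add: shift_zero)
  have cl: "closed (A ` Y)" by (rule bounded_solvable_imp_closed[OF A(1) Y sol0])
  have AY: "csubspace (A ` Y)" by (rule csubspace_image[OF AD(7) Y(2)])
  obtain W where W: "direct_sum Y (A ` Y) W" using complement_exists[OF AY Y(2) A(2)] .
  note WD = direct_sumD[OF W]
  have dW: "defect Y A = edim W" by (simp add: defect_def ecodim_eq[OF W])
  have Wf: "edim W < \<infinity>" using fin dW by simp
  have W0: "W \<inter> A ` Y = {0}" using WD(3) by (simp add: Int_commute)
  obtain Q where Q: "Q \<in> bounded_ops UNIV" "\<And>x. x \<in> A ` Y \<Longrightarrow> Q x = 0" "\<And>v. v \<in> W \<Longrightarrow> Q v = v"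
    "range Q \<subseteq> W"
    using finite_dim_projection[OF cl AY WD(2) Wf W0] by metis
  note QD = bounded_ops_UNIV_D[OF Q(1)]
  obtain B where B: "0 < B" "\<And>x. norm (Q x) \<le> B * norm x" using bounded_ops_norm_bound[OF Q(1)] by blast
  define d where "d = min e (1 / (2 * ((1 + B) * K)))"
  have "defect Y (shift A l) \<le> defect Y A" if l: "cmod l < d" for l
  proof -
    have le: "cmod l < e" using l by (simp add: d_def)
    have lBK: "cmod l * (K * (1 + B)) \<le> 1 / 2"
    proof -
      have "0 < (1 + B) * K" using B(1) K by simp
      then have "cmod l * ((1 + B) * K) \<le> 1 / 2"
        by (rule mult_le_half) (use l in \<open>simp add: d_def\<close>)
      then show ?thesis by (simp add: mult_ac)
    qed
    have lA: "shift A l \<in> bounded_ops UNIV" by (rule bounded_ops_diff_scaleC[OF A(1)])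
    let ?R = "shift A l ` Y"
    have R: "csubspace ?R" by (rule csubspace_image[OF bounded_ops_UNIV_D(7)[OF lA] Y(2)])
    have clR: "closed ?R" by (rule bounded_solvable_imp_closed[OF lA Y sol[OF le]])
    have RW: "csubspace (sumset ?R W)" by (rule complex_vector.subspace_sums[OF R WD(2)])
    have RWY: "sumset ?R W \<subseteq> Y"
      using shift_image_subset[OF Y(2) A(2), of l] WD(7) complex_vector.subspace_add[OF Y(2)] by blast
    have "sumset ?R W = Y"
    proof (rule closed_subspace_eq_of_half_approx[OF closed_sumset_finite_dim[OF clR R WD(2) Wf]
          csubspace_imp_subspace[OF RW] RWY csubspace_imp_subspace[OF Y(2)]])
      fix y assume "y \<in> Y"
      then obtain r w where rw: "y = r + w" "r \<in> A ` Y" "w \<in> W" using WD(4) by blast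
      have "y - Q y = r" using rw Q(2)[OF rw(2)] Q(3)[OF rw(3)] by (simp add: QD)
      then obtain x where x: "x \<in> Y" "A x = y - Q y" "norm x \<le> K * norm (y - Q y)"
        using sol0 rw(2) unfolding bounded_solvable_def by metis
      have "norm (y - (shift A l x + Q y)) = cmod l * norm x" by (simp add: x(2) norm_scaleC)
      also have "\<dots> \<le> cmod l * (K * ((1 + B) * norm y))"
      proof (intro mult_left_mono order_trans[OF x(3)])
        show "norm (y - Q y) \<le> (1 + B) * norm y"
          using norm_triangle_ineq4[of y "Q y"] B(2)[of y] by (simp add: algebra_simps)
      qed (use K in auto)
      also have "\<dots> \<le> (1 / 2) * norm y"
        using mult_right_mono[OF lBK norm_ge_zero[of y]] by (simp add: mult.assoc)
      finally have "norm (y - (shift A l x + Q y)) \<le> norm y / 2" by simp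
      moreover have "shift A l x + Q y \<in> sumset ?R W" using x(1) Q(4) by blast
      ultimately show "\<exists>v\<in>sumset ?R W. norm (y - v) \<le> norm y / 2" by blast
    qed
    then have "ecodim Y ?R \<le> edim W" by (intro ecodim_le[OF R WD(2)]) simp
    then show ?thesis unfolding dW by (simp only: defect_def)
  qed
  moreover have "0 < d" using e B K by (simp add: d_def)
  ultimately show thesis using that by blast
qed

text \<open>For each finite \<open>m\<close> the condition \<open>enat m \<le> f x\<close> is
  locally constant: \<open>lower\<close> preserves it nearby, and where it fails \<open>f x\<close>
  is finite and \<open>upper\<close> preserves the failure. Finite thresholds determine an extended
  number, infinity included.\<close>

lemma enat_locally_constant_imp_constant:
  fixes f :: "'b::metric_space \<Rightarrow> enat"
  assumes S: "connected S" "a \<in> S" "b \<in> S"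
    and lower: "\<And>x m. x \<in> S \<Longrightarrow> enat m \<le> f x \<Longrightarrow> \<exists>d>0. \<forall>y. dist y x < d \<longrightarrow> enat m \<le> f y"
    and upper: "\<And>x. x \<in> S \<Longrightarrow> f x < \<infinity> \<Longrightarrow> \<exists>d>0. \<forall>y. dist y x < d \<longrightarrow> f y \<le> f x"
  shows "f a = f b"
proof -
  have eq: "(enat m \<le> f a) = (enat m \<le> f b)" for m
  proof (rule connected_local_const[OF S(1-3)], intro ballI)
    fix x assume x: "x \<in> S"
    show "\<forall>\<^sub>F y in at x within S. (enat m \<le> f x) = (enat m \<le> f y)"
    proof (cases "enat m \<le> f x")
      case True
      then show ?thesis using lower[OF x True] unfolding eventually_at by blast
    next
      case False
      then have "f x < enat m" by simp
      then have "f x < \<infinity>" by (rule less_trans) simp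
      then obtain d where "d > 0" "\<And>y. dist y x < d \<Longrightarrow> f y \<le> f x" using upper[OF x] by blast
      then show ?thesis using \<open>f x < enat m\<close> unfolding eventually_at
        by (intro exI[of _ d]) (auto dest: le_less_trans simp: not_le)
    qed
  qed
  have le: "p \<le> q" if "\<And>m. enat m \<le> p \<Longrightarrow> enat m \<le> q" for p q :: enat
  proof (cases p)
    case infinity
    then have "enat m \<le> q" for m using that by simp
    from this[of "Suc (the_enat q)"] show ?thesis by (cases q) auto
  qed (use that in simp)
  show ?thesis
  proof (rule antisym)
    show "f a \<le> f b" by (rule le) (use eq in blast)
    show "f b \<le> f a" by (rule le) (use eq in blast)
  qed
qed

text \<open>The same \<open>K\<close> serves around every centre \<open>m\<close> of the disc, so
  the semicontinuity lemmas apply at all points and not just at 0, and both numbers are locally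
  constant throughout.\<close>

lemma kato_stable:
  fixes T :: "'a::complex_banach \<Rightarrow> 'a"
  assumes T: "T \<in> bounded_ops UNIV" "T ` Y \<subseteq> Y" and Y: "closed Y" "csubspace Y" and kato: "kato Y T"
  obtains e where "0 < e"
    "\<And>l i. cmod l < e \<Longrightarrow> shift T l \<in> regularity i Y \<longleftrightarrow> T \<in> regularity i Y"
proof -
  have "closed (T ` Y)" using kato T(2) Y(1) closedin_closed_eq unfolding kato_def by blast
  moreover have "kernel_on Y T \<subseteq> (T ^^ n) ` Y" for n using kato by (simp add: kato_def)
  ultimately obtain e K where e: "0 < e" "0 < K"
    "\<And>l. cmod l < e \<Longrightarrow> bounded_solvable K Y (shift T l)"
    using kato_uniformly_solvable[OF T Y] by metis
  have sh: "shift T l \<in> bounded_ops UNIV" "shift T l ` Y \<subseteq> Y" for l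
    by (rule bounded_ops_diff_scaleC[OF T(1)], rule shift_image_subset[OF Y(2) T(2)])
  have loc: "\<exists>r>0. \<forall>l. cmod l < r \<longrightarrow> bounded_solvable K Y (shift (shift T m) l)"
    if "m \<in> ball 0 e" for m
  proof (intro exI conjI allI impI)
    show "0 < e - cmod m" using that by simp
    fix l assume "cmod l < e - cmod m"
    then have "cmod (m + l) < e" using norm_triangle_ineq[of m l] by simp
    then show "bounded_solvable K Y (shift (shift T m) l)" unfolding shift_shift by (rule e(3))
  qed
  have solm: "bounded_solvable K Y (shift T m)" if "m \<in> ball 0 e" for m using e(3) that by simp
  \<comment> \<open>Changes the centre: shifts of \<open>shift T m\<close> are shifts of
    \<open>T\<close> by points near \<open>m\<close>.\<close>
  have conv: "(\<exists>d>0. \<forall>l'. dist l' m < d \<longrightarrow> P (shift T l'))"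
    if "0 < d" "\<And>l. cmod l < d \<Longrightarrow> P (shift (shift T m) l)" for P d m
  proof (intro exI conjI allI impI)
    fix l' assume "dist l' m < d"
    then show "P (shift T l')"
      using that(2)[of "l' - m"] unfolding shift_shift by (simp add: dist_norm)
  qed (rule that)
  have nul: "nullity Y (shift T l) = nullity Y (shift T 0)" if l: "cmod l < e" for l
  proof (rule enat_locally_constant_imp_constant[of "ball 0 e"])
    fix m :: complex and k assume m: "m \<in> ball 0 e" and k: "enat k \<le> nullity Y (shift T m)"
    obtain r where r: "0 < r" "\<And>l. cmod l < r \<Longrightarrow> bounded_solvable K Y (shift (shift T m) l)"
      using loc[OF m] by blast
    obtain d where "0 < d" "\<And>l. cmod l < d \<Longrightarrow> enat k \<le> nullity Y (shift (shift T m) l)"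
      using nullity_lower_semicontinuous[OF sh(1) Y(2) r e(2) k] by blast
    then show "\<exists>d>0. \<forall>y. dist y m < d \<longrightarrow> enat k \<le> nullity Y (shift T y)"
      by (rule conv)
  next
    fix m :: complex assume m: "m \<in> ball 0 e" and k: "nullity Y (shift T m) < \<infinity>"
    obtain d where "0 < d" "\<And>l. cmod l < d \<Longrightarrow> nullity Y (shift (shift T m) l) \<le> nullity Y (shift T m)"
      using nullity_upper_semicontinuous[OF sh Y(2) solm[OF m] e(2) k] by blast
    then show "\<exists>d>0. \<forall>y. dist y m < d \<longrightarrow> nullity Y (shift T y) \<le> nullity Y (shift T m)"
      by (rule conv)
  qed (use l e in auto)
  have def: "defect Y (shift T l) = defect Y (shift T 0)" if l: "cmod l < e" for l
  proof (rule enat_locally_constant_imp_constant[of "ball 0 e"])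
    fix m :: complex and k assume m: "m \<in> ball 0 e" and k: "enat k \<le> defect Y (shift T m)"
    obtain r where r: "0 < r" "\<And>l. cmod l < r \<Longrightarrow> bounded_solvable K Y (shift (shift T m) l)"
      using loc[OF m] by blast
    obtain d where "0 < d" "\<And>l. cmod l < d \<Longrightarrow> enat k \<le> defect Y (shift (shift T m) l)"
      using defect_lower_semicontinuous[OF sh Y r e(2) k] by blast
    then show "\<exists>d>0. \<forall>y. dist y m < d \<longrightarrow> enat k \<le> defect Y (shift T y)"
      by (rule conv)
  next
    fix m :: complex assume m: "m \<in> ball 0 e" and k: "defect Y (shift T m) < \<infinity>"
    obtain r where r: "0 < r" "\<And>l. cmod l < r \<Longrightarrow> bounded_solvable K Y (shift (shift T m) l)"
      using loc[OF m] by blast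
    obtain d where "0 < d" "\<And>l. cmod l < d \<Longrightarrow> defect Y (shift (shift T m) l) \<le> defect Y (shift T m)"
      using defect_upper_semicontinuous[OF sh Y r e(2) k] by blast
    then show "\<exists>d>0. \<forall>y. dist y m < d \<longrightarrow> defect Y (shift T y) \<le> defect Y (shift T m)"
      by (rule conv)
  qed (use l e in auto)
  have cl: "closed (shift T l ` Y)" if "cmod l < e" for l
    using bounded_solvable_imp_closed[OF sh(1) Y e(3)[OF that]] .
  have "shift T l \<in> regularity i Y \<longleftrightarrow> shift T 0 \<in> regularity i Y" if l: "cmod l < e" for l i
  proof -
    have "closed (shift T l ` Y) = closed (shift T 0 ` Y)" using cl[OF l] cl[of 0] e(1) by simp
    then show ?thesis unfolding regularity_iff[OF Y(1) sh] by (simp only: nul[OF l] def[OF l])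
  qed
  then show thesis using that e(1) by (simp add: shift_zero)
qed

section \<open>Kato decomposition of semi-Fredholm operators\<close>

text \<open>\<open>T x + w\<close> maps the product of \<open>Y\<close> and a complement
  \<open>W\<close> onto \<open>Y\<close>, with bounded lifts by the open mapping theorem. For
  \<open>y\<close> in the range the component in \<open>W\<close> must vanish, so the lift solves
  \<open>T x = y\<close>.\<close>

lemma closed_range_of_finite_defect:
  fixes T :: "'a::complex_banach \<Rightarrow> 'a"
  assumes T: "T \<in> bounded_ops UNIV" "T ` Y \<subseteq> Y" and Y: "closed Y" "csubspace Y"
    and fin: "defect Y T < \<infinity>"
  shows "closed (T ` Y)"
proof -
  note TD = bounded_ops_UNIV_D[OF T(1)]
  have TY: "csubspace (T ` Y)" by (rule csubspace_image[OF TD(7) Y(2)])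
  obtain W where W: "direct_sum Y (T ` Y) W" using complement_exists[OF TY Y(2) T(2)] .
  note WD = direct_sumD[OF W]
  have "edim W < \<infinity>" using fin by (simp add: defect_def ecodim_eq[OF W])
  then have clW: "closed W" by (rule closed_finite_dim[OF WD(2)])
  define F :: "'a \<times> 'a \<Rightarrow> 'a" where "F = (\<lambda>p. T (fst p) + snd p)"
  have F: "bounded_linear F" unfolding F_def
    by (intro bounded_linear_add bounded_linear_compose[OF TD(1)] bounded_linear_fst bounded_linear_snd)
  have E: "closed (Y \<times> W)" "subspace (Y \<times> W)"
    using Y clW WD by (auto intro: closed_Times subspace_Times csubspace_imp_subspace)
  have FE: "F ` (Y \<times> W) = Y"
  proof
    show "F ` (Y \<times> W) \<subseteq> Y"
      using T(2) WD(7) complex_vector.subspace_add[OF Y(2)] by (force simp: F_def)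
    show "Y \<subseteq> F ` (Y \<times> W)"
    proof
      fix y assume "y \<in> Y"
      then obtain x w where "y = T x + w" "x \<in> Y" "w \<in> W" using WD(4) by blast
      then show "y \<in> F ` (Y \<times> W)" by (intro image_eqI[of _ _ "(x, w)"]) (auto simp: F_def)
    qed
  qed
  obtain C where C: "\<And>y. y \<in> Y \<Longrightarrow> \<exists>p\<in>Y \<times> W. F p = y \<and> norm p \<le> C * norm y"
    using open_mapping_bound[OF F E] Y(1) unfolding FE by blast
  have "bounded_solvable C Y T" unfolding bounded_solvable_def
  proof
    fix y assume y: "y \<in> T ` Y"
    then obtain p where p: "p \<in> Y \<times> W" "F p = y" "norm p \<le> C * norm y" using C T(2) by blast
    have "snd p = y - T (fst p)" using p(2) by (auto simp: F_def)
    then have "snd p \<in> T ` Y" using y p(1) complex_vector.subspace_diff[OF TY] by auto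
    then have "snd p \<in> T ` Y \<inter> W" using p(1) by auto
    then have "snd p = 0" unfolding WD(3) by simp
    then have "T (fst p) = y" using p(2) by (simp add: F_def)
    moreover have "norm (fst p) \<le> C * norm y" using p(3) norm_fst_le[of "fst p" "snd p"] by simp
    ultimately show "\<exists>x\<in>Y. T x = y \<and> norm x \<le> C * norm y" using p(1) by auto
  qed
  then show ?thesis by (rule bounded_solvable_imp_closed[OF T(1) Y])
qed

text \<open>The functional \<open>f\<close> vanishes on \<open>(T ^^ Suc k) ` M\<close> and is \<open>1\<close> at the end \<open>(T ^^ k) x\<close> of a
  Jordan chain. The functionals \<open>f \<circ> T ^^ j\<close> are then triangular with respect to the chain, so
  their common kernel is an invariant complement of its span.\<close>

lemma jordan_chain_splitting:
  fixes T :: "'a::complex_banach \<Rightarrow> 'a"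
  assumes T: "T \<in> bounded_ops UNIV" "T ` M \<subseteq> M" and M: "closed M" "csubspace M"
    and cl: "closed (T ` M)" and not_kato: "\<not> kernel_on M T \<subseteq> (T ^^ n) ` M"
  obtains M' L k where "direct_sum M M' L" "closed M'" "T ` M' \<subseteq> M'" "T ` L \<subseteq> L" "edim L < \<infinity>"
    "\<forall>v\<in>L. (T ^^ k) v = 0" "closed (T ` M')"
    "nullity M T = nullity M' T + 1" "defect M T = defect M' T + 1"
proof -
  note TD = bounded_ops_UNIV_D[OF T(1)]
  note TnD = bounded_ops_UNIV_D[OF bounded_ops_funpow[OF T(1)]]
  \<comment> \<open>The least failing exponent: the kernel lies in the ranges of all smaller powers,
    which both starts the chain at some \<open>x\<close> with \<open>(T ^^ k) x = u\<close> and
    makes the range of \<open>T ^^ Suc k\<close> closed, as the functional requires.\<close>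
  define n' where "n' = (LEAST n. \<not> kernel_on M T \<subseteq> (T ^^ n) ` M)"
  have n': "\<not> kernel_on M T \<subseteq> (T ^^ n') ` M" "\<And>j. j < n' \<Longrightarrow> kernel_on M T \<subseteq> (T ^^ j) ` M"
    using LeastI[of "\<lambda>n. \<not> kernel_on M T \<subseteq> (T ^^ n) ` M", OF not_kato] not_less_Least
    unfolding n'_def by blast+
  have "n' \<noteq> 0" using n'(1) by (auto simp: kernel_on_def intro!: notI)
  then obtain k where k: "n' = Suc k" using not0_implies_Suc by blast
  obtain u where u: "u \<in> kernel_on M T" "u \<notin> (T ^^ Suc k) ` M" using n'(1) k by blast
  then obtain x where x: "x \<in> M" "u = (T ^^ k) x" using n'(2)[of k] k by blast
  have Tx: "(T ^^ Suc k) x = 0" using u(1) x(2) by (simp add: kernel_on_def)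
  obtain K where K: "0 < K" "bounded_solvable K M T" using closed_imp_bounded_solvable[OF T(1) M cl] .
  have clR: "closed ((T ^^ Suc k) ` M)"
    using bounded_solvable_imp_closed[OF bounded_ops_funpow[OF T(1)] M
        bounded_solvable_funpow[OF T M(2) K(2,1)]] n'(2) unfolding k by blast
  obtain f :: "'a \<Rightarrow> complex" where f: "bounded_linear f" "\<And>c x. f (c *\<^sub>C x) = c * f x"
    "\<And>y. y \<in> (T ^^ Suc k) ` M \<Longrightarrow> f y = 0" "f u = 1"
    using hahn_banach_functional[OF clR csubspace_image[OF TnD(7) M(2)] u(2)] by blast
  interpret f: bounded_linear f by fact
  have Tin: "(T ^^ j) y \<in> M" if "y \<in> M" for j y using funpow_image_subset[OF T(2), of j] that by blast
  have fM: "f ((T ^^ j) y) = 0" if "y \<in> M" "k < j" for j y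
  proof -
    have "(T ^^ j) y = (T ^^ Suc k) ((T ^^ (j - Suc k)) y)"
      using that(2) by (metis Suc_leI comp_apply funpow_add le_add_diff_inverse)
    then show ?thesis using f(3) Tin[OF that(1)] by simp
  qed
  \<comment> \<open>The triangular matrix of the chain: 1 on the antidiagonal
    \<open>i + j = k\<close>, 0 beyond it.\<close>
  have fx: "f ((T ^^ j) ((T ^^ i) x)) = (if i + j = k then 1 else 0)" if "k \<le> i + j" for i j
  proof (cases "i + j = k")
    case True
    then have "(T ^^ j) ((T ^^ i) x) = u" by (metis x(2) add.commute comp_apply funpow_add)
    then show ?thesis using True f(4) by simp
  next
    case False
    have "f ((T ^^ (j + i)) x) = 0" by (rule fM) (use that False x(1) in auto)
    then show ?thesis using False by (simp add: funpow_add)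
  qed
  \<comment> \<open>Tails of the chain; \<open>G 0\<close> is all of it and \<open>G (Suc k)\<close>
    is empty.\<close>
  define G where "G m = (\<lambda>i. (T ^^ i) x) ` {m..k}" for m
  define L where "L = cspan (G 0)"
  have L: "csubspace L" unfolding L_def by (rule complex_vector.subspace_span)
  have Lf: "edim L < \<infinity>" unfolding edim_finite_iff L_def G_def by blast
  have gL: "(T ^^ i) x \<in> L" if "i \<le> k" for i
    unfolding L_def G_def using that by (intro complex_vector.span_base) auto
  have LM: "L \<subseteq> M" unfolding L_def G_def using Tin x(1) by (intro complex_vector.span_minimal M(2)) auto
  have ker_sub: "csubspace {v. f ((T ^^ j) v) = 0}" for j
    by (auto simp: complex_vector.subspace_def TnD f.add f(2) f.zero)
  have TL: "T ` L \<subseteq> L"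
  proof -
    have "L \<subseteq> {v. T v \<in> L}" unfolding L_def
    proof (rule complex_vector.span_minimal)
      show "csubspace {v. T v \<in> cspan (G 0)}" by (intro csubspace_vimage TD complex_vector.subspace_span)
      show "G 0 \<subseteq> {v. T v \<in> cspan (G 0)}"
      proof
        fix v assume "v \<in> G 0"
        then obtain i where i: "i \<le> k" "v = (T ^^ i) x" by (auto simp: G_def)
        then have "T v = (T ^^ Suc i) x" by simp
        then have "T v \<in> L" using gL[of "Suc i"] i(1) Tx complex_vector.subspace_0[OF L]
          by (cases "i = k") auto
        then show "v \<in> {v. T v \<in> cspan (G 0)}" by (simp add: L_def)
      qed
    qed
    then show ?thesis by blast
  qed
  have uniq: "v = 0" if v: "v \<in> L" "\<And>j. j \<le> k \<Longrightarrow> f ((T ^^ j) v) = 0" for v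
  proof -
    have "v \<in> cspan (G m)" if "m \<le> Suc k" for m
      using that
    proof (induction m)
      case 0
      then show ?case using v(1) by (simp add: L_def)
    next
      case (Suc m)
      have "G m = insert ((T ^^ m) x) (G (Suc m))"
        using Suc.prems by (auto simp: G_def Icc_eq_insert_lb_nat)
      then have "v \<in> cspan (insert ((T ^^ m) x) (G (Suc m)))" using Suc by simp
      then obtain c where c: "v - c *\<^sub>C (T ^^ m) x \<in> cspan (G (Suc m))"
        unfolding complex_vector.span_breakdown_eq by blast
      \<comment> \<open>On the tail after position \<open>m\<close> the functional
        \<open>f \<circ> T ^^ (k - m)\<close> vanishes, so it isolates the coefficient of
        \<open>(T ^^ m) x\<close>.\<close>
      have "cspan (G (Suc m)) \<subseteq> {w. f ((T ^^ (k - m)) w) = 0}"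
        using Suc.prems fx by (intro complex_vector.span_minimal ker_sub) (auto simp: G_def)
      then have "f ((T ^^ (k - m)) (v - c *\<^sub>C (T ^^ m) x)) = 0" using c by blast
      then have "c = 0" using v(2)[of "k - m"] fx[of m "k - m"] Suc.prems by (simp add: TnD f.diff f(2))
      then show ?case using c by simp
    qed
    from this[of "Suc k"] show ?thesis by (simp add: G_def)
  qed
  define M' where "M' = M \<inter> (\<Inter>j\<in>{..k}. {v. f ((T ^^ j) v) = 0})"
  have M'iff: "y \<in> M' \<longleftrightarrow> y \<in> M \<and> (\<forall>j\<le>k. f ((T ^^ j) y) = 0)" for y by (auto simp: M'_def)
  have subM': "csubspace M'" unfolding M'_def
    using ker_sub by (intro complex_vector.subspace_inter M(2) complex_vector.subspace_Inter) auto
  have "closed {v. f ((T ^^ j) v) = 0}" for j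
    using continuous_closed_vimage[OF closed_singleton linear_continuous_at[OF
        bounded_linear_compose[OF f(1) TnD(1)]]]
    by (simp add: vimage_def)
  then have clM': "closed M'" unfolding M'_def using M(1) by (intro closed_Int closed_INT) auto
  \<comment> \<open>Applying \<open>T\<close> moves each functional to the next one, and the one
    beyond the last, \<open>f \<circ> T ^^ Suc k\<close>, vanishes on all of
    \<open>M\<close>.\<close>
  have TM': "T ` M' \<subseteq> M'"
  proof safe
    fix y assume y: "y \<in> M'"
    have "f ((T ^^ j) (T y)) = 0" if "j \<le> k" for j
    proof -
      have "(T ^^ j) (T y) = (T ^^ Suc j) y" by (simp add: funpow_swap1)
      then show ?thesis using y fM[of y "Suc j"] that by (cases "j = k") (auto simp: M'iff simp del: funpow.simps)
    qed
    then show "T y \<in> M'" using y T(2) by (auto simp: M'iff)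
  qed
  have M'L: "M' \<inter> L = {0}"
    using uniq complex_vector.subspace_0[OF L] complex_vector.subspace_0[OF subM'] by (auto simp: M'iff)
  have ex: "\<exists>v\<in>L. \<forall>j\<le>k. k < j + m \<longrightarrow> f ((T ^^ j) (y - v)) = 0" if "y \<in> M" "m \<le> Suc k" for y m
    using that(2)
  proof (induction m)
    case 0
    then show ?case using complex_vector.subspace_0[OF L] by auto
  next
    case (Suc m)
    then obtain v where v: "v \<in> L" "\<And>j. j \<le> k \<Longrightarrow> k < j + m \<Longrightarrow> f ((T ^^ j) (y - v)) = 0" by auto
    \<comment> \<open>The functionals are cleared from \<open>j = k\<close> downwards: a multiple of
      \<open>(T ^^ m) x\<close> corrects the value at \<open>j = k - m\<close> and leaves larger
      \<open>j\<close> unchanged, since there \<open>j + m\<close> exceeds \<open>k\<close>.\<close>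
    define c where "c = f ((T ^^ (k - m)) (y - v))"
    have "v + c *\<^sub>C (T ^^ m) x \<in> L"
      using v(1) gL[of m] Suc.prems
      by (intro complex_vector.subspace_add[OF L] complex_vector.subspace_scale[OF L]) auto
    moreover have "f ((T ^^ j) (y - (v + c *\<^sub>C (T ^^ m) x))) = 0" if j: "j \<le> k" "k < j + Suc m" for j
    proof -
      have "f ((T ^^ j) (y - (v + c *\<^sub>C (T ^^ m) x)))
        = f ((T ^^ j) (y - v)) - c * f ((T ^^ j) ((T ^^ m) x))"
        by (simp add: diff_diff_add[symmetric] TnD f.diff f(2))
      also have "\<dots> = 0"
      proof (cases "j = k - m")
        case True
        then show ?thesis using fx[of m j] Suc.prems by (simp add: c_def)
      next
        case False
        then show ?thesis using fx[of m j] v(2)[of j] j by auto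
      qed
      finally show ?thesis .
    qed
    ultimately show ?case by blast
  qed
  have sum: "M = sumset M' L"
  proof
    show "M \<subseteq> sumset M' L"
    proof
      fix y assume y: "y \<in> M"
      then obtain v where v: "v \<in> L" "\<forall>j\<le>k. f ((T ^^ j) (y - v)) = 0" using ex[of y "Suc k"] by auto
      have "y - v \<in> M'" using y v LM complex_vector.subspace_diff[OF M(2)] by (auto simp: M'iff)
      moreover have "y = (y - v) + v" by simp
      ultimately show "y \<in> sumset M' L" using v(1) by blast
    qed
    show "sumset M' L \<subseteq> M" using LM complex_vector.subspace_add[OF M(2)] by (auto simp: M'iff)
  qed
  have ds: "direct_sum M M' L" unfolding direct_sum_def using subM' L M'L sum by blast
  \<comment> \<open>Writes the image of \<open>M'\<close> as an intersection of two closed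
    sets.\<close>
  have "T ` M' = T ` M \<inter> M'"
  proof
    show "T ` M \<inter> M' \<subseteq> T ` M'"
    proof safe
      fix m assume m: "m \<in> M" "T m \<in> M'"
      then obtain a v where av: "m = a + v" "a \<in> M'" "v \<in> L" unfolding sum by blast
      have "T v = T m - T a" using av(1) by (simp add: TD)
      then have "T v \<in> M'" using m(2) av(2) TM' complex_vector.subspace_diff[OF subM'] by auto
      then have "T v \<in> M' \<inter> L" using av(3) TL by blast
      then have "T v = 0" unfolding M'L by simp
      then show "T m \<in> T ` M'" using av by (simp add: TD)
    qed
  qed (use TM' in \<open>auto simp: M'iff\<close>)
  then have clTM': "closed (T ` M')" using cl clM' by (simp add: closed_Int)
  have nilp: "(T ^^ Suc k) v = 0" if "v \<in> L" for v
  proof -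
    have "L \<subseteq> {v. (T ^^ Suc k) v \<in> {0}}" unfolding L_def
    proof (rule complex_vector.span_minimal)
      show "csubspace {v. (T ^^ Suc k) v \<in> {0}}"
        by (intro csubspace_vimage TnD complex_vector.subspace_single_0)
      have "(T ^^ Suc k) ((T ^^ i) x) = 0" for i
      proof -
        have "(T ^^ Suc k) ((T ^^ i) x) = (T ^^ i) ((T ^^ Suc k) x)"
          by (metis add.commute comp_apply funpow_add)
        then show ?thesis unfolding Tx by (simp add: TnD)
      qed
      then show "G 0 \<subseteq> {v. (T ^^ Suc k) v \<in> {0}}" unfolding G_def by blast
    qed
    then show ?thesis using that by blast
  qed
  have "u \<noteq> 0" using f(4) f.zero by auto
  have "x \<noteq> 0" using \<open>u \<noteq> 0\<close> x(2) TnD(5) by auto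
  have "nullity L T = 1"
  proof -
    have "kernel_on L T = cspan {u}"
    proof
      show "kernel_on L T \<subseteq> cspan {u}"
      proof
        fix v assume "v \<in> kernel_on L T"
        then have v: "v \<in> L" "T v = 0" by (auto simp: kernel_on_def)
        have z: "(T ^^ j) w = 0" if "T w = 0" "j \<noteq> 0" for j w
        proof -
          obtain i where "j = Suc i" using \<open>j \<noteq> 0\<close> not0_implies_Suc by blast
          then show ?thesis using \<open>T w = 0\<close> by (simp add: funpow_swap1 TnD)
        qed
        \<comment> \<open>On a kernel vector only the functional with \<open>j = 0\<close> can be
          nonzero, and subtracting \<open>f v *\<^sub>C u\<close> clears it.\<close>
        have "v - f v *\<^sub>C u = 0"
        proof (rule uniq)
          show "v - f v *\<^sub>C u \<in> L"
            using v(1) gL[of k] x(2)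
            by (intro complex_vector.subspace_diff[OF L] complex_vector.subspace_scale[OF L]) auto
          have "T (v - f v *\<^sub>C u) = 0" using v(2) u(1) by (simp add: TD kernel_on_def)
          then show "f ((T ^^ j) (v - f v *\<^sub>C u)) = 0" for j
            using z[of "v - f v *\<^sub>C u" j] f(4) by (cases "j = 0") (auto simp: f.diff f(2) f.zero)
        qed
        then have "v = f v *\<^sub>C u" by simp
        then show "v \<in> cspan {u}" by (metis complex_vector.span_base complex_vector.span_scale singletonI)
      qed
      show "cspan {u} \<subseteq> kernel_on L T"
        using u(1) gL[of k] x(2)
        by (intro complex_vector.span_minimal kernel_on_csubspace[OF TD(7) L]) (auto simp: kernel_on_def)
    qed
    then show ?thesis using edim_cspan_singleton[OF \<open>u \<noteq> 0\<close>] by (simp add: nullity_def)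
  qed
  moreover have "defect L T = 1"
  proof -
    have sTL: "csubspace (T ` L)" by (rule csubspace_image[OF TD(7) L])
    \<comment> \<open>Only the starting vector \<open>x\<close> is missing from the image of the
      chain; \<open>f \<circ> T ^^ k\<close> is 1 at \<open>x\<close> and 0 on that image.\<close>
    have "direct_sum L (T ` L) (cspan {x})" unfolding direct_sum_def
    proof (intro conjI sTL complex_vector.subspace_span)
      have "v = 0" if v: "v \<in> T ` L" "v \<in> cspan {x}" for v
      proof -
        obtain c where c: "v = c *\<^sub>C x" using v(2) by (auto simp: complex_vector.span_singleton)
        obtain w where w: "w \<in> L" "v = T w" using v(1) by blast
        have "f ((T ^^ k) v) = f ((T ^^ Suc k) w)" unfolding w(2) by (simp add: funpow_swap1)
        also have "\<dots> = 0" using fM[of w "Suc k"] w(1) LM by blast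
        finally have "c = 0" using f(4) x(2) by (simp add: c TnD f(2))
        then show ?thesis by (simp add: c)
      qed
      then show "T ` L \<inter> cspan {x} = {0}"
        using complex_vector.subspace_0[OF sTL] complex_vector.span_zero by blast
      have xL: "x \<in> L" using gL[of 0] by simp
      show "L = sumset (T ` L) (cspan {x})"
      proof
        show "sumset (T ` L) (cspan {x}) \<subseteq> L"
          using TL complex_vector.span_minimal[OF _ L, of "{x}"] xL complex_vector.subspace_add[OF L] by blast
        have "G 0 \<subseteq> sumset (T ` L) (cspan {x})"
        proof
          fix v assume "v \<in> G 0"
          then obtain i where i: "i \<le> k" "v = (T ^^ i) x" by (auto simp: G_def)
          show "v \<in> sumset (T ` L) (cspan {x})"
          proof (cases i)
            case 0
            then have "v \<in> cspan {x}" using i by (simp add: complex_vector.span_base)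
            then show ?thesis using subset_sumset2[OF sTL] by blast
          next
            case (Suc j)
            then have "v = T ((T ^^ j) x)" using i by simp
            then have "v \<in> T ` L" using gL[of j] Suc i(1) by auto
            then show ?thesis using subset_sumset1[OF complex_vector.subspace_span] by blast
          qed
        qed
        then show "L \<subseteq> sumset (T ` L) (cspan {x})" unfolding L_def
          by (intro complex_vector.span_minimal complex_vector.subspace_sums
              complex_vector.subspace_span sTL[unfolded L_def])
      qed
    qed
    then show ?thesis
      using edim_cspan_singleton[OF \<open>x \<noteq> 0\<close>] by (simp add: defect_def ecodim_eq)
  qed
  ultimately have "nullity M T = nullity M' T + 1" "defect M T = defect M' T + 1"
    using nullity_direct_sum[OF ds TD(7) TM' TL] defect_direct_sum[OF ds TD(7) TM' TL] by simp_all
  then show thesis using that[OF ds clM' TM' TL Lf ballI[OF nilp] clTM'] by blast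
qed

lemma direct_sum_refine:
  assumes MN: "direct_sum Y M N" and M: "direct_sum M M' L"
  shows "direct_sum Y M' (sumset N L)"
proof -
  note D = direct_sumD[OF MN] and E = direct_sumD[OF M]
  have "x = 0" if x: "x \<in> M'" "x \<in> sumset N L" for x
  proof -
    obtain n v where nv: "x = n + v" "n \<in> N" "v \<in> L" using x(2) by blast
    have "n = x - v" using nv(1) by simp
    then have "n \<in> M" using x(1) nv(3) E(6,7) complex_vector.subspace_diff[OF D(1)] by blast
    then have "n \<in> M \<inter> N" using nv(2) by (rule IntI)
    then have "n = 0" unfolding D(3) by simp
    then have "x \<in> M' \<inter> L" using x(1) nv by simp
    then show ?thesis unfolding E(3) by simp
  qed
  moreover have S: "csubspace (sumset N L)" by (rule complex_vector.subspace_sums[OF D(2) E(2)])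
  moreover have "Y = sumset M' (sumset N L)"
  proof
    show "Y \<subseteq> sumset M' (sumset N L)"
    proof
      fix y assume "y \<in> Y"
      then obtain m n where y: "y = m + n" "m \<in> M" "n \<in> N" using D(4) by blast
      then obtain a v where a: "m = a + v" "a \<in> M'" "v \<in> L" using E(4) by blast
      have "y = a + (n + v)" using y a by (simp add: algebra_simps)
      then show "y \<in> sumset M' (sumset N L)" using y a by blast
    qed
    have "sumset N L \<subseteq> Y" using D(6,7) E(7) complex_vector.subspace_add[OF D(5)] by blast
    then show "sumset M' (sumset N L) \<subseteq> Y"
      using D(6) E(6) complex_vector.subspace_add[OF D(5)] by blast
  qed
  ultimately show ?thesis
    using E(1) complex_vector.subspace_0[OF E(1)] complex_vector.subspace_0[OF S]
    unfolding direct_sum_def by blast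
qed

text \<open>Each Jordan block moves from \<open>M\<close> to the quasinilpotent side and lowers
  nullity and defect together, so induction on whichever of them is finite ends with a Kato
  restriction in the same class.\<close>

lemma regular_kato_decomposition:
  fixes T :: "'a::complex_banach \<Rightarrow> 'a"
  assumes T: "T \<in> bounded_ops UNIV" and MN: "(M, N) \<in> Red T"
    and reg: "T \<in> regularity i M" and qn: "quasinilpotent N T"
  obtains M' N' where "(M', N') \<in> Red T" "kato M' T" "T \<in> regularity i M'" "quasinilpotent N' T"
proof -
  note TD = bounded_ops_UNIV_D[OF T]
  have main: "\<exists>M' N'. (M', N') \<in> Red T \<and> kato M' T \<and> T \<in> regularity i M' \<and> quasinilpotent N' T"
    if "(M, N) \<in> Red T" "T \<in> regularity i M" "quasinilpotent N T" "closed (T ` M)"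
      "nullity M T = enat k \<or> defect M T = enat k" for M N k
    using that
  proof (induction k arbitrary: M N rule: less_induct)
    case (less k)
    note R = less.prems(1) and reg = less.prems(2) and qn = less.prems(3)
      and cl = less.prems(4) and fin = less.prems(5)
    have MN: "closed M" "closed N" "T ` M \<subseteq> M" "T ` N \<subseteq> N" "direct_sum UNIV M N"
      using R by (auto simp: Red_def)
    note D = direct_sumD[OF MN(5)]
    show "\<exists>M' N'. (M', N') \<in> Red T \<and> kato M' T \<and> T \<in> regularity i M' \<and> quasinilpotent N' T"
    proof (cases "\<forall>n. kernel_on M T \<subseteq> (T ^^ n) ` M")
      case True
      then have "kato M T"
        using bounded_ops_subspace[OF T MN(3)] cl closed_subset[OF MN(3) cl] by (simp add: kato_def)
      then show ?thesis using R reg qn by blast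
    next
      case False
      then obtain n where nk: "\<not> kernel_on M T \<subseteq> (T ^^ n) ` M" by blast
      obtain M' L j where S: "direct_sum M M' L" "closed M'" "T ` M' \<subseteq> M'" "T ` L \<subseteq> L" "edim L < \<infinity>"
        "\<forall>v\<in>L. (T ^^ j) v = 0" "closed (T ` M')"
        "nullity M T = nullity M' T + 1" "defect M T = defect M' T + 1"
        using jordan_chain_splitting[OF T MN(3,1) D(1) cl nk] .
      note E = direct_sumD[OF S(1)]
      obtain Q where Q: "Q \<in> bounded_ops UNIV" "\<And>x. x \<in> N \<Longrightarrow> Q x = x" "\<And>x. x \<in> M \<Longrightarrow> Q x = 0"
        using closed_direct_sum_projection[OF direct_sum_commute[OF MN(5)] MN(2,1)] by metis
      have "quasinilpotent L T"
        by (rule quasinilpotent_of_nilpotent[OF T S(4) complex_vector.subspace_0[OF E(2)] S(6)[rule_format]])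
      then have "quasinilpotent (sumset N L) T"
        using quasinilpotent_sumset[OF T MN(4) S(4) D(2) E(2) Q(1,2) _ qn] Q(3) E(7) by blast
      moreover have "(M', sumset N L) \<in> Red T"
      proof -
        have "T ` sumset N L \<subseteq> sumset N L" using image_direct_sum[OF TD(7), of N L] MN(4) S(4) by blast
        then show ?thesis
          using S(2,3) closed_sumset_finite_dim[OF MN(2) D(2) E(2) S(5)] direct_sum_refine[OF MN(5) S(1)]
          by (simp add: Red_def)
      qed
      moreover have "T \<in> regularity i M'"
        using reg cl S(7) unfolding regularity_iff[OF MN(1) T MN(3)] regularity_iff[OF S(2) T S(3)]
          S(8,9) regular_data_Suc by simp
      moreover obtain k' where "k' < k" "nullity M' T = enat k' \<or> defect M' T = enat k'"
        using fin unfolding S(8,9)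
        by (cases "nullity M' T"; cases "defect M' T") (auto simp: one_enat_def)
      ultimately show ?thesis using less.IH[of k' M' "sumset N L"] S(7) by blast
    qed
  qed
  have M: "closed M" "T ` M \<subseteq> M" "csubspace M"
    using MN by (auto simp: Red_def direct_sum_def)
  have rd: "regular_data i (closed (T ` M)) (nullity M T) (defect M T)"
    using reg regularity_iff[OF M(1) T M(2)] by simp
  \<comment> \<open>Classes 1 and 4 include closedness; in the other four it follows from finite
    defect.\<close>
  have "closed (T ` M)"
    using rd closed_range_of_finite_defect[OF T M(2,1,3)] by (auto simp: regular_data_def)
  moreover obtain k where "nullity M T = enat k \<or> defect M T = enat k"
    using rd by (auto simp: regular_data_def)
  ultimately show thesis using main[OF MN reg qn] that by blast
qed

section \<open>The equivalences\<close>

text \<open>The given pair is refined to a Kato one in the same class. On a punctured disc the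
  shifts are then regular on \<open>M\<close> by stability and bijective on \<open>N\<close>, so
  they avoid the spectrum.\<close>

lemma gDR_imp_kato:
  fixes T :: "'a::complex_banach \<Rightarrow> 'a"
  assumes T: "T \<in> bounded_ops UNIV" and g: "T \<in> gDR i"
  shows "generalized_kato_decomposition T \<and> \<not> 0 islimpt regularity_spectrum i T"
proof -
  obtain M0 N0 where "(M0, N0) \<in> Red T" "T \<in> regularity i M0" "quasinilpotent N0 T"
    using g by (auto simp: gDR_def)
  then obtain M N where MN: "(M, N) \<in> Red T" "kato M T" "T \<in> regularity i M" "quasinilpotent N T"
    using regular_kato_decomposition[OF T] by metis
  then have R: "closed M" "closed N" "T ` M \<subseteq> M" "T ` N \<subseteq> N" "direct_sum UNIV M N"
    by (auto simp: Red_def)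
  note D = direct_sumD[OF R(5)]
  obtain e where e: "0 < e"
    "\<And>l i. cmod l < e \<Longrightarrow> shift T l \<in> regularity i M \<longleftrightarrow> T \<in> regularity i M"
    using kato_stable[OF T R(3,1) D(1) MN(2)] by blast
  have "l \<notin> regularity_spectrum i T" if "l \<noteq> 0" "cmod l < e" for l
  proof -
    have "shift T l \<in> regularity i UNIV"
      using regularity_direct_sum_bijective[OF R(5,1,2) bounded_ops_diff_scaleC[OF T]
          shift_image_subset[OF D(1) R(3)]
          quasinilpotent_diff_scaleC_bijective[OF T R(4) D(2) R(2) MN(4) that(1)]]
        e(2)[OF that(2)] MN(3) by blast
    then show ?thesis by (simp add: regularity_spectrum_def)
  qed
  then have "\<not> 0 islimpt regularity_spectrum i T"
    using e(1) unfolding islimpt_approachable by (metis dist_0_norm dist_commute)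
  then show ?thesis using MN by (auto simp: generalized_kato_decomposition_def)
qed

text \<open>A non-interior point leaves some regular shift \<open>l\<close> in the disc of
  stability, and stability carries the class of its restriction to \<open>M\<close> back from
  \<open>l\<close> to 0.\<close>

lemma kato_imp_gDR:
  fixes T :: "'a::complex_banach \<Rightarrow> 'a"
  assumes T: "T \<in> bounded_ops UNIV" and g: "generalized_kato_decomposition T"
    and int: "0 \<notin> interior (regularity_spectrum i T)"
  shows "T \<in> gDR i"
proof -
  obtain M N where MN: "(M, N) \<in> Red T" "kato M T" "quasinilpotent N T"
    using g by (auto simp: generalized_kato_decomposition_def)
  then have R: "closed M" "closed N" "T ` M \<subseteq> M" "T ` N \<subseteq> N" "direct_sum UNIV M N"
    by (auto simp: Red_def)
  note D = direct_sumD[OF R(5)]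
  obtain e where e: "0 < e"
    "\<And>l i. cmod l < e \<Longrightarrow> shift T l \<in> regularity i M \<longleftrightarrow> T \<in> regularity i M"
    using kato_stable[OF T R(3,1) D(1) MN(2)] by blast
  have "\<not> ball 0 e \<subseteq> regularity_spectrum i T" using int e(1) unfolding mem_interior by blast
  then obtain l where l: "cmod l < e" "shift T l \<in> regularity i UNIV"
    by (auto simp: regularity_spectrum_def)
  show ?thesis
  proof (cases "l = 0")
    \<comment> \<open>At \<open>l = 0\<close> the summand \<open>N\<close> need not be mapped
      bijectively, but \<open>T\<close> itself is regular and the trivial pair does.\<close>
    case True
    then have "T \<in> regularity i UNIV" using l(2) by simp
    moreover have "(UNIV, {0}) \<in> Red T"
      by (auto simp: Red_def direct_sum_def bounded_ops_UNIV_D[OF T] complex_vector.subspace_single_0)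
    moreover have "quasinilpotent {0} T"
      by (rule quasinilpotent_of_nilpotent[where k = 0]) (auto simp: T bounded_ops_UNIV_D[OF T])
    ultimately show ?thesis using T by (auto simp: gDR_def)
  next
    case False
    have "shift T l \<in> regularity i M"
      using regularity_direct_sum_bijective[OF R(5,1,2) bounded_ops_diff_scaleC[OF T]
          shift_image_subset[OF D(1) R(3)]
          quasinilpotent_diff_scaleC_bijective[OF T R(4) D(2) R(2) MN(3) False]] l(2) by blast
    then have "T \<in> regularity i M" using e(2)[OF l(1)] by blast
    then show ?thesis using T MN by (auto simp: gDR_def)
  qed
qed

section \<open>Commuting projections and reducing pairs\<close>

lemma regularity_add_projection:
  fixes T :: "'a::complex_banach \<Rightarrow> 'a"
  assumes T: "T \<in> bounded_ops UNIV" and MN: "(M, N) \<in> Red T" and qn: "quasinilpotent N T"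
    and P: "P \<in> bounded_ops UNIV" "\<And>x. x \<in> N \<Longrightarrow> P x = x" "\<And>x. x \<in> M \<Longrightarrow> P x = 0"
  shows "(\<lambda>x. T x + P x) \<in> regularity i UNIV \<longleftrightarrow> T \<in> regularity i M"
proof -
  let ?S = "\<lambda>x. T x + P x"
  have R: "closed M" "closed N" "T ` M \<subseteq> M" "T ` N \<subseteq> N" "direct_sum UNIV M N"
    using MN by (auto simp: Red_def)
  note D = direct_sumD[OF R(5)]
  \<comment> \<open>\<open>P\<close> is the identity on \<open>N\<close>, so there
    \<open>T + P\<close> is the shift by -1 of a quasinilpotent operator, hence bijective.\<close>
  have SN: "?S x = shift T (- 1) x" if "x \<in> N" for x
    using P(2)[OF that] by (simp add: scaleC_one)
  have "(- 1 :: complex) \<noteq> 0" by simp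
  note bij = quasinilpotent_diff_scaleC_bijective[OF T R(4) D(2) R(2) qn this]
  have SM: "?S x = T x" if "x \<in> M" for x using P(3)[OF that] by simp
  have "?S ` M \<subseteq> M" using R(3) SM by auto
  moreover have "?S ` N = N" using bij(1) SN by (metis (no_types, lifting) image_cong)
  moreover have "kernel_on N ?S = {0}"
  proof -
    have "kernel_on N ?S = kernel_on N (shift T (- 1))" using SN by (auto simp: kernel_on_def)
    then show ?thesis using bij(2) by simp
  qed
  ultimately have "?S \<in> regularity i UNIV \<longleftrightarrow> ?S \<in> regularity i M"
    by (rule regularity_direct_sum_bijective[OF R(5,1,2) bounded_ops_add[OF T P(1)]])
  also have "\<dots> \<longleftrightarrow> T \<in> regularity i M" by (rule regularity_cong[OF D(1) SM])
  finally show ?thesis .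
qed

text \<open>The exponent starts at 1 because the zeroth power of \<open>T \<circ> P\<close> is the
  identity and not \<open>P\<close>.\<close>

lemma funpow_compose_projection:
  assumes "\<And>x. x \<in> N \<Longrightarrow> P x = x" "\<And>x. P x \<in> N" "T ` N \<subseteq> N"
  shows "((T \<circ> P) ^^ Suc n) x = (T ^^ Suc n) (P x)"
proof (induction n)
  case (Suc n)
  have "(T ^^ Suc n) (P x) \<in> N" using funpow_image_subset[OF assms(3)] assms(2) by blast
  then have "P ((T ^^ Suc n) (P x)) = (T ^^ Suc n) (P x)" by (rule assms(1))
  then show ?case using Suc by simp
qed simp

lemma quasinilpotent_compose_projection:
  fixes T :: "'a::complex_normed_vector \<Rightarrow> 'a"
  assumes T: "T \<in> bounded_ops UNIV" "T ` N \<subseteq> N" and N: "0 \<in> N"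
    and P: "P \<in> bounded_ops UNIV" "\<And>x. x \<in> N \<Longrightarrow> P x = x" "\<And>x. P x \<in> N"
  shows "quasinilpotent UNIV (T \<circ> P) \<longleftrightarrow> quasinilpotent N T"
proof -
  note pow = funpow_compose_projection[where N = N, OF P(2,3) T(2)]
  have TP: "T \<circ> P \<in> bounded_ops UNIV" by (rule bounded_ops_compose[OF T(1) P(1)])
  obtain B where B: "0 < B" "\<And>x. norm (P x) \<le> B * norm x"
    using bounded_ops_norm_bound[OF P(1)] by blast
  show ?thesis
    unfolding quasinilpotent_iff[OF T N] quasinilpotent_iff[OF TP subset_UNIV UNIV_I]
  proof (intro iffI allI impI)
    fix e :: real assume e: "e > 0"
      and *: "\<forall>e>0. \<exists>C. \<forall>n. \<forall>x\<in>UNIV. norm (((T \<circ> P) ^^ n) x) \<le> C * e ^ n * norm x"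
    obtain C where C: "\<And>n x. norm (((T \<circ> P) ^^ n) x) \<le> C * e ^ n * norm x" using * e by blast
    have "((T \<circ> P) ^^ n) x = (T ^^ n) x" if "x \<in> N" for n x
      using pow[of _ x] P(2)[OF that] by (cases n) simp_all
    then have "norm ((T ^^ n) x) \<le> C * e ^ n * norm x" if "x \<in> N" for n x
      using C[of n x] that by simp
    then show "\<exists>C. \<forall>n. \<forall>x\<in>N. norm ((T ^^ n) x) \<le> C * e ^ n * norm x" by blast
  next
    fix e :: real assume e: "e > 0"
      and *: "\<forall>e>0. \<exists>C. \<forall>n. \<forall>x\<in>N. norm ((T ^^ n) x) \<le> C * e ^ n * norm x"
    obtain C where C: "\<And>n x. x \<in> N \<Longrightarrow> norm ((T ^^ n) x) \<le> C * e ^ n * norm x" using * e by blast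
    \<comment> \<open>The added 1 covers \<open>n = 0\<close>, where the power is the
      identity.\<close>
    have "norm (((T \<circ> P) ^^ n) x) \<le> (\<bar>C\<bar> * B + 1) * e ^ n * norm x" for n x
    proof (cases n)
      case 0
      have "0 \<le> \<bar>C\<bar> * B * norm x" using B(1) by simp
      then show ?thesis using 0 by (simp add: algebra_simps)
    next
      case (Suc m)
      have "((T \<circ> P) ^^ n) x = (T ^^ n) (P x)" unfolding Suc by (rule pow)
      then have "norm (((T \<circ> P) ^^ n) x) \<le> C * e ^ n * norm (P x)" using C[OF P(3)] by simp
      also have "\<dots> \<le> \<bar>C\<bar> * e ^ n * (B * norm x)"
        using e B by (intro mult_mono) auto
      also have "\<dots> \<le> (\<bar>C\<bar> * B + 1) * e ^ n * norm x"
        using e by (simp add: algebra_simps)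
      finally show ?thesis .
    qed
    then show "\<exists>C. \<forall>n. \<forall>x\<in>UNIV. norm (((T \<circ> P) ^^ n) x) \<le> C * e ^ n * norm x" by blast
  qed
qed

text \<open>\<open>P\<close> is the projection onto \<open>N\<close> along \<open>M\<close>:
  invariance of both summands amounts to commuting with \<open>T\<close>, and conversely the fixed
  vectors and the kernel of \<open>P\<close> recover \<open>N\<close> and \<open>M\<close>.\<close>

lemma gDR_iff_projection:
  fixes T :: "'a::complex_banach \<Rightarrow> 'a"
  assumes T: "T \<in> bounded_ops UNIV"
  shows "T \<in> gDR i \<longleftrightarrow> (\<exists>P \<in> bounded_ops UNIV. P \<circ> P = P \<and> P \<circ> T = T \<circ> P \<and>
    (\<lambda>x. T x + P x) \<in> regularity i UNIV \<and> quasinilpotent UNIV (T \<circ> P))"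
proof
  note TD = bounded_ops_UNIV_D[OF T]
  assume "T \<in> gDR i"
  then obtain M N where MN: "(M, N) \<in> Red T" "T \<in> regularity i M" "quasinilpotent N T"
    by (auto simp: gDR_def)
  then have R: "closed M" "closed N" "T ` M \<subseteq> M" "T ` N \<subseteq> N" "direct_sum UNIV M N"
    by (auto simp: Red_def)
  note D = direct_sumD[OF R(5)]
  obtain P where P: "P \<in> bounded_ops UNIV" "\<And>x. P x \<in> N" "\<And>x. x - P x \<in> M"
    "\<And>x. x \<in> N \<Longrightarrow> P x = x" "\<And>x. x \<in> M \<Longrightarrow> P x = 0"
    using closed_direct_sum_projection[OF direct_sum_commute[OF R(5)] R(2,1)] by blast
  have "P (T x) = T (P x)" for x
  proof -
    have "T (x - P x) \<in> M" "T (P x) \<in> N" using P(2,3) R(3,4) by blast+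
    then have "P (T (x - P x)) = 0" "P (T (P x)) = T (P x)" using P(4,5) by blast+
    then show ?thesis by (simp add: TD bounded_ops_UNIV_D[OF P(1)])
  qed
  then have "P \<circ> T = T \<circ> P" by (simp add: fun_eq_iff)
  moreover have "P \<circ> P = P" using P(2,4) by (simp add: fun_eq_iff)
  moreover have "(\<lambda>x. T x + P x) \<in> regularity i UNIV"
    using regularity_add_projection[OF T MN(1,3) P(1,4,5)] MN(2) by blast
  moreover have "quasinilpotent UNIV (T \<circ> P)"
    using quasinilpotent_compose_projection[OF T R(4) complex_vector.subspace_0[OF D(2)] P(1,4,2)] MN(3)
    by blast
  ultimately show "\<exists>P \<in> bounded_ops UNIV. P \<circ> P = P \<and> P \<circ> T = T \<circ> P \<and>
    (\<lambda>x. T x + P x) \<in> regularity i UNIV \<and> quasinilpotent UNIV (T \<circ> P)" using P(1) by blast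
next
  note TD = bounded_ops_UNIV_D[OF T]
  assume "\<exists>P \<in> bounded_ops UNIV. P \<circ> P = P \<and> P \<circ> T = T \<circ> P \<and>
    (\<lambda>x. T x + P x) \<in> regularity i UNIV \<and> quasinilpotent UNIV (T \<circ> P)"
  then obtain P where P: "P \<in> bounded_ops UNIV" "P \<circ> P = P" "P \<circ> T = T \<circ> P"
    "(\<lambda>x. T x + P x) \<in> regularity i UNIV" "quasinilpotent UNIV (T \<circ> P)" by blast
  note PD = bounded_ops_UNIV_D[OF P(1)]
  have PP: "P (P x) = P x" and PT: "P (T x) = T (P x)" for x
    using fun_cong[OF P(2), of x] fun_cong[OF P(3), of x] by simp_all
  define M where "M = {x. P x = 0}"
  define N where "N = {x. P x = x}"
  have "M = P -` {0}" "N = (\<lambda>x. x - P x) -` {0}" by (auto simp: M_def N_def)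
  then have cl: "closed M" "closed N"
    using continuous_closed_vimage[OF closed_singleton linear_continuous_at[OF PD(1)]]
      continuous_closed_vimage[OF closed_singleton
        linear_continuous_at[OF bounded_linear_sub[OF bounded_linear_ident PD(1)]]]
    by simp_all
  have inv: "T ` M \<subseteq> M" "T ` N \<subseteq> N" by (auto simp: M_def N_def PT TD)
  have "direct_sum UNIV M N" unfolding direct_sum_def
  proof (intro conjI)
    show "csubspace M" "csubspace N"
      by (auto simp: M_def N_def complex_vector.subspace_def PD)
    show "M \<inter> N = {0}" by (auto simp: M_def N_def PD)
    have "x = (x - P x) + P x" "x - P x \<in> M" "P x \<in> N" for x by (auto simp: M_def N_def PD PP)
    then show "UNIV = sumset M N" by blast
  qed
  then have MN: "(M, N) \<in> Red T" using cl inv by (simp add: Red_def)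
  have zN: "0 \<in> N" by (simp add: N_def PD)
  have PN: "P x = x" if "x \<in> N" for x using that by (simp add: N_def)
  have PM: "P x = 0" if "x \<in> M" for x using that by (simp add: M_def)
  have "P x \<in> N" for x by (simp add: N_def PP)
  then have qn: "quasinilpotent N T"
    using quasinilpotent_compose_projection[OF T inv(2) zN P(1) PN] P(5) by blast
  moreover have "T \<in> regularity i M"
    using regularity_add_projection[OF T MN qn P(1) PN PM] P(4) by blast
  ultimately show "T \<in> gDR i" using T MN unfolding gDR_def by blast
qed

theorem theorem3p3:
  fixes T :: "'a::complex_banach \<Rightarrow> 'a" and i :: nat
  assumes "edim (UNIV :: 'a set) = \<infinity>"
    and "T \<in> bounded_ops UNIV"
    and "1 \<le> i" and "i \<le> 6"
  shows "(T \<in> gDR i \<longleftrightarrow>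
           generalized_kato_decomposition T \<and> \<not> 0 islimpt regularity_spectrum i T) \<and>
         (T \<in> gDR i \<longleftrightarrow>
           generalized_kato_decomposition T \<and> 0 \<notin> interior (regularity_spectrum i T)) \<and>
         (T \<in> gDR i \<longleftrightarrow>
           (\<exists>P \<in> bounded_ops UNIV. P \<circ> P = P \<and> P \<circ> T = T \<circ> P \<and>
              (\<lambda>x. T x + P x) \<in> regularity i UNIV \<and> quasinilpotent UNIV (T \<circ> P)))"
proof -
  note T = assms(2)
  \<comment> \<open>Interior points of a set in the complex plane are limit points, so (ii) gives
    (iii) and closes the cycle (i), (ii), (iii), (i).\<close>
  have "0 \<notin> interior (regularity_spectrum i T)" if "\<not> 0 islimpt regularity_spectrum i T"
    using that interior_limit_point by blast
  then show ?thesis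
    using gDR_imp_kato[OF T] kato_imp_gDR[OF T] gDR_iff_projection[OF T] by blast
qed

end
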